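(* Let $(\mathcal X,\mathcal B,\mu)$ be a $\sigma$-finite measure space ($\mathcal X$ Polish) and let $\mathrm L$ be a non-negative self-adjoint operator on $L^2(\mu)$ generating a sub-Markovian semigroup and satisfying (A1)--(A3) of the context, with eigenvalues $0\le\lambda_1\le\lambda_2\le\cdots$, algebraic core $\mathcal A$ and carré du champ $\Gamma$. Let $n\ge 1$ (with $n\le \dim L^2(\mu)$) and let $\mathcal S_n$ be the spectral DPP of $\mathrm L$ of rank $n$. Let $f\in\mathcal A$ be such that $\|f\|_\infty<\infty$ and $\|\Gamma(f)\|_\infty<\infty$, and let $\alpha\in(0,1/2)$ be arbitrary. Put $$C_\alpha[f]:=\frac{2}{(1-2\alpha)\gamma(1-\alpha)}\,\|\Gamma(f)\|_\infty^{\alpha}\,\|f\|_\infty^{1-2\alpha},\qquad \gamma(z)=\int_0^\infty u^{z-1}e^{-u}\,du .$$ Then $$\mathrm{Var}[\mathcal S_n(f)]\le\sum_{k=1}^n\min\left\{\|f\|_\infty^2,\ \frac{C_\alpha[f]^2}{(\lambda_n^\alpha-\lambda_k^\alpha)^2}\right\},$$ where the fraction is interpreted as $+\infty$ whenever $\lambda_k=\lambda_n$. Consequently, $$\mathrm{Var}[\mathcal S_n(f)]\le\Big(\|f\|_\infty^2+\frac{\pi^2}{6}C_\alpha[f]^2\Big)R_{\mathrm L,\alpha}(n),$$ where, with $n_{\mathrm L}(\lambda):=\#\{k\ge1:\lambda_k\le\lambda\}$, $$R_{\mathrm L,\alpha}(n):=\max\Big\{n_{\mathrm L}(1);\ \max_{0\le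 p\le\lfloor\lambda_n^\alpha\rfloor-1}\big\{n_{\mathrm L}\big((\lambda_n^\alpha-p)^{1/\alpha}\big)-n_{\mathrm L}\big((\lambda_n^\alpha-p-1)^{1/\alpha}\big)\big\}\Big\}$$ (the inner maximum being omitted if its index range is empty).
   Context: Functions are real-valued; $\langle f,g\rangle=\int fg\,d\mu$ and $\|\cdot\|_2$ is the norm of $L^2(\mu)$. $\mathrm L$ is a densely defined non-negative self-adjoint operator on $L^2(\mu)$ such that $\mathrm P_t:=e^{-t\mathrm L}$ is sub-Markovian: $0\le f\le1$ $\mu$-a.e. implies $0\le \mathrm P_tf\le1$ $\mu$-a.e. for all $t\ge0$. The Dirichlet form is $\mathcal E(f,g)=\langle \mathrm L^{1/2}f,\mathrm L^{1/2}g\rangle$ on $\mathcal D(\mathrm L^{1/2})$, and $\mathcal E(f):=\mathcal E(f,f)$. An algebraic core for $\mathrm L$ is a linear subspace $\mathcal A\subset\mathcal D(\mathrm L)\cap L^\infty(\mu)$, closed under pointwise multiplication, and dense in $\mathcal D(\mathrm L)$ for the graph norm $\|f\|_2+\|\mathrm Lf\|_2$. On $\mathcal A$ the carré du champ is $\Gamma(f,g):=\frac12(f\mathrm Lg+g\mathrm Lf-\mathrm L(fg))$, and $\Gamma(f):=\Gamma(f,f)$. Assumptions. (A1) $\mathrm L$ has compact resolvent; equivalently $L^2(\mu)$ has a finite or countable orthonormal basis of real eigenfunctions $(\phi_k)$ with $\mathrm L\phi_k=\lambda_k\phi_k$, $0\le\lambda_1\le\lambda_2\le\cdots$ repeated with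 multiplicity ($\lambda_k\to\infty$ in the infinite-dimensional case). (A2) There is an algebraic core $\mathcal A$ for $\mathrm L$ containing all $\phi_k$. (A3) For every $f\in\mathcal A$ with $\|\Gamma(f)\|_\infty<\infty$ and every $w\in\mathcal A$, $\mathcal E(fw)\le2\|f\|_\infty^2\mathcal E(w)+2\|\Gamma(f)\|_\infty\|w\|_2^2$. The spectral DPP of $\mathrm L$ of rank $n$ is the determinantal point process $\mathcal S_n$ on $\mathcal X$ with kernel $\mathrm K_n(x,y)=\sum_{k=1}^n\phi_k(x)\phi_k(y)$ and reference measure $\mu$. That is, for every $j\in\mathbb N$ and bounded measurable $F:\mathcal X^j\to\mathbb R$, $\mathbb E[\sum_{\neq}F(x_{i_1},\dots,x_{i_j})]=\int F\det[\mathrm K_n(x_a,x_b)]_{1\le a,b\le j}\,d\mu^{\otimes j}$, the sum being over ordered $j$-tuples of pairwise distinct points of $\mathcal S_n$. It has exactly $n$ points almost surely; equivalently it is the unordered set of an exchangeable $n$-tuple with density $\frac1{n!}\det[\mathrm K_n(x_a,x_b)]_{a,b\le n}$ with respect to $\mu^{\otimes n}$. The linear statistic is $\mathcal S_n(f):=\sum_{x\in\mathcal S_n}f(x)$. *)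

theory Defs
  imports "HOL-Probability.Probability" "Jordan_Normal_Form.Determinant"
begin

text \<open>
  Elements of $L^2(\mu)$ and $L^\infty(\mu)$ are represented by measurable functions, and sets of
  classes by sets of functions that are saturated under almost everywhere equality. Equations
  between classes are written \<^term>\<open>AE x in M. f x = g x\<close>.
\<close>

definition L2 :: "'a measure \<Rightarrow> ('a \<Rightarrow> real) set" where
  "L2 M = {f \<in> borel_measurable M. integrable M (\<lambda>x. (f x)\<^sup>2)}"

definition l2_inner :: "'a measure \<Rightarrow> ('a \<Rightarrow> real) \<Rightarrow> ('a \<Rightarrow> real) \<Rightarrow> real" where
  "l2_inner M f g = (\<integral>x. f x * g x \<partial>M)"

definition l2_norm :: "'a measure \<Rightarrow> ('a \<Rightarrow> real) \<Rightarrow> real" where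
  "l2_norm M f = sqrt (l2_inner M f f)"

definition linf_norm :: "'a measure \<Rightarrow> ('a \<Rightarrow> real) \<Rightarrow> ennreal" where
  "linf_norm M f = esssup M (\<lambda>x. ennreal \<bar>f x\<bar>)"

definition l2_subspace :: "'a measure \<Rightarrow> ('a \<Rightarrow> real) set \<Rightarrow> bool" where
  "l2_subspace M V \<longleftrightarrow>
     V \<subseteq> L2 M \<and>
     (\<forall>f\<in>V. \<forall>g\<in>borel_measurable M. (AE x in M. f x = g x) \<longrightarrow> g \<in> V) \<and>
     (\<lambda>x. 0) \<in> V \<and>
     (\<forall>f\<in>V. \<forall>g\<in>V. (\<lambda>x. f x + g x) \<in> V) \<and>
     (\<forall>c. \<forall>f\<in>V. (\<lambda>x. c * f x) \<in> V)"

subsection \<open>Unbounded operators on $L^2$\<close>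

text \<open>An operator is a function \<^term>\<open>T\<close> together with its domain \<^term>\<open>D\<close>; the values of
  \<^term>\<open>T\<close> outside \<^term>\<open>D\<close> are irrelevant.\<close>

definition l2_operator ::
  "'a measure \<Rightarrow> ('a \<Rightarrow> real) set \<Rightarrow> (('a \<Rightarrow> real) \<Rightarrow> 'a \<Rightarrow> real) \<Rightarrow> bool" where
  "l2_operator M D T \<longleftrightarrow>
     l2_subspace M D \<and>
     (\<forall>f\<in>D. T f \<in> L2 M) \<and>
     (\<forall>f\<in>D. \<forall>g\<in>D. (AE x in M. f x = g x) \<longrightarrow> (AE x in M. T f x = T g x)) \<and>
     (\<forall>f\<in>D. \<forall>g\<in>D. AE x in M. T (\<lambda>y. f y + g y) x = T f x + T g x) \<and>
     (\<forall>c. \<forall>f\<in>D. AE x in M. T (\<lambda>y. c * f y) x = c * T f x)"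

definition densely_defined :: "'a measure \<Rightarrow> ('a \<Rightarrow> real) set \<Rightarrow> bool" where
  "densely_defined M D \<longleftrightarrow> (\<forall>f\<in>L2 M. \<forall>e>0. \<exists>g\<in>D. l2_norm M (\<lambda>x. f x - g x) < e)"

text \<open>The graph of the adjoint.\<close>

definition adjoint_rel ::
  "'a measure \<Rightarrow> ('a \<Rightarrow> real) set \<Rightarrow> (('a \<Rightarrow> real) \<Rightarrow> 'a \<Rightarrow> real) \<Rightarrow>
     ('a \<Rightarrow> real) \<Rightarrow> ('a \<Rightarrow> real) \<Rightarrow> bool" where
  "adjoint_rel M D T g h \<longleftrightarrow>
     g \<in> L2 M \<and> h \<in> L2 M \<and> (\<forall>f\<in>D. l2_inner M (T f) g = l2_inner M f h)"

definition self_adjoint ::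
  "'a measure \<Rightarrow> ('a \<Rightarrow> real) set \<Rightarrow> (('a \<Rightarrow> real) \<Rightarrow> 'a \<Rightarrow> real) \<Rightarrow> bool" where
  "self_adjoint M D T \<longleftrightarrow>
     l2_operator M D T \<and> densely_defined M D \<and>
     (\<forall>g h. adjoint_rel M D T g h \<longleftrightarrow> g \<in> D \<and> h \<in> L2 M \<and> (AE x in M. h x = T g x))"

definition nonneg_self_adjoint ::
  "'a measure \<Rightarrow> ('a \<Rightarrow> real) set \<Rightarrow> (('a \<Rightarrow> real) \<Rightarrow> 'a \<Rightarrow> real) \<Rightarrow> bool" where
  "nonneg_self_adjoint M D T \<longleftrightarrow>
     self_adjoint M D T \<and> (\<forall>f\<in>D. 0 \<le> l2_inner M f (T f))"

text \<open>The operator \<^term>\<open>S\<close> with domain \<^term>\<open>DS\<close> is $\mathrm{L}^{1/2}$, the unique non-negative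
  self-adjoint operator whose square (with its natural domain) is $\mathrm{L}$.\<close>

definition operator_sqrt ::
  "'a measure \<Rightarrow> ('a \<Rightarrow> real) set \<Rightarrow> (('a \<Rightarrow> real) \<Rightarrow> 'a \<Rightarrow> real) \<Rightarrow>
     ('a \<Rightarrow> real) set \<Rightarrow> (('a \<Rightarrow> real) \<Rightarrow> 'a \<Rightarrow> real) \<Rightarrow> bool" where
  "operator_sqrt M D L DS S \<longleftrightarrow>
     nonneg_self_adjoint M DS S \<and>
     D = {f\<in>DS. S f \<in> DS} \<and>
     (\<forall>f\<in>D. AE x in M. L f x = S (S f) x)"

definition dirichlet_form ::
  "'a measure \<Rightarrow> (('a \<Rightarrow> real) \<Rightarrow> 'a \<Rightarrow> real) \<Rightarrow> ('a \<Rightarrow> real) \<Rightarrow> ('a \<Rightarrow> real) \<Rightarrow> real" where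
  "dirichlet_form M S f g = l2_inner M (S f) (S g)"

text \<open>The family $\mathrm{P}_t = e^{-t\mathrm{L}}$: the strongly continuous semigroup of bounded
  operators whose infinitesimal generator, domain included, is $-\mathrm{L}$.\<close>

definition generated_semigroup ::
  "'a measure \<Rightarrow> ('a \<Rightarrow> real) set \<Rightarrow> (('a \<Rightarrow> real) \<Rightarrow> 'a \<Rightarrow> real) \<Rightarrow>
     (real \<Rightarrow> ('a \<Rightarrow> real) \<Rightarrow> 'a \<Rightarrow> real) \<Rightarrow> bool" where
  "generated_semigroup M D L P \<longleftrightarrow>
     (\<forall>t\<ge>0. l2_operator M (L2 M) (P t) \<and>
        (\<exists>C. \<forall>f\<in>L2 M. l2_norm M (P t f) \<le> C * l2_norm M f)) \<and>
     (\<forall>f\<in>L2 M. AE x in M. P 0 f x = f x) \<and>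
     (\<forall>s\<ge>0. \<forall>t\<ge>0. \<forall>f\<in>L2 M. AE x in M. P (s + t) f x = P s (P t f) x) \<and>
     (\<forall>f\<in>L2 M. ((\<lambda>t. l2_norm M (\<lambda>x. P t f x - f x)) \<longlongrightarrow> 0) (at_right 0)) \<and>
     (\<forall>f\<in>L2 M. \<forall>g\<in>L2 M.
        (f \<in> D \<and> (AE x in M. g x = L f x)) \<longleftrightarrow>
        ((\<lambda>t. l2_norm M (\<lambda>x. (P t f x - f x) / t - (- g x))) \<longlongrightarrow> 0) (at_right 0))"

definition sub_markovian ::
  "'a measure \<Rightarrow> (real \<Rightarrow> ('a \<Rightarrow> real) \<Rightarrow> 'a \<Rightarrow> real) \<Rightarrow> bool" where
  "sub_markovian M P \<longleftrightarrow>
     (\<forall>t\<ge>0. \<forall>f\<in>L2 M. (AE x in M. 0 \<le> f x \<and> f x \<le> 1) \<longrightarrow>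
        (AE x in M. 0 \<le> P t f x \<and> P t f x \<le> 1))"

subsection \<open>Eigenbasis, algebraic core and carr\'e du champ\<close>

text \<open>Eigenpairs are numbered from 1 to \<^term>\<open>N\<close>, which is the dimension of $L^2(\mu)$ and may be
  infinite.\<close>

definition eigen_indices :: "enat \<Rightarrow> nat set" where
  "eigen_indices N = {k. 1 \<le> k \<and> enat k \<le> N}"

definition orthonormal_basis ::
  "'a measure \<Rightarrow> nat set \<Rightarrow> (nat \<Rightarrow> 'a \<Rightarrow> real) \<Rightarrow> bool" where
  "orthonormal_basis M I \<phi> \<longleftrightarrow>
     (\<forall>k\<in>I. \<phi> k \<in> L2 M) \<and>
     (\<forall>j\<in>I. \<forall>k\<in>I. l2_inner M (\<phi> j) (\<phi> k) = (if j = k then 1 else 0)) \<and>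
     (\<forall>f\<in>L2 M. \<forall>e>0. \<exists>J c. finite J \<and> J \<subseteq> I \<and>
        l2_norm M (\<lambda>x. f x - (\<Sum>k\<in>J. c k * \<phi> k x)) < e)"

definition eigenbasis ::
  "'a measure \<Rightarrow> ('a \<Rightarrow> real) set \<Rightarrow> (('a \<Rightarrow> real) \<Rightarrow> 'a \<Rightarrow> real) \<Rightarrow>
     enat \<Rightarrow> (nat \<Rightarrow> 'a \<Rightarrow> real) \<Rightarrow> (nat \<Rightarrow> real) \<Rightarrow> bool" where
  "eigenbasis M D L N \<phi> lam \<longleftrightarrow>
     orthonormal_basis M (eigen_indices N) \<phi> \<and>
     (\<forall>k\<in>eigen_indices N. \<phi> k \<in> D \<and> (AE x in M. L (\<phi> k) x = lam k * \<phi> k x)) \<and>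
     (\<forall>k\<in>eigen_indices N. 0 \<le> lam k) \<and>
     (\<forall>j\<in>eigen_indices N. \<forall>k\<in>eigen_indices N. j \<le> k \<longrightarrow> lam j \<le> lam k) \<and>
     (N = \<infinity> \<longrightarrow> filterlim lam at_top sequentially)"

definition algebraic_core ::
  "'a measure \<Rightarrow> ('a \<Rightarrow> real) set \<Rightarrow> (('a \<Rightarrow> real) \<Rightarrow> 'a \<Rightarrow> real) \<Rightarrow> ('a \<Rightarrow> real) set \<Rightarrow> bool" where
  "algebraic_core M D L \<A> \<longleftrightarrow>
     l2_subspace M \<A> \<and>
     \<A> \<subseteq> D \<and>
     (\<forall>f\<in>\<A>. linf_norm M f < \<infinity>) \<and>
     (\<forall>f\<in>\<A>. \<forall>g\<in>\<A>. (\<lambda>x. f x * g x) \<in> \<A>) \<and>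
     (\<forall>f\<in>D. \<forall>e>0. \<exists>g\<in>\<A>.
        l2_norm M (\<lambda>x. f x - g x) + l2_norm M (L (\<lambda>x. f x - g x)) < e)"

definition carre_du_champ ::
  "(('a \<Rightarrow> real) \<Rightarrow> 'a \<Rightarrow> real) \<Rightarrow> ('a \<Rightarrow> real) \<Rightarrow> ('a \<Rightarrow> real) \<Rightarrow> 'a \<Rightarrow> real" where
  "carre_du_champ L f g =
     (\<lambda>x. (1 / 2) * (f x * L g x + g x * L f x - L (\<lambda>y. f y * g y) x))"

subsection \<open>The spectral determinantal process\<close>

definition spectral_kernel :: "(nat \<Rightarrow> 'a \<Rightarrow> real) \<Rightarrow> nat \<Rightarrow> 'a \<Rightarrow> 'a \<Rightarrow> real" where
  "spectral_kernel \<phi> n x y = (\<Sum>k=1..n. \<phi> k x * \<phi> k y)"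

definition finite_point_process ::
  "'b measure \<Rightarrow> 'a measure \<Rightarrow> ('b \<Rightarrow> 'a set) \<Rightarrow> bool" where
  "finite_point_process \<Omega> M X \<longleftrightarrow>
     (\<forall>\<omega>\<in>space \<Omega>. finite (X \<omega>) \<and> X \<omega> \<subseteq> space M) \<and>
     (\<forall>B\<in>sets M. (\<lambda>\<omega>. card (X \<omega> \<inter> B)) \<in> measurable \<Omega> (count_space UNIV))"

text \<open>Ordered \<^term>\<open>j\<close>-tuples of pairwise distinct points of a configuration.\<close>

definition distinct_tuples :: "nat \<Rightarrow> 'a set \<Rightarrow> (nat \<Rightarrow> 'a) set" where
  "distinct_tuples j s = {x \<in> {..<j} \<rightarrow>\<^sub>E s. inj_on x {..<j}}"

text \<open>The determinant is \<^const>\<open>Determinant.det\<close>, for matrices of variable size.\<close>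

definition spectral_dpp ::
  "'b measure \<Rightarrow> 'a measure \<Rightarrow> (nat \<Rightarrow> 'a \<Rightarrow> real) \<Rightarrow> nat \<Rightarrow> ('b \<Rightarrow> 'a set) \<Rightarrow> bool" where
  "spectral_dpp \<Omega> M \<phi> n X \<longleftrightarrow>
     finite_point_process \<Omega> M X \<and>
     (\<forall>j F. F \<in> borel_measurable (\<Pi>\<^sub>M i\<in>{..<j}. M) \<and>
            (\<exists>C. \<forall>x\<in>space (\<Pi>\<^sub>M i\<in>{..<j}. M). \<bar>F x\<bar> \<le> C) \<longrightarrow>
        has_bochner_integral \<Omega>
          (\<lambda>\<omega>. \<Sum>x\<in>distinct_tuples j (X \<omega>). F x)
          (\<integral>x. F x * Determinant.det (mat j j (\<lambda>(a, b). spectral_kernel \<phi> n (x a) (x b)))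
             \<partial>(\<Pi>\<^sub>M i\<in>{..<j}. M)))"

definition linear_statistic :: "('b \<Rightarrow> 'a set) \<Rightarrow> ('a \<Rightarrow> real) \<Rightarrow> 'b \<Rightarrow> real" where
  "linear_statistic X f \<omega> = (\<Sum>x\<in>X \<omega>. f x)"

subsection \<open>The quantities in the bounds\<close>

text \<open>\<^const>\<open>Gamma\<close> is Euler's function $\gamma$; see \<open>Gamma_integral_real\<close> for its integral
  representation.\<close>

definition C_const ::
  "'a measure \<Rightarrow> (('a \<Rightarrow> real) \<Rightarrow> 'a \<Rightarrow> real) \<Rightarrow> real \<Rightarrow> ('a \<Rightarrow> real) \<Rightarrow> real" where
  "C_const M L \<alpha> f =
     2 / ((1 - 2 * \<alpha>) * Gamma (1 - \<alpha>))
       * enn2real (linf_norm M (carre_du_champ L f f)) powr \<alpha>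
       * enn2real (linf_norm M f) powr (1 - 2 * \<alpha>)"

definition eigen_count :: "enat \<Rightarrow> (nat \<Rightarrow> real) \<Rightarrow> real \<Rightarrow> nat" where
  "eigen_count N lam r = card {k \<in> eigen_indices N. lam k \<le> r}"

definition R_const :: "enat \<Rightarrow> (nat \<Rightarrow> real) \<Rightarrow> real \<Rightarrow> nat \<Rightarrow> real" where
  "R_const N lam \<alpha> n =
     Max (insert (real (eigen_count N lam 1))
       {real (eigen_count N lam ((lam n powr \<alpha> - real p) powr (1 / \<alpha>)))
          - real (eigen_count N lam ((lam n powr \<alpha> - real p - 1) powr (1 / \<alpha>)))
        | p :: nat. int p \<le> \<lfloor>lam n powr \<alpha>\<rfloor> - 1})"

end

theory Submission
  imports Defs
begin

text \<open>
  The determinantal formulas for one and two points give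
  $\mathrm{Var}[\mathcal S_n(f)] = \sum_{k\le n}(\|f\phi_k\|^2 - \sum_{l\le n}\langle f\phi_k,\phi_l\rangle^2)$,
  so it remains to bound, for each $k$, the squared norm $A_k$ of the component of $f\phi_k$
  orthogonal to $\phi_1,\dots,\phi_n$. Trivially $A_k\le\|f\|_\infty^2$. For $\lambda_k<\lambda_n$ the
  commutator identity
  $\langle fu,\mathrm Lv\rangle-\langle fv,\mathrm Lu\rangle=\int u\,\Gamma(f,v)-v\,\Gamma(f,u)\,d\mu$,
  with $u=\phi_k$ and $v=\sum_{j>n}\langle f\phi_k,\phi_j\rangle\phi_j/(\lambda_j-\lambda_k)$, has left-hand
  side $A_k$, while Cauchy--Schwarz for $\Gamma$ and $\int\Gamma(v)\,d\mu\le\langle v,\mathrm Lv\rangle$ bound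
  the right-hand side; this gives
  $A_k\le\|\Gamma(f)\|_\infty/(\sqrt{\lambda_n}-\sqrt{\lambda_k})^2$. Interpolating geometrically
  between the two estimates, and using that $x\mapsto x^{2\alpha}$ is subadditive, yields the first
  bound, even without the constant $2/((1-2\alpha)\gamma(1-\alpha))\ge1$. The second bound follows by
  grouping the indices $k$ by the integer part of $\lambda_n^\alpha-\lambda_k^\alpha$.
  The positivity of $\Gamma$ and the integral inequality come from
  $2t\,\Gamma(u)\approx\mathrm P_t(u^2)-2u\mathrm P_tu+u^2\ge(\mathrm P_tu-u)^2$ and the symmetry of
  $\mathrm P_t$.
\<close>

text \<open>\<open>generated_semigroup\<close> describes \<open>P\<close> only through its
  generator, a right derivative at 0: neither the symmetry of \<open>P t\<close> nor its action on
  eigenvectors is given, and both must be derived before any calculus with \<Gamma> can start. A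
  second obstacle is that the measure may be infinite. Constants then lie outside
  \<open>L2 M\<close>, so Jensen's inequality and the contraction of integrals, usually read off
  from \<open>P t\<close> applied to 1, come instead from bounded functions and from indicators of
  sets of finite measure. The square roots in the decay estimate arise because the commutator bound
  reads A_k \<le> sqrt G * sqrt A_k * (sqrt(lam n) + sqrt(lam k)) / (lam n - lam k), and the sum of
  roots cancels against a factor of the denominator. The interpolation weights 1 - 2\<alpha> and
  2\<alpha> are those for which the gap of square roots enters with exponent 4\<alpha>, so that its
  power 2\<alpha> can be compared with lam n^\<alpha> - lam k^\<alpha>. As v has to lie in the core,
  only finite sections of its series are used.\<close>

section \<open>Square integrable functions\<close>

text \<open>Rational \<open>q\<close> suffice because the solution set is closed and the rationals
  are dense. This form suits inequalities that hold almost everywhere for each \<open>q\<close>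
  separately: countably many exceptional sets can be united.\<close>

lemma quadratic_discriminant_rat:
  fixes a b c :: real
  assumes "0 \<le> c" and "\<And>q. q \<in> \<rat> \<Longrightarrow> 0 \<le> a + 2 * q * b + q\<^sup>2 * c"
  shows "b\<^sup>2 \<le> a * c"
proof -
  have real_ge: "0 \<le> a + 2 * t * b + t\<^sup>2 * c" for t :: real
  proof -
    let ?S = "{t. 0 \<le> a + 2 * t * b + t\<^sup>2 * c}"
    have "closed ?S"
      by (intro closed_Collect_le continuous_intros)
    moreover have "\<rat> \<subseteq> ?S" using assms by auto
    ultimately have "closure \<rat> \<subseteq> ?S" by (simp add: closure_minimal)
    then show ?thesis using Rats_closure_real by auto
  qed
  show ?thesis
  proof (cases "c = 0")
    case True
    have "b = 0"
    proof (rule ccontr)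
      assume "b \<noteq> 0"
      \<comment> \<open>Without a quadratic term the expression is affine in \<open>t\<close>; this
        point is chosen to give it the value -1.\<close>
      then have "2 * (- (a + 1) / (2 * b)) * b = - (a + 1)" by (simp add: field_simps)
      with real_ge[of "- (a + 1) / (2 * b)"] show False unfolding True by simp
    qed
    then show ?thesis using True by simp
  next
    case False
    with assms(1) have "c > 0" by simp
    have "2 * (- b / c) * b + (- b / c)\<^sup>2 * c = - (b\<^sup>2 / c)"
      using False by (simp add: power2_eq_square)
    with real_ge[of "- b / c"] have "b\<^sup>2 / c \<le> a" by linarith
    then show ?thesis using \<open>c > 0\<close> by (simp add: pos_divide_le_eq)
  qed
qed

lemma L2_measurable [measurable_dest]: "f \<in> L2 M \<Longrightarrow> f \<in> borel_measurable M"
  by (simp add: L2_def)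

lemma L2_integrable_mult:
  assumes "f \<in> L2 M" "g \<in> L2 M"
  shows "integrable M (\<lambda>x. f x * g x)"
proof (rule Bochner_Integration.integrable_bound)
  show "integrable M (\<lambda>x. (f x)\<^sup>2 + (g x)\<^sup>2)"
    using assms by (auto simp: L2_def)
  show "(\<lambda>x. f x * g x) \<in> borel_measurable M"
    using assms by (auto simp: L2_def)
  have "\<bar>a * b\<bar> \<le> a\<^sup>2 + b\<^sup>2" for a b :: real
  proof -
    have "2 * (\<bar>a\<bar> * \<bar>b\<bar>) \<le> a\<^sup>2 + b\<^sup>2"
      using sum_squares_bound[of "\<bar>a\<bar>" "\<bar>b\<bar>"] by (simp add: mult.assoc)
    moreover have "0 \<le> \<bar>a\<bar> * \<bar>b\<bar>" by simp
    ultimately show ?thesis unfolding abs_mult by linarith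
  qed
  then show "AE x in M. norm (f x * g x) \<le> norm ((f x)\<^sup>2 + (g x)\<^sup>2)"
    by (simp add: abs_mult)
qed

lemma L2_add:
  assumes "f \<in> L2 M" "g \<in> L2 M"
  shows "(\<lambda>x. f x + g x) \<in> L2 M"
proof -
  have "(\<lambda>x. (f x + g x)\<^sup>2) = (\<lambda>x. (f x)\<^sup>2 + (g x)\<^sup>2 + 2 * (f x * g x))"
    by (auto simp: power2_sum)
  then show ?thesis
    using assms L2_integrable_mult[OF assms] by (auto simp: L2_def)
qed

lemma L2_scale: "f \<in> L2 M \<Longrightarrow> (\<lambda>x. c * f x) \<in> L2 M"
  by (auto simp: L2_def power_mult_distrib)

lemma L2_minus: "f \<in> L2 M \<Longrightarrow> (\<lambda>x. - f x) \<in> L2 M"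
  using L2_scale[of f M "-1"] by simp

lemma L2_diff: "f \<in> L2 M \<Longrightarrow> g \<in> L2 M \<Longrightarrow> (\<lambda>x. f x - g x) \<in> L2 M"
  using L2_add[of f M "\<lambda>x. - g x"] L2_minus[of g M] by simp

lemma L2_divide: "f \<in> L2 M \<Longrightarrow> (\<lambda>x. f x / c) \<in> L2 M"
  using L2_scale[of f M "inverse c"] by (simp add: divide_inverse mult.commute)

lemma L2_zero: "(\<lambda>x. 0) \<in> L2 M"
  by (simp add: L2_def)

lemma L2_sum: "(\<And>i. i \<in> I \<Longrightarrow> f i \<in> L2 M) \<Longrightarrow> (\<lambda>x. \<Sum>i\<in>I. f i x) \<in> L2 M"
  by (induction I rule: infinite_finite_induct) (auto intro: L2_zero L2_add)

lemma L2_mono: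
  assumes "g \<in> L2 M" "f \<in> borel_measurable M" "AE x in M. \<bar>f x\<bar> \<le> \<bar>g x\<bar>"
  shows "f \<in> L2 M"
proof -
  have "integrable M (\<lambda>x. (f x)\<^sup>2)"
  proof (rule Bochner_Integration.integrable_bound)
    show "integrable M (\<lambda>x. (g x)\<^sup>2)" using assms by (simp add: L2_def)
    show "AE x in M. norm ((f x)\<^sup>2) \<le> norm ((g x)\<^sup>2)"
      using assms(3) by eventually_elim (simp add: abs_le_square_iff)
  qed (use assms in auto)
  then show ?thesis using assms(2) by (simp add: L2_def)
qed

lemma L2_bounded_mult:
  assumes "f \<in> borel_measurable M" "AE x in M. \<bar>f x\<bar> \<le> C" "g \<in> L2 M"
  shows "(\<lambda>x. f x * g x) \<in> L2 M"
proof (rule L2_mono)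
  show "(\<lambda>x. C * g x) \<in> L2 M" using assms(3) by (rule L2_scale)
  show "(\<lambda>x. f x * g x) \<in> borel_measurable M" using assms by auto
  show "AE x in M. \<bar>f x * g x\<bar> \<le> \<bar>C * g x\<bar>"
    using assms(2) by eventually_elim (auto simp: abs_mult intro!: mult_right_mono)
qed

lemmas L2_intros = L2_add L2_scale L2_minus L2_diff L2_divide L2_zero L2_sum

lemma L2_indicator:
  assumes "B \<in> sets M" "emeasure M B < \<infinity>"
  shows "(indicator B :: 'a \<Rightarrow> real) \<in> L2 M"
proof -
  have "(\<lambda>x. (indicator B x :: real)\<^sup>2) = indicator B"
    by (auto simp: indicator_def)
  then show ?thesis using assms by (auto simp: L2_def)
qed

lemma l2_inner_commute: "l2_inner M f g = l2_inner M g f"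
  by (simp add: l2_inner_def mult.commute)

lemma l2_inner_add_left:
  "f \<in> L2 M \<Longrightarrow> g \<in> L2 M \<Longrightarrow> h \<in> L2 M \<Longrightarrow>
    l2_inner M (\<lambda>x. f x + g x) h = l2_inner M f h + l2_inner M g h"
  by (simp add: l2_inner_def distrib_right L2_integrable_mult)

lemma l2_inner_add_right:
  "f \<in> L2 M \<Longrightarrow> g \<in> L2 M \<Longrightarrow> h \<in> L2 M \<Longrightarrow>
    l2_inner M h (\<lambda>x. f x + g x) = l2_inner M h f + l2_inner M h g"
  by (simp add: l2_inner_def distrib_left L2_integrable_mult)

lemma l2_inner_diff_left:
  "f \<in> L2 M \<Longrightarrow> g \<in> L2 M \<Longrightarrow> h \<in> L2 M \<Longrightarrow>
    l2_inner M (\<lambda>x. f x - g x) h = l2_inner M f h - l2_inner M g h"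
  by (simp add: l2_inner_def left_diff_distrib L2_integrable_mult)

lemma l2_inner_diff_right:
  "f \<in> L2 M \<Longrightarrow> g \<in> L2 M \<Longrightarrow> h \<in> L2 M \<Longrightarrow>
    l2_inner M h (\<lambda>x. f x - g x) = l2_inner M h f - l2_inner M h g"
  by (simp add: l2_inner_def right_diff_distrib L2_integrable_mult)

lemma l2_inner_scale_left: "l2_inner M (\<lambda>x. c * f x) g = c * l2_inner M f g"
  by (simp add: l2_inner_def mult.assoc)

lemma l2_inner_scale_right: "l2_inner M f (\<lambda>x. c * g x) = c * l2_inner M f g"
  by (simp add: l2_inner_def mult.left_commute)

lemma l2_inner_sum_left:
  "(\<And>i. i \<in> I \<Longrightarrow> f i \<in> L2 M) \<Longrightarrow> g \<in> L2 M \<Longrightarrow>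
    l2_inner M (\<lambda>x. \<Sum>i\<in>I. f i x) g = (\<Sum>i\<in>I. l2_inner M (f i) g)"
  by (simp add: l2_inner_def sum_distrib_right L2_integrable_mult)

lemma l2_inner_sum_right:
  "(\<And>i. i \<in> I \<Longrightarrow> f i \<in> L2 M) \<Longrightarrow> g \<in> L2 M \<Longrightarrow>
    l2_inner M g (\<lambda>x. \<Sum>i\<in>I. f i x) = (\<Sum>i\<in>I. l2_inner M g (f i))"
  by (simp add: l2_inner_def sum_distrib_left L2_integrable_mult)

lemma l2_inner_cong_AE:
  assumes "f \<in> borel_measurable M" "f' \<in> borel_measurable M" "g \<in> borel_measurable M"
    "g' \<in> borel_measurable M" "AE x in M. f x = f' x" "AE x in M. g x = g' x"
  shows "l2_inner M f g = l2_inner M f' g'"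
  unfolding l2_inner_def using assms by (intro integral_cong_AE) auto

lemma l2_inner_nonneg: "0 \<le> l2_inner M f f"
  by (simp add: l2_inner_def)

lemma l2_norm_nonneg: "0 \<le> l2_norm M f"
  by (simp add: l2_norm_def l2_inner_nonneg)

lemma l2_norm_power2: "(l2_norm M f)\<^sup>2 = l2_inner M f f"
  by (simp add: l2_norm_def l2_inner_nonneg)

lemma l2_norm_cong_AE:
  assumes "f \<in> borel_measurable M" "g \<in> borel_measurable M" "AE x in M. f x = g x"
  shows "l2_norm M f = l2_norm M g"
  unfolding l2_norm_def using l2_inner_cong_AE[of f M g f g] assms by simp

lemma l2_norm_scale: "l2_norm M (\<lambda>x. c * f x) = \<bar>c\<bar> * l2_norm M f"
  by (simp add: l2_norm_def l2_inner_scale_left l2_inner_scale_right real_sqrt_mult)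

lemma l2_norm_minus: "l2_norm M (\<lambda>x. - f x) = l2_norm M f"
  by (simp add: l2_norm_def l2_inner_def)

lemma l2_norm_zero: "l2_norm M (\<lambda>x. 0) = 0"
  by (simp add: l2_norm_def l2_inner_def)

lemma l2_cauchy_schwarz:
  assumes "f \<in> L2 M" "g \<in> L2 M"
  shows "\<bar>l2_inner M f g\<bar> \<le> l2_norm M f * l2_norm M g"
proof -
  have "(l2_inner M f g)\<^sup>2 \<le> l2_inner M f f * l2_inner M g g"
  proof (rule quadratic_discriminant_rat[OF l2_inner_nonneg])
    fix q :: real
    have "0 \<le> l2_inner M (\<lambda>x. f x + q * g x) (\<lambda>x. f x + q * g x)"
      by (rule l2_inner_nonneg)
    also have "\<dots> = l2_inner M f f + 2 * q * l2_inner M f g + q\<^sup>2 * l2_inner M g g"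
      using assms by (simp add: l2_inner_add_left l2_inner_add_right L2_intros
          l2_inner_scale_left l2_inner_scale_right l2_inner_commute[of M g f] power2_eq_square algebra_simps)
    finally show "0 \<le> l2_inner M f f + 2 * q * l2_inner M f g + q\<^sup>2 * l2_inner M g g" .
  qed
  then have "sqrt ((l2_inner M f g)\<^sup>2) \<le> sqrt (l2_inner M f f * l2_inner M g g)"
    by (rule real_sqrt_le_mono)
  then show ?thesis by (simp add: l2_norm_def real_sqrt_mult)
qed

lemma l2_norm_triangle:
  assumes "f \<in> L2 M" "g \<in> L2 M"
  shows "l2_norm M (\<lambda>x. f x + g x) \<le> l2_norm M f + l2_norm M g"
proof (rule power2_le_imp_le)
  have "(l2_norm M (\<lambda>x. f x + g x))\<^sup>2 = (l2_norm M f)\<^sup>2 + 2 * l2_inner M f g + (l2_norm M g)\<^sup>2"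
    using assms by (simp add: l2_norm_power2 l2_inner_add_left l2_inner_add_right L2_intros
          l2_inner_commute[of M g f])
  also have "\<dots> \<le> (l2_norm M f + l2_norm M g)\<^sup>2"
    using l2_cauchy_schwarz[OF assms] by (simp add: power2_sum)
  finally show "(l2_norm M (\<lambda>x. f x + g x))\<^sup>2 \<le> (l2_norm M f + l2_norm M g)\<^sup>2" .
qed (simp add: l2_norm_nonneg)

lemma l2_norm_triangle_diff:
  assumes "f \<in> L2 M" "g \<in> L2 M" "h \<in> L2 M"
  shows "l2_norm M (\<lambda>x. f x - h x) \<le> l2_norm M (\<lambda>x. f x - g x) + l2_norm M (\<lambda>x. g x - h x)"
  using l2_norm_triangle[of "\<lambda>x. f x - g x" M "\<lambda>x. g x - h x"] assms by (simp add: L2_intros)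

lemma l2_norm_sum_le:
  assumes "\<And>i. i \<in> I \<Longrightarrow> f i \<in> L2 M"
  shows "l2_norm M (\<lambda>x. \<Sum>i\<in>I. f i x) \<le> (\<Sum>i\<in>I. l2_norm M (f i))"
  using assms
proof (induction I rule: infinite_finite_induct)
  case (insert i I)
  have "l2_norm M (\<lambda>x. f i x + (\<Sum>j\<in>I. f j x)) \<le> l2_norm M (f i) + l2_norm M (\<lambda>x. \<Sum>j\<in>I. f j x)"
    using insert by (intro l2_norm_triangle L2_sum) auto
  also have "\<dots> \<le> l2_norm M (f i) + (\<Sum>j\<in>I. l2_norm M (f j))"
    using insert by simp
  finally show ?case using insert by simp
qed (auto simp: l2_norm_zero)

lemma l2_norm_eq_0_AE:
  assumes "f \<in> L2 M" "l2_norm M f = 0"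
  shows "AE x in M. f x = 0"
proof -
  have "(\<integral>x. (f x)\<^sup>2 \<partial>M) = 0"
    using l2_norm_power2[of M f] assms(2) by (simp add: l2_inner_def power2_eq_square)
  then have "AE x in M. (f x)\<^sup>2 = 0"
    using assms(1) by (subst (asm) integral_nonneg_eq_0_iff_AE) (auto simp: L2_def)
  then show ?thesis by simp
qed

lemma l2_norm_diff_eq_0_AE:
  assumes "f \<in> L2 M" "g \<in> L2 M" "l2_norm M (\<lambda>x. f x - g x) = 0"
  shows "AE x in M. f x = g x"
  using l2_norm_eq_0_AE[OF L2_diff[OF assms(1,2)] assms(3)] by simp

lemma l2_inner_tendsto:
  assumes "\<forall>\<^sub>F t in F. f t \<in> L2 M" "f0 \<in> L2 M" "g \<in> L2 M"
    "((\<lambda>t. l2_norm M (\<lambda>x. f t x - f0 x)) \<longlongrightarrow> 0) F"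
  shows "((\<lambda>t. l2_inner M (f t) g) \<longlongrightarrow> l2_inner M f0 g) F"
proof (rule Lim_null[THEN iffD2], rule Lim_null_comparison)
  show "\<forall>\<^sub>F t in F. norm (l2_inner M (f t) g - l2_inner M f0 g)
      \<le> l2_norm M (\<lambda>x. f t x - f0 x) * l2_norm M g"
    using assms(1)
  proof eventually_elim
    case (elim t)
    then show ?case
      using l2_cauchy_schwarz[OF L2_diff[OF elim assms(2)] assms(3)] assms(2,3)
      by (simp add: l2_inner_diff_left)
  qed
  show "((\<lambda>t. l2_norm M (\<lambda>x. f t x - f0 x) * l2_norm M g) \<longlongrightarrow> 0) F"
    using tendsto_mult_right[OF assms(4), of "l2_norm M g"] by simp
qed

text \<open>Where \<open>f t\<close> is nonnegative, the negative part of \<open>f0\<close> is at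
  most the distance from \<open>f0\<close> to \<open>f t\<close>. Its norm is thus bounded by a
  quantity tending to 0, and no almost everywhere convergent subsequence has to be
  extracted.\<close>

lemma l2_limit_nonneg:
  assumes "\<forall>\<^sub>F t in F. f t \<in> L2 M" "f0 \<in> L2 M"
    and lim: "((\<lambda>t. l2_norm M (\<lambda>x. f t x - f0 x)) \<longlongrightarrow> 0) F" and "F \<noteq> bot"
    and nn: "\<forall>\<^sub>F t in F. AE x in M. 0 \<le> f t x"
  shows "AE x in M. 0 \<le> f0 x"
proof -
  let ?n = "\<lambda>x. min (f0 x) 0"
  have nL: "?n \<in> L2 M"
    using assms(2) by (intro L2_mono[OF assms(2)]) (auto simp: min_def)
  have "\<forall>\<^sub>F t in F. l2_norm M ?n \<le> l2_norm M (\<lambda>x. f t x - f0 x)"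
    using nn assms(1)
  proof eventually_elim
    case (elim t)
    have "(l2_norm M ?n)\<^sup>2 \<le> (l2_norm M (\<lambda>x. f t x - f0 x))\<^sup>2"
      unfolding l2_norm_power2 l2_inner_def
    proof (rule integral_mono_AE)
      show "AE x in M. ?n x * ?n x \<le> (f t x - f0 x) * (f t x - f0 x)"
        using elim(1)
      proof eventually_elim
        case (elim x)
        then have "\<bar>?n x\<bar> \<le> \<bar>f t x - f0 x\<bar>" by (auto simp: min_def)
        then show ?case by (metis abs_le_square_iff power2_eq_square)
      qed
    qed (use nL assms(2) elim(2) in \<open>auto intro!: L2_integrable_mult L2_intros\<close>)
    then show ?case by (rule power2_le_imp_le) (rule l2_norm_nonneg)
  qed
  then have "l2_norm M ?n \<le> 0"
    by (rule tendsto_lowerbound[OF lim]) (rule assms(4))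
  then have "AE x in M. ?n x = 0"
    using l2_norm_eq_0_AE[OF nL] l2_norm_nonneg[of M ?n] by simp
  then show ?thesis by eventually_elim (auto simp: min_def split: if_splits)
qed

lemma l2_norm_bounded_mult:
  assumes "f \<in> borel_measurable M" "AE x in M. \<bar>f x\<bar> \<le> C" "0 \<le> C" "g \<in> L2 M"
  shows "l2_norm M (\<lambda>x. f x * g x) \<le> C * l2_norm M g"
proof (rule power2_le_imp_le)
  have "(l2_norm M (\<lambda>x. f x * g x))\<^sup>2 \<le> (l2_norm M (\<lambda>x. C * g x))\<^sup>2"
    unfolding l2_norm_power2 l2_inner_def
  proof (rule integral_mono_AE)
    show "AE x in M. f x * g x * (f x * g x) \<le> C * g x * (C * g x)"
      using assms(2)
    proof eventually_elim
      case (elim x)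
      then have "\<bar>f x * g x\<bar> \<le> \<bar>C * g x\<bar>"
        using assms(3) by (auto simp: abs_mult intro!: mult_right_mono)
      then show ?case by (metis abs_le_square_iff power2_eq_square)
    qed
  qed (use assms in \<open>auto intro!: L2_integrable_mult L2_bounded_mult L2_scale\<close>)
  then show "(l2_norm M (\<lambda>x. f x * g x))\<^sup>2 \<le> (C * l2_norm M g)\<^sup>2"
    by (simp add: l2_norm_scale power_mult_distrib)
  show "0 \<le> C * l2_norm M g" using assms(3) l2_norm_nonneg[of M g] by simp
qed

text \<open>The finiteness assumption matters: \<open>enn2real\<close> sends an infinite norm to
  0.\<close>

lemma linf_norm_AE_le:
  assumes "f \<in> borel_measurable M" "linf_norm M f < \<infinity>"
  shows "AE x in M. \<bar>f x\<bar> \<le> enn2real (linf_norm M f)"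
proof -
  have "AE x in M. ennreal \<bar>f x\<bar> \<le> linf_norm M f"
    unfolding linf_norm_def by (rule esssup_AE)
  then show ?thesis
  proof eventually_elim
    case (elim x)
    then have "enn2real (ennreal \<bar>f x\<bar>) \<le> enn2real (linf_norm M f)"
      using assms(2) by (intro enn2real_mono) auto
    then show ?case by simp
  qed
qed

section \<open>Orthonormal systems\<close>

text \<open>The coefficients \<open>c\<close> are arbitrary because the density clause of
  \<open>orthonormal_basis\<close> yields approximations with unspecified coefficients, which then
  have to be compared with the Fourier coefficients.\<close>

lemma l2_norm_diff_orthonormal_sum:
  assumes "f \<in> L2 M" "finite J" "\<And>k. k \<in> J \<Longrightarrow> \<phi> k \<in> L2 M"
    and on: "\<And>j k. j \<in> J \<Longrightarrow> k \<in> J \<Longrightarrow> l2_inner M (\<phi> j) (\<phi> k) = (if j = k then 1 else 0)"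
  shows "(l2_norm M (\<lambda>x. f x - (\<Sum>k\<in>J. c k * \<phi> k x)))\<^sup>2
    = (l2_norm M f)\<^sup>2 - 2 * (\<Sum>k\<in>J. c k * l2_inner M f (\<phi> k)) + (\<Sum>k\<in>J. (c k)\<^sup>2)"
proof -
  let ?S = "\<lambda>x. \<Sum>k\<in>J. c k * \<phi> k x"
  have S: "?S \<in> L2 M" using assms by (intro L2_sum L2_scale)
  have fS: "l2_inner M f ?S = (\<Sum>k\<in>J. c k * l2_inner M f (\<phi> k))"
    using assms by (subst l2_inner_sum_right) (auto simp: l2_inner_scale_right L2_scale)
  have "l2_inner M ?S ?S = (\<Sum>k\<in>J. c k * (\<Sum>j\<in>J. c j * l2_inner M (\<phi> k) (\<phi> j)))"
    using assms S
    by (simp add: l2_inner_sum_left l2_inner_sum_right l2_inner_scale_left l2_inner_scale_right L2_scale)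
  also have "\<dots> = (\<Sum>k\<in>J. c k * (\<Sum>j\<in>J. if k = j then c j else 0))"
    using on by (intro sum.cong arg_cong2[where f="(*)"] refl) auto
  also have "\<dots> = (\<Sum>k\<in>J. (c k)\<^sup>2)"
    using \<open>finite J\<close> by (simp add: power2_eq_square)
  finally have SS: "l2_inner M ?S ?S = (\<Sum>k\<in>J. (c k)\<^sup>2)" .
  have "l2_inner M (\<lambda>x. f x - ?S x) (\<lambda>x. f x - ?S x)
      = l2_inner M f f - 2 * l2_inner M f ?S + l2_inner M ?S ?S"
    using assms(1) S
    by (simp add: l2_inner_diff_left l2_inner_diff_right L2_diff l2_inner_commute[of M ?S f])
  then show ?thesis unfolding l2_norm_power2 fS SS .
qed

lemma bessel_remainder:
  assumes "f \<in> L2 M" "finite J" "\<And>k. k \<in> J \<Longrightarrow> \<phi> k \<in> L2 M"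
    and "\<And>j k. j \<in> J \<Longrightarrow> k \<in> J \<Longrightarrow> l2_inner M (\<phi> j) (\<phi> k) = (if j = k then 1 else 0)"
  shows "(l2_norm M (\<lambda>x. f x - (\<Sum>k\<in>J. l2_inner M f (\<phi> k) * \<phi> k x)))\<^sup>2
    = (l2_norm M f)\<^sup>2 - (\<Sum>k\<in>J. (l2_inner M f (\<phi> k))\<^sup>2)"
  using l2_norm_diff_orthonormal_sum[OF assms, of "\<lambda>k. l2_inner M f (\<phi> k)"]
  by (simp add: power2_eq_square)

text \<open>By completing the square, no combination over \<open>J\<close> approximates better than
  the one with Fourier coefficients, and enlarging the index set only lowers the remainder. The
  prescribed part \<open>K\<close> lets a later argument keep the first \<open>n\<close> indices
  inside \<open>K'\<close>.\<close>

lemma bessel_remainder_arbitrarily_small: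
  assumes on: "orthonormal_basis M I \<phi>" and f: "f \<in> L2 M" and "0 < e" "finite K" "K \<subseteq> I"
  obtains K' where "finite K'" "K \<subseteq> K'" "K' \<subseteq> I"
    "(l2_norm M f)\<^sup>2 - (\<Sum>k\<in>K'. (l2_inner M f (\<phi> k))\<^sup>2) < e"
proof -
  let ?a = "\<lambda>k. l2_inner M f (\<phi> k)"
  have "sqrt e > 0" using \<open>0 < e\<close> by simp
  then obtain J c where J: "finite J" "J \<subseteq> I"
    and lt: "l2_norm M (\<lambda>x. f x - (\<Sum>k\<in>J. c k * \<phi> k x)) < sqrt e"
    using on f unfolding orthonormal_basis_def by meson
  have "(\<Sum>k\<in>J. (?a k)\<^sup>2) \<le> (\<Sum>k\<in>K \<union> J. (?a k)\<^sup>2)"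
    using J \<open>finite K\<close> by (intro sum_mono2) auto
  moreover have "0 \<le> (\<Sum>k\<in>J. (?a k - c k)\<^sup>2)" by (intro sum_nonneg) auto
  moreover have "(\<Sum>k\<in>J. (?a k - c k)\<^sup>2)
      = (\<Sum>k\<in>J. (?a k)\<^sup>2) - 2 * (\<Sum>k\<in>J. c k * ?a k) + (\<Sum>k\<in>J. (c k)\<^sup>2)"
    by (simp add: power2_diff sum.distrib sum_subtractf sum_distrib_left mult_ac)
  moreover have "(l2_norm M (\<lambda>x. f x - (\<Sum>k\<in>J. c k * \<phi> k x)))\<^sup>2
      = (l2_norm M f)\<^sup>2 - 2 * (\<Sum>k\<in>J. c k * ?a k) + (\<Sum>k\<in>J. (c k)\<^sup>2)"
    using on J f by (intro l2_norm_diff_orthonormal_sum) (auto simp: orthonormal_basis_def subset_iff)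
  moreover have "(l2_norm M (\<lambda>x. f x - (\<Sum>k\<in>J. c k * \<phi> k x)))\<^sup>2 < e"
    using power_strict_mono[OF lt l2_norm_nonneg, of 2] \<open>0 < e\<close> by simp
  ultimately have "(l2_norm M f)\<^sup>2 - (\<Sum>k\<in>K \<union> J. (?a k)\<^sup>2) < e" by linarith
  then show ?thesis using J assms(4,5) by (intro that[of "K \<union> J"]) auto
qed

text \<open>Indices outside \<open>K\<close> contribute nothing, so the remainder for
  \<open>K\<close> equals the remainder for every finite \<open>K'\<close> containing
  \<open>K\<close>, and that can be made arbitrarily small.\<close>

lemma finite_orthonormal_expansion:
  assumes on: "orthonormal_basis M I \<phi>" and f: "f \<in> L2 M" and K: "finite K" "K \<subseteq> I"
    and orth: "\<And>j. j \<in> I - K \<Longrightarrow> l2_inner M f (\<phi> j) = 0"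
  shows "AE x in M. f x = (\<Sum>k\<in>K. l2_inner M f (\<phi> k) * \<phi> k x)"
proof (rule l2_norm_diff_eq_0_AE)
  let ?r = "l2_norm M (\<lambda>x. f x - (\<Sum>k\<in>K. l2_inner M f (\<phi> k) * \<phi> k x))"
  have phi: "\<phi> k \<in> L2 M" if "k \<in> K" for k
    using on K that by (auto simp: orthonormal_basis_def)
  then show "(\<lambda>x. \<Sum>k\<in>K. l2_inner M f (\<phi> k) * \<phi> k x) \<in> L2 M"
    by (intro L2_sum L2_scale)
  have eq: "?r\<^sup>2 = (l2_norm M f)\<^sup>2 - (\<Sum>k\<in>K. (l2_inner M f (\<phi> k))\<^sup>2)"
    using on K phi f by (intro bessel_remainder) (auto simp: orthonormal_basis_def subset_iff)
  have "?r\<^sup>2 \<le> e" if e: "e > 0" for e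
  proof -
    obtain K' where K': "finite K'" "K \<subseteq> K'" "K' \<subseteq> I"
      "(l2_norm M f)\<^sup>2 - (\<Sum>k\<in>K'. (l2_inner M f (\<phi> k))\<^sup>2) < e"
      using bessel_remainder_arbitrarily_small[OF on f e K] .
    have "(\<Sum>k\<in>K'. (l2_inner M f (\<phi> k))\<^sup>2) = (\<Sum>k\<in>K. (l2_inner M f (\<phi> k))\<^sup>2)"
      using K' orth by (intro sum.mono_neutral_right) auto
    then show ?thesis using K' eq by simp
  qed
  then have "?r\<^sup>2 \<le> 0" by (rule field_le_epsilon[of _ 0, simplified])
  then show "?r = 0" by simp
qed (rule f)

section \<open>The semigroup on the eigenbasis\<close>

locale markov_eigenbasis = sigma_finite_measure M
  for M :: "'a measure" +
  fixes D :: "('a \<Rightarrow> real) set" and L :: "('a \<Rightarrow> real) \<Rightarrow> 'a \<Rightarrow> real"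
    and P :: "real \<Rightarrow> ('a \<Rightarrow> real) \<Rightarrow> 'a \<Rightarrow> real"
    and N :: enat and \<phi> :: "nat \<Rightarrow> 'a \<Rightarrow> real" and lam :: "nat \<Rightarrow> real"
  assumes nonneg_self_adjoint_L: "nonneg_self_adjoint M D L"
    and generated_semigroup_P: "generated_semigroup M D L P"
    and sub_markovian_P: "sub_markovian M P"
    and eigenbasis_phi: "eigenbasis M D L N \<phi> lam"
begin

abbreviation I where "I \<equiv> eigen_indices N"

lemma operator_L: "l2_operator M D L"
  using nonneg_self_adjoint_L by (simp add: nonneg_self_adjoint_def self_adjoint_def)

lemma subspace_D: "l2_subspace M D"
  using operator_L by (simp add: l2_operator_def)

lemma D_L2: "f \<in> D \<Longrightarrow> f \<in> L2 M"
  using subspace_D by (auto simp: l2_subspace_def)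

lemma L_L2: "f \<in> D \<Longrightarrow> L f \<in> L2 M"
  using operator_L by (auto simp: l2_operator_def)

lemma L_add: "f \<in> D \<Longrightarrow> g \<in> D \<Longrightarrow> AE x in M. L (\<lambda>y. f y + g y) x = L f x + L g x"
  using operator_L by (simp add: l2_operator_def)

lemma L_scale: "f \<in> D \<Longrightarrow> AE x in M. L (\<lambda>y. c * f y) x = c * L f x"
  using operator_L by (simp add: l2_operator_def)

text \<open>\<open>self_adjoint\<close> equates two graphs; symmetry is the inclusion of the graph
  of \<open>L\<close> in that of its adjoint.\<close>

lemma L_symmetric:
  assumes "f \<in> D" "g \<in> D"
  shows "l2_inner M (L f) g = l2_inner M f (L g)"
proof -
  have "adjoint_rel M D L g (L g)"
    using nonneg_self_adjoint_L assms L_L2[of g]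
    by (simp add: nonneg_self_adjoint_def self_adjoint_def)
  then show ?thesis using assms by (simp add: adjoint_rel_def)
qed

lemma operator_P: "0 \<le> t \<Longrightarrow> l2_operator M (L2 M) (P t)"
  using generated_semigroup_P by (simp add: generated_semigroup_def)

lemma P_L2: "0 \<le> t \<Longrightarrow> f \<in> L2 M \<Longrightarrow> P t f \<in> L2 M"
  using operator_P by (simp add: l2_operator_def)

lemma P_cong:
  "0 \<le> t \<Longrightarrow> f \<in> L2 M \<Longrightarrow> g \<in> L2 M \<Longrightarrow> AE x in M. f x = g x \<Longrightarrow> AE x in M. P t f x = P t g x"
  using operator_P by (simp add: l2_operator_def)

lemma P_add:
  "0 \<le> t \<Longrightarrow> f \<in> L2 M \<Longrightarrow> g \<in> L2 M \<Longrightarrow> AE x in M. P t (\<lambda>y. f y + g y) x = P t f x + P t g x"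
  using operator_P by (simp add: l2_operator_def)

lemma P_scale:
  "0 \<le> t \<Longrightarrow> f \<in> L2 M \<Longrightarrow> AE x in M. P t (\<lambda>y. c * f y) x = c * P t f x"
  using operator_P by (simp add: l2_operator_def)

lemma P_diff:
  assumes "0 \<le> t" "f \<in> L2 M" "g \<in> L2 M"
  shows "AE x in M. P t (\<lambda>y. f y - g y) x = P t f x - P t g x"
  using P_add[OF assms(1,2) L2_scale[OF assms(3), of "-1"]] P_scale[OF assms(1,3), of "-1"]
  by eventually_elim simp

lemma P_sum:
  assumes "0 \<le> t" "finite K" "\<And>k. k \<in> K \<Longrightarrow> f k \<in> L2 M"
  shows "AE x in M. P t (\<lambda>y. \<Sum>k\<in>K. c k * f k y) x = (\<Sum>k\<in>K. c k * P t (f k) x)"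
  using assms(2,3)
proof (induction K)
  case empty
  show ?case using P_scale[OF assms(1) L2_zero, of 0] by simp
next
  case (insert k K)
  have "AE x in M. P t (\<lambda>y. \<Sum>k\<in>K. c k * f k y) x = (\<Sum>k\<in>K. c k * P t (f k) x)"
    using insert by auto
  moreover have "AE x in M. P t (\<lambda>y. c k * f k y + (\<Sum>k\<in>K. c k * f k y)) x
      = P t (\<lambda>y. c k * f k y) x + P t (\<lambda>y. \<Sum>k\<in>K. c k * f k y) x"
    using insert by (intro P_add assms(1) L2_scale L2_sum) auto
  moreover have "AE x in M. P t (\<lambda>y. c k * f k y) x = c k * P t (f k) x"
    using insert by (intro P_scale assms(1)) auto
  ultimately show ?case
    unfolding sum.insert[OF insert.hyps] by eventually_elim simp
qed

lemma P_bounded: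
  assumes "0 \<le> t"
  obtains C where "0 \<le> C" "\<And>f. f \<in> L2 M \<Longrightarrow> l2_norm M (P t f) \<le> C * l2_norm M f"
proof -
  obtain C where C: "\<forall>f\<in>L2 M. l2_norm M (P t f) \<le> C * l2_norm M f"
    using generated_semigroup_P assms unfolding generated_semigroup_def by blast
  have "l2_norm M (P t f) \<le> max 0 C * l2_norm M f" if "f \<in> L2 M" for f
    using C that mult_right_mono[of C "max 0 C" "l2_norm M f"] l2_norm_nonneg[of M f] by fastforce
  then show ?thesis using that[of "max 0 C"] by simp
qed

lemma P_zero: "f \<in> L2 M \<Longrightarrow> AE x in M. P 0 f x = f x"
  using generated_semigroup_P by (simp add: generated_semigroup_def)

lemma P_semigroup:
  "0 \<le> s \<Longrightarrow> 0 \<le> t \<Longrightarrow> f \<in> L2 M \<Longrightarrow> AE x in M. P (s + t) f x = P s (P t f) x"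
  using generated_semigroup_P by (simp add: generated_semigroup_def)

lemma generator_iff:
  "f \<in> L2 M \<Longrightarrow> g \<in> L2 M \<Longrightarrow>
    (f \<in> D \<and> (AE x in M. g x = L f x)) \<longleftrightarrow>
    ((\<lambda>t. l2_norm M (\<lambda>x. (P t f x - f x) / t - (- g x))) \<longlongrightarrow> 0) (at_right 0)"
  using generated_semigroup_P unfolding generated_semigroup_def by blast

lemma generator_tendsto:
  assumes "f \<in> D"
  shows "((\<lambda>t. l2_norm M (\<lambda>x. (P t f x - f x) / t + L f x)) \<longlongrightarrow> 0) (at_right 0)"
  using generator_iff[OF D_L2[OF assms] L_L2[OF assms]] assms by simp

text \<open>\<open>P t\<close> is bounded and commutes with \<open>P h\<close>, so it can be pulled
  through the difference quotient at 0. The quotient of \<open>P t f\<close> therefore converges,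
  and \<open>generator_iff\<close> read from right to left yields both membership in the domain and
  the value.\<close>

lemma L_P_commute:
  assumes f: "f \<in> D" and t: "0 \<le> t"
  shows "P t f \<in> D" "AE x in M. L (P t f) x = P t (L f) x"
proof -
  note fL = D_L2[OF f] note LfL = L_L2[OF f]
  obtain C where C: "0 \<le> C" "\<And>f. f \<in> L2 M \<Longrightarrow> l2_norm M (P t f) \<le> C * l2_norm M f"
    using P_bounded[OF t] by blast
  have "((\<lambda>h. l2_norm M (\<lambda>x. (P h (P t f) x - P t f x) / h - (- P t (L f) x))) \<longlongrightarrow> 0) (at_right 0)"
  proof (rule Lim_null_comparison)
    show "((\<lambda>h. C * l2_norm M (\<lambda>x. (P h f x - f x) / h + L f x)) \<longlongrightarrow> 0) (at_right 0)"
      using tendsto_mult_left[OF generator_tendsto[OF f], of C] by simp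
    show "\<forall>\<^sub>F h in at_right 0. norm (l2_norm M (\<lambda>x. (P h (P t f) x - P t f x) / h - (- P t (L f) x)))
        \<le> C * l2_norm M (\<lambda>x. (P h f x - f x) / h + L f x)"
      using eventually_at_right_less[of 0]
    proof eventually_elim
      case (elim h)
      then have h: "0 \<le> h" "0 < h" by auto
      \<comment> \<open>The error of the difference quotient of \<open>f\<close>; its image under
        \<open>P t\<close> is the corresponding error for \<open>P t f\<close>.\<close>
      let ?u = "\<lambda>x. (1 / h) * (P h f x - f x) + L f x"
      have u: "(\<lambda>x. (1 / h) * (P h f x - f x)) \<in> L2 M" "?u \<in> L2 M"
        using fL LfL P_L2[OF h(1) fL] by (auto intro!: L2_intros)
      have "AE x in M. P h (P t f) x = P t (P h f) x"
        using P_semigroup[OF h(1) t fL] P_semigroup[OF t h(1) fL] by (simp add: add.commute) (elim AE_mp, simp)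
      moreover have "AE x in M. P t ?u x = P t (\<lambda>x. (1 / h) * (P h f x - f x)) x + P t (L f) x"
        by (intro P_add t u LfL)
      moreover have "AE x in M. P t (\<lambda>x. (1 / h) * (P h f x - f x)) x = (1 / h) * P t (\<lambda>x. P h f x - f x) x"
        by (intro P_scale t L2_diff P_L2 h fL)
      moreover have "AE x in M. P t (\<lambda>x. P h f x - f x) x = P t (P h f) x - P t f x"
        by (intro P_diff t P_L2 h fL)
      ultimately have "AE x in M. (P h (P t f) x - P t f x) / h - (- P t (L f) x) = P t ?u x"
        by eventually_elim simp
      then have "l2_norm M (\<lambda>x. (P h (P t f) x - P t f x) / h - (- P t (L f) x)) = l2_norm M (P t ?u)"
        using fL LfL u t h
        by (intro l2_norm_cong_AE L2_measurable L2_divide L2_diff L2_minus P_L2) auto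
      also have "\<dots> \<le> C * l2_norm M ?u" by (rule C(2)[OF u(2)])
      finally show ?case by (simp add: l2_norm_nonneg)
    qed
  qed
  then have *: "P t f \<in> D \<and> (AE x in M. P t (L f) x = L (P t f) x)"
    using generator_iff[OF P_L2[OF t fL] P_L2[OF t LfL]] by simp
  then show "P t f \<in> D" by simp
  from * have "AE x in M. P t (L f) x = L (P t f) x" by simp
  then show "AE x in M. L (P t f) x = P t (L f) x" by eventually_elim simp
qed

section \<open>Spectral data of \<open>L\<close>\<close>

lemma orthonormal_phi: "orthonormal_basis M I \<phi>"
  using eigenbasis_phi by (simp add: eigenbasis_def)

lemma phi_L2: "k \<in> I \<Longrightarrow> \<phi> k \<in> L2 M"
  using orthonormal_phi by (simp add: orthonormal_basis_def)

lemma phi_D: "k \<in> I \<Longrightarrow> \<phi> k \<in> D"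
  using eigenbasis_phi by (simp add: eigenbasis_def)

lemma phi_inner: "j \<in> I \<Longrightarrow> k \<in> I \<Longrightarrow> l2_inner M (\<phi> j) (\<phi> k) = (if j = k then 1 else 0)"
  using orthonormal_phi by (simp add: orthonormal_basis_def)

lemma L_phi: "k \<in> I \<Longrightarrow> AE x in M. L (\<phi> k) x = lam k * \<phi> k x"
  using eigenbasis_phi by (simp add: eigenbasis_def)

lemma lam_nonneg: "k \<in> I \<Longrightarrow> 0 \<le> lam k"
  using eigenbasis_phi by (simp add: eigenbasis_def)

lemma lam_mono: "j \<in> I \<Longrightarrow> k \<in> I \<Longrightarrow> j \<le> k \<Longrightarrow> lam j \<le> lam k"
  using eigenbasis_phi by (simp add: eigenbasis_def)

lemma l2_norm_phi: "k \<in> I \<Longrightarrow> l2_norm M (\<phi> k) = 1"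
  by (simp add: l2_norm_def phi_inner)

lemma finite_eigenvalues_le: "finite {k \<in> I. lam k \<le> r}"
proof (cases N)
  case (enat m)
  then have "{k \<in> I. lam k \<le> r} \<subseteq> {..m}" by (auto simp: eigen_indices_def)
  then show ?thesis by (rule finite_subset) simp
next
  case infinity
  then have "filterlim lam at_top sequentially"
    using eigenbasis_phi by (simp add: eigenbasis_def)
  then have "\<forall>\<^sub>F k in sequentially. r < lam k"
    by (simp add: filterlim_at_top_dense)
  then obtain m where "\<And>k. k \<ge> m \<Longrightarrow> r < lam k"
    by (auto simp: eventually_sequentially)
  then have "{k \<in> I. lam k \<le> r} \<subseteq> {..m}" by (force simp: not_less[symmetric])
  then show ?thesis by (rule finite_subset) simp
qed

text \<open>Symmetry gives \<open>r * l2_inner M f (\<phi> j) = lam j * l2_inner M f (\<phi>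
  j)\<close>, so coefficients at other eigenvalues vanish. The remaining index set is finite, which
  makes eigenspaces finite dimensional.\<close>

lemma eigenvector_expansion:
  assumes f: "f \<in> D" "AE x in M. L f x = r * f x"
  shows "AE x in M. f x = (\<Sum>k | k \<in> I \<and> lam k = r. l2_inner M f (\<phi> k) * \<phi> k x)"
proof (rule finite_orthonormal_expansion[OF orthonormal_phi D_L2[OF f(1)]])
  show "finite {k. k \<in> I \<and> lam k = r}"
    by (rule finite_subset[OF _ finite_eigenvalues_le[of r]]) auto
  fix j assume j: "j \<in> I - {k. k \<in> I \<and> lam k = r}"
  have "r * l2_inner M f (\<phi> j) = l2_inner M (\<lambda>x. r * f x) (\<phi> j)"
    by (simp add: l2_inner_scale_left)
  also have "\<dots> = l2_inner M (L f) (\<phi> j)"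
    using f j L_L2[of f] D_L2[of f] phi_L2[of j] by (intro l2_inner_cong_AE L2_measurable L2_scale) auto
  also have "\<dots> = l2_inner M f (L (\<phi> j))"
    using f j by (intro L_symmetric phi_D) auto
  also have "\<dots> = l2_inner M f (\<lambda>x. lam j * \<phi> j x)"
    using f j L_L2[OF phi_D, of j] D_L2[of f] phi_L2[of j] L_phi[of j]
    by (intro l2_inner_cong_AE L2_measurable L2_scale) auto
  also have "\<dots> = lam j * l2_inner M f (\<phi> j)"
    by (simp add: l2_inner_scale_right)
  finally show "l2_inner M f (\<phi> j) = 0" using j by auto
qed auto

section \<open>Action of the semigroup on eigenvectors\<close>

lemma P_phi_first_order:
  assumes k: "k \<in> I"
  shows "((\<lambda>h. l2_norm M (\<lambda>x. P h (\<phi> k) x - exp (- lam k * h) * \<phi> k x) / h) \<longlongrightarrow> 0) (at_right 0)"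
\<comment> \<open>Both \<open>P h (\<phi> k)\<close> and the exponential multiple of
  \<open>\<phi> k\<close> start at \<open>\<phi> k\<close> and have right derivative
  \<open>- lam k\<close> times \<open>\<phi> k\<close> at 0; the error is split into the errors of
  these two difference quotients.\<close>
proof (rule Lim_null_comparison)
  let ?l = "lam k"
  have "((\<lambda>h. exp (- ?l * h)) has_real_derivative - ?l) (at 0)"
    by (auto intro!: derivative_eq_intros)
  then have "((\<lambda>h. (exp (- ?l * h) - 1) / h) \<longlongrightarrow> - ?l) (at 0)"
    by (simp add: has_field_derivative_iff)
  then have "((\<lambda>h. (exp (- ?l * h) - 1) / h) \<longlongrightarrow> - ?l) (at_right 0)"
    by (rule tendsto_within_subset[where S=UNIV]) simp
  then have "((\<lambda>h. (exp (- ?l * h) - 1) / h - (- ?l)) \<longlongrightarrow> 0) (at_right 0)"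
    by (subst (asm) Lim_null)
  from tendsto_add[OF generator_tendsto[OF phi_D[OF k]] tendsto_rabs[OF this]]
  show "((\<lambda>h. l2_norm M (\<lambda>x. (P h (\<phi> k) x - \<phi> k x) / h + L (\<phi> k) x)
      + \<bar>(exp (- ?l * h) - 1) / h - (- ?l)\<bar>) \<longlongrightarrow> 0) (at_right 0)"
    by simp
  show "\<forall>\<^sub>F h in at_right 0. norm (l2_norm M (\<lambda>x. P h (\<phi> k) x - exp (- ?l * h) * \<phi> k x) / h)
      \<le> l2_norm M (\<lambda>x. (P h (\<phi> k) x - \<phi> k x) / h + L (\<phi> k) x)
        + \<bar>(exp (- ?l * h) - 1) / h - (- ?l)\<bar>"
    using eventually_at_right_less[of 0]
  proof eventually_elim
    case (elim h)
    then have h: "0 < h" "0 \<le> h" by auto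
    let ?c = "- ((exp (- ?l * h) - 1) / h - (- ?l))"
    let ?u = "\<lambda>x. (P h (\<phi> k) x - \<phi> k x) / h + L (\<phi> k) x"
    note [intro] = phi_L2[OF k] P_L2[OF h(2) phi_L2[OF k]] L_L2[OF phi_D[OF k]]
    have u: "?u \<in> L2 M" by (intro L2_intros) auto
    have "l2_norm M (\<lambda>x. P h (\<phi> k) x - exp (- ?l * h) * \<phi> k x) / h
        = l2_norm M (\<lambda>x. (1 / h) * (P h (\<phi> k) x - exp (- ?l * h) * \<phi> k x))"
      using h by (subst l2_norm_scale) simp
    also have "\<dots> = l2_norm M (\<lambda>x. ?u x + ?c * \<phi> k x)"
    proof (rule l2_norm_cong_AE)
      show "AE x in M. (1 / h) * (P h (\<phi> k) x - exp (- ?l * h) * \<phi> k x) = ?u x + ?c * \<phi> k x"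
        using L_phi[OF k] by eventually_elim (use h in \<open>simp add: field_simps\<close>)
    qed (auto intro!: L2_measurable L2_intros)
    also have "\<dots> \<le> l2_norm M ?u + l2_norm M (\<lambda>x. ?c * \<phi> k x)"
      using u by (intro l2_norm_triangle) (auto intro!: L2_scale)
    finally show ?case
      using h by (simp add: l2_norm_scale l2_norm_phi[OF k] l2_norm_nonneg)
  qed
qed

text \<open>The difference quotient of \<^term>\<open>P\<close> is only known to converge from the right, so the
  exponential is reached through \<open>P t = (P (t/m))^m\<close>; the convergence is uniform on an eigenspace
  since eigenspaces have finite dimension.\<close>

lemma P_eigenspace_approx:
  assumes "0 < e"
  obtains d where "0 < d"
    "\<And>h f. 0 < h \<Longrightarrow> h < d \<Longrightarrow> f \<in> D \<Longrightarrow> AE x in M. L f x = r * f x \<Longrightarrow>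
      l2_norm M (\<lambda>x. P h f x - exp (- r * h) * f x) \<le> e * h * l2_norm M f"
proof -
  let ?K = "{k. k \<in> I \<and> lam k = r}"
  have K: "finite ?K"
    by (rule finite_subset[OF _ finite_eigenvalues_le[of r]]) auto
  let ?n = "\<lambda>h k. l2_norm M (\<lambda>x. P h (\<phi> k) x - exp (- r * h) * \<phi> k x)"
  have "((\<lambda>h. \<Sum>k\<in>?K. ?n h k / h) \<longlongrightarrow> 0) (at_right 0)"
    using P_phi_first_order by (intro tendsto_null_sum) auto
  then have "\<forall>\<^sub>F h in at_right 0. (\<Sum>k\<in>?K. ?n h k / h) < e"
    using \<open>0 < e\<close> by (rule order_tendstoD)
  then obtain d where d: "0 < d" "\<And>h. 0 < h \<Longrightarrow> h < d \<Longrightarrow> (\<Sum>k\<in>?K. ?n h k / h) < e"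
    by (auto simp: eventually_at_right_field)
  have "l2_norm M (\<lambda>x. P h f x - exp (- r * h) * f x) \<le> e * h * l2_norm M f"
    if h: "0 < h" "h < d" and f: "f \<in> D" "AE x in M. L f x = r * f x" for h f
  proof -
    have h0: "0 \<le> h" using h by simp
    let ?a = "\<lambda>k. l2_inner M f (\<phi> k)"
    let ?S = "\<lambda>x. \<Sum>k\<in>?K. ?a k * \<phi> k x"
    have S: "?S \<in> L2 M" by (intro L2_sum L2_scale phi_L2) auto
    have fS: "AE x in M. f x = ?S x" by (rule eigenvector_expansion[OF f])
    have "AE x in M. P h f x = (\<Sum>k\<in>?K. ?a k * P h (\<phi> k) x)"
      using P_cong[OF h0 D_L2[OF f(1)] S fS] P_sum[OF h0 K, of \<phi> ?a] phi_L2
      by (auto elim!: AE_mp)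
    then have "AE x in M. P h f x - exp (- r * h) * f x
        = (\<Sum>k\<in>?K. ?a k * (P h (\<phi> k) x - exp (- r * h) * \<phi> k x))"
      using fS by eventually_elim (simp add: sum_distrib_left right_diff_distrib sum_subtractf mult_ac)
    then have "l2_norm M (\<lambda>x. P h f x - exp (- r * h) * f x)
        = l2_norm M (\<lambda>x. \<Sum>k\<in>?K. ?a k * (P h (\<phi> k) x - exp (- r * h) * \<phi> k x))"
      using P_L2[OF h0] phi_L2 D_L2[OF f(1)]
      by (intro l2_norm_cong_AE L2_measurable L2_diff L2_scale L2_sum) auto
    also have "\<dots> \<le> (\<Sum>k\<in>?K. \<bar>?a k\<bar> * ?n h k)"
      using l2_norm_sum_le[of ?K "\<lambda>k x. ?a k * (P h (\<phi> k) x - exp (- r * h) * \<phi> k x)" M]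
        P_L2[OF h0] phi_L2 by (simp add: l2_norm_scale L2_diff L2_scale)
    also have "\<dots> \<le> (\<Sum>k\<in>?K. l2_norm M f * ?n h k)"
      using l2_cauchy_schwarz[OF D_L2[OF f(1)] phi_L2]
      by (intro sum_mono mult_right_mono l2_norm_nonneg) (auto simp: l2_norm_phi)
    also have "\<dots> = l2_norm M f * h * (\<Sum>k\<in>?K. ?n h k / h)"
      using h by (simp add: sum_distrib_left)
    also have "\<dots> \<le> l2_norm M f * h * e"
      using d(2)[OF h] h l2_norm_nonneg[of M f] by (intro mult_left_mono) auto
    finally show ?thesis by (simp add: mult_ac)
  qed
  then show ?thesis using that d(1) by blast
qed

text \<open>The interval is cut into \<open>m\<close> steps short enough for the one-step estimate
  with rate \<open>e\<close>. The accumulated error is at most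
  \<open>(exp (e * t) - 1) * l2_norm M f\<close> whatever \<open>m\<close> is, and \<open>e\<close>
  then tends to 0.\<close>

lemma P_eigenvector:
  assumes f: "f \<in> D" "AE x in M. L f x = r * f x" and "0 \<le> r" and t: "0 < t"
  shows "AE x in M. P t f x = exp (- r * t) * f x"
proof (rule l2_norm_diff_eq_0_AE)
  let ?F = "l2_norm M f"
  note fL = D_L2[OF f(1)]
  show "P t f \<in> L2 M" "(\<lambda>x. exp (- r * t) * f x) \<in> L2 M"
    using t fL by (auto intro: P_L2 L2_scale)
  let ?d = "\<lambda>s. l2_norm M (\<lambda>x. P s f x - exp (- r * s) * f x)"
  \<comment> \<open>The one-step estimate is applied again at each intermediate time, hence to
    \<open>P s f\<close>, which must itself be an eigenvector for \<open>r\<close>.\<close>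
  have eig: "P s f \<in> D" "AE x in M. L (P s f) x = r * P s f x" if "0 \<le> s" for s
  proof -
    show "P s f \<in> D" by (rule L_P_commute[OF f(1) that])
    have "AE x in M. P s (L f) x = P s (\<lambda>x. r * f x) x"
      by (rule P_cong[OF that L_L2[OF f(1)] L2_scale[OF fL] f(2)])
    with L_P_commute(2)[OF f(1) that] P_scale[OF that fL, of r]
    show "AE x in M. L (P s f) x = r * P s f x"
      by eventually_elim simp
  qed
  have bound: "?d t \<le> (exp (e * t) - 1) * ?F" if e: "0 < e" for e
  proof -
    obtain \<delta> where \<delta>: "0 < \<delta>"
      "\<And>h f. 0 < h \<Longrightarrow> h < \<delta> \<Longrightarrow> f \<in> D \<Longrightarrow> AE x in M. L f x = r * f x \<Longrightarrow>
        l2_norm M (\<lambda>x. P h f x - exp (- r * h) * f x) \<le> e * h * l2_norm M f"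
      using P_eigenspace_approx[OF e] by blast
    obtain m :: nat where m: "t / \<delta> < real m" using reals_Archimedean2 by blast
    have m0: "0 < real m" using m divide_pos_pos[OF t \<delta>(1)] by linarith
    define h where "h = t / real m"
    have h: "0 < h" "h < \<delta>" "0 \<le> h"
      using m m0 t \<delta>(1) by (auto simp: h_def field_simps)
    \<comment> \<open>Each step turns the error d into at most d + e h (d + F): the old error is
      damped by exp(-r h) \<le> 1, and the new one is proportional to the norm of
      \<open>P ?s f\<close>, at most d + F. Adding F to the error makes this recursion a pure
      multiplication by 1 + e h.\<close>
    have step: "?d (real i * h) + ?F \<le> (1 + e * h) ^ i * ?F" for i
    proof (induction i)
      case 0
      have "?d 0 = l2_norm M (\<lambda>x. 0)"
        using P_zero[OF fL] P_L2[OF _ fL, of 0] fL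
        by (intro l2_norm_cong_AE L2_measurable L2_diff L2_scale L2_zero) auto
      then show ?case by (simp add: l2_norm_zero)
    next
      case (Suc i)
      let ?s = "real i * h"
      have s: "0 \<le> ?s" using h by simp
      have exp_Suc: "exp (- r * (real (Suc i) * h)) = exp (- r * h) * exp (- r * ?s)"
        by (simp add: exp_add[symmetric] algebra_simps)
      note PsL = P_L2[OF s fL] note PhL = P_L2[OF h(3) PsL]
      have "AE x in M. P (h + ?s) f x = P h (P ?s f) x"
        by (rule P_semigroup[OF h(3) s fL])
      then have "AE x in M. P (real (Suc i) * h) f x = P h (P ?s f) x"
        by (simp add: distrib_right)
      then have "?d (real (Suc i) * h)
          = l2_norm M (\<lambda>x. P h (P ?s f) x - exp (- r * (real (Suc i) * h)) * f x)"
        using h fL PhL by (intro l2_norm_cong_AE L2_measurable L2_diff L2_scale P_L2) auto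
      also have "\<dots> \<le> l2_norm M (\<lambda>x. P h (P ?s f) x - exp (- r * h) * P ?s f x)
          + l2_norm M (\<lambda>x. exp (- r * h) * P ?s f x - exp (- r * (real (Suc i) * h)) * f x)"
        by (intro l2_norm_triangle_diff L2_scale PhL PsL fL)
      finally have split: "?d (real (Suc i) * h)
          \<le> l2_norm M (\<lambda>x. P h (P ?s f) x - exp (- r * h) * P ?s f x)
            + l2_norm M (\<lambda>x. exp (- r * h) * P ?s f x - exp (- r * (real (Suc i) * h)) * f x)" .
      have "l2_norm M (\<lambda>x. exp (- r * h) * P ?s f x - exp (- r * (real (Suc i) * h)) * f x)
          = l2_norm M (\<lambda>x. exp (- r * h) * (P ?s f x - exp (- r * ?s) * f x))"
        unfolding exp_Suc by (simp only: right_diff_distrib mult.assoc)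
      also have "\<dots> = exp (- r * h) * ?d ?s"
        unfolding l2_norm_scale by simp
      also have "\<dots> \<le> 1 * ?d ?s"
        using \<open>0 \<le> r\<close> h by (intro mult_right_mono l2_norm_nonneg) simp
      finally have second: "l2_norm M (\<lambda>x. exp (- r * h) * P ?s f x - exp (- r * (real (Suc i) * h)) * f x)
          \<le> ?d ?s" by simp
      have "l2_norm M (\<lambda>x. (P ?s f x - exp (- r * ?s) * f x) + exp (- r * ?s) * f x)
          \<le> ?d ?s + l2_norm M (\<lambda>x. exp (- r * ?s) * f x)"
        by (intro l2_norm_triangle L2_diff L2_scale PsL fL)
      moreover have "l2_norm M (\<lambda>x. exp (- r * ?s) * f x) \<le> 1 * ?F"
        unfolding l2_norm_scale
        using \<open>0 \<le> r\<close> s by (intro mult_right_mono l2_norm_nonneg) simp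
      ultimately have Ps: "l2_norm M (P ?s f) \<le> ?d ?s + ?F" by simp
      have "l2_norm M (\<lambda>x. P h (P ?s f) x - exp (- r * h) * P ?s f x) \<le> e * h * l2_norm M (P ?s f)"
        using eig[OF s] h by (intro \<delta>(2)) auto
      also have "\<dots> \<le> e * h * (?d ?s + ?F)"
        using Ps h e by (intro mult_left_mono) auto
      finally have "?d (real (Suc i) * h) \<le> e * h * (?d ?s + ?F) + ?d ?s"
        using split second by linarith
      then have "?d (real (Suc i) * h) + ?F \<le> (1 + e * h) * (?d ?s + ?F)"
        by (simp add: algebra_simps)
      also have "\<dots> \<le> (1 + e * h) * ((1 + e * h) ^ i * ?F)"
        using Suc h e by (intro mult_left_mono) auto
      finally show ?case by simp
    qed
    have "?d t + ?F \<le> (1 + e * h) ^ m * ?F"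
      using step[of m] m0 by (simp add: h_def)
    also have "\<dots> \<le> exp (e * h) ^ m * ?F"
      using h e by (intro mult_right_mono power_mono exp_ge_add_one_self l2_norm_nonneg) auto
    also have "exp (e * h) ^ m = exp (e * t)"
      using m0 by (simp add: exp_of_nat_mult[symmetric] h_def)
    finally show ?thesis by (simp add: algebra_simps)
  qed
  have "((\<lambda>e. (exp (e * t) - 1) * ?F) \<longlongrightarrow> (exp (0 * t) - 1) * ?F) (at_right 0)"
    by (intro tendsto_intros)
  then have "?d t \<le> (exp (0 * t) - 1) * ?F"
    by (rule tendsto_lowerbound)
      (use bound in \<open>auto intro: eventually_mono[OF eventually_at_right_less[of 0]]\<close>)
  then show "?d t = 0" using l2_norm_nonneg[of M "\<lambda>x. P t f x - exp (- r * t) * f x"] by simp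
qed

section \<open>Symmetry of the semigroup\<close>

lemma bounded_functional_eq_0:
  assumes f: "f \<in> L2 M"
    and diff: "\<And>f g. f \<in> L2 M \<Longrightarrow> g \<in> L2 M \<Longrightarrow> b (\<lambda>x. f x - g x) = b f - b g"
    and bd: "\<And>f. f \<in> L2 M \<Longrightarrow> \<bar>b f\<bar> \<le> C * l2_norm M f"
    and basis: "\<And>J c. finite J \<Longrightarrow> J \<subseteq> I \<Longrightarrow> b (\<lambda>x. \<Sum>k\<in>J. c k * \<phi> k x) = 0"
  shows "b f = (0 :: real)"
proof -
  \<comment> \<open>The sign of \<open>C\<close> is left open in the hypothesis, hence the maximum
    with 0.\<close>
  have "\<bar>b f\<bar> \<le> max C 0 * e" if "0 < e" for e
  proof -
    obtain J c where J: "finite J" "J \<subseteq> I" "l2_norm M (\<lambda>x. f x - (\<Sum>k\<in>J. c k * \<phi> k x)) < e"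
      using orthonormal_phi f \<open>0 < e\<close> unfolding orthonormal_basis_def by meson
    have S: "(\<lambda>x. \<Sum>k\<in>J. c k * \<phi> k x) \<in> L2 M"
      using J phi_L2 by (intro L2_sum L2_scale) auto
    have "b f = b (\<lambda>x. f x - (\<Sum>k\<in>J. c k * \<phi> k x))"
      using diff[OF f S] basis[OF J(1,2)] by simp
    then have "\<bar>b f\<bar> \<le> C * l2_norm M (\<lambda>x. f x - (\<Sum>k\<in>J. c k * \<phi> k x))"
      using bd[OF L2_diff[OF f S]] by simp
    also have "\<dots> \<le> max C 0 * e"
      using J(3) l2_norm_nonneg[of M "\<lambda>x. f x - (\<Sum>k\<in>J. c k * \<phi> k x)"] by (intro mult_mono) auto
    finally show ?thesis .
  qed
  moreover have "((\<lambda>e. max C 0 * e) \<longlongrightarrow> max C 0 * 0) (at_right 0)"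
    by (intro tendsto_intros)
  ultimately have "\<bar>b f\<bar> \<le> max C 0 * 0"
    by (intro tendsto_lowerbound[of "\<lambda>e. max C 0 * e" _ "at_right 0"])
      (auto intro: eventually_mono[OF eventually_at_right_less[of 0]])
  then show ?thesis by simp
qed

text \<open>Both sides are bounded in \<open>f\<close>, so by density \<open>f\<close> may be taken
  to be a basis vector. There either the two indices agree, and so do the exponentials, or the inner
  product is 0.\<close>

lemma inner_P_phi:
  assumes t: "0 < t" and f: "f \<in> L2 M" and j: "j \<in> I"
  shows "l2_inner M (P t f) (\<phi> j) = l2_inner M f (P t (\<phi> j))"
proof -
  have t0: "0 \<le> t" using t by simp
  obtain C where C: "0 \<le> C" "\<And>f. f \<in> L2 M \<Longrightarrow> l2_norm M (P t f) \<le> C * l2_norm M f"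
    using P_bounded[OF t0] by blast
  have Pphi: "AE x in M. P t (\<phi> k) x = exp (- lam k * t) * \<phi> k x" if "k \<in> I" for k
    using P_eigenvector[OF phi_D L_phi lam_nonneg t] that by simp
  note pj = phi_L2[OF j] P_L2[OF t0 phi_L2[OF j]]
  have "l2_inner M (P t f) (\<phi> j) - l2_inner M f (P t (\<phi> j)) = 0"
  proof (rule bounded_functional_eq_0[OF f, where C = "2 * C"])
    fix f g assume fg: "f \<in> L2 M" "g \<in> L2 M"
    have "l2_inner M (P t (\<lambda>x. f x - g x)) (\<phi> j) = l2_inner M (\<lambda>x. P t f x - P t g x) (\<phi> j)"
      by (intro l2_inner_cong_AE P_diff L2_measurable P_L2 L2_diff t0 fg pj) auto
    then show "l2_inner M (P t (\<lambda>x. f x - g x)) (\<phi> j) - l2_inner M (\<lambda>x. f x - g x) (P t (\<phi> j))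
        = l2_inner M (P t f) (\<phi> j) - l2_inner M f (P t (\<phi> j))
          - (l2_inner M (P t g) (\<phi> j) - l2_inner M g (P t (\<phi> j)))"
      using fg pj P_L2[OF t0] by (simp add: l2_inner_diff_left)
  next
    fix f assume f: "f \<in> L2 M"
    have "\<bar>l2_inner M (P t f) (\<phi> j)\<bar> \<le> C * l2_norm M f"
      using l2_cauchy_schwarz[OF P_L2[OF t0 f] pj(1)] C(2)[OF f] by (simp add: l2_norm_phi[OF j])
    moreover have "\<bar>l2_inner M f (P t (\<phi> j))\<bar> \<le> C * l2_norm M f"
    proof -
      have "\<bar>l2_inner M f (P t (\<phi> j))\<bar> \<le> l2_norm M f * l2_norm M (P t (\<phi> j))"
        by (rule l2_cauchy_schwarz[OF f pj(2)])
      also have "\<dots> \<le> l2_norm M f * C"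
        using C(2)[OF pj(1)] by (intro mult_left_mono l2_norm_nonneg) (simp add: l2_norm_phi[OF j])
      finally show ?thesis by (simp add: mult.commute)
    qed
    ultimately show "\<bar>l2_inner M (P t f) (\<phi> j) - l2_inner M f (P t (\<phi> j))\<bar> \<le> 2 * C * l2_norm M f"
      by linarith
  next
    fix J and c :: "nat \<Rightarrow> real" assume J: "finite J" "J \<subseteq> I"
    then have JI: "\<And>k. k \<in> J \<Longrightarrow> k \<in> I" by auto
    have eq: "l2_inner M (P t (\<phi> k)) (\<phi> j) = l2_inner M (\<phi> k) (P t (\<phi> j))" if "k \<in> I" for k
    proof -
      have "l2_inner M (P t (\<phi> k)) (\<phi> j) = l2_inner M (\<lambda>x. exp (- lam k * t) * \<phi> k x) (\<phi> j)"
        by (intro l2_inner_cong_AE L2_measurable P_L2 L2_scale phi_L2 that t0 j Pphi) auto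
      also have "\<dots> = l2_inner M (\<phi> k) (\<lambda>x. exp (- lam j * t) * \<phi> j x)"
        unfolding l2_inner_scale_left l2_inner_scale_right using phi_inner[OF that j] by simp
      also have "\<dots> = l2_inner M (\<phi> k) (P t (\<phi> j))"
        using Pphi[OF j] by (intro l2_inner_cong_AE L2_measurable P_L2 L2_scale phi_L2 that t0 j) auto
      finally show ?thesis .
    qed
    have "l2_inner M (P t (\<lambda>x. \<Sum>k\<in>J. c k * \<phi> k x)) (\<phi> j)
        = l2_inner M (\<lambda>x. \<Sum>k\<in>J. c k * P t (\<phi> k) x) (\<phi> j)"
      by (intro l2_inner_cong_AE L2_measurable P_L2 L2_sum L2_scale phi_L2 JI t0 j P_sum J) auto
    also have "\<dots> = l2_inner M (\<lambda>x. \<Sum>k\<in>J. c k * \<phi> k x) (P t (\<phi> j))"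
      using JI pj t0 eq
      by (simp add: l2_inner_sum_left L2_scale P_L2 phi_L2 l2_inner_scale_left)
    finally show "l2_inner M (P t (\<lambda>x. \<Sum>k\<in>J. c k * \<phi> k x)) (\<phi> j)
        - l2_inner M (\<lambda>x. \<Sum>k\<in>J. c k * \<phi> k x) (P t (\<phi> j)) = 0" by simp
  qed
  then show ?thesis by simp
qed

text \<open>The density argument once more, now in the second variable; \<open>inner_P_phi\<close>
  supplies the basis vectors for arbitrary \<open>f\<close>.\<close>

lemma P_symmetric:
  assumes t: "0 < t" and f: "f \<in> L2 M" and g: "g \<in> L2 M"
  shows "l2_inner M (P t f) g = l2_inner M f (P t g)"
proof -
  have t0: "0 \<le> t" using t by simp
  obtain C where C: "0 \<le> C" "\<And>f. f \<in> L2 M \<Longrightarrow> l2_norm M (P t f) \<le> C * l2_norm M f"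
    using P_bounded[OF t0] by blast
  note Pf = P_L2[OF t0 f]
  have "l2_inner M (P t f) g - l2_inner M f (P t g) = 0"
  proof (rule bounded_functional_eq_0[OF g, where C = "2 * C * l2_norm M f"])
    fix g h assume gh: "g \<in> L2 M" "h \<in> L2 M"
    have "l2_inner M f (P t (\<lambda>x. g x - h x)) = l2_inner M f (\<lambda>x. P t g x - P t h x)"
      by (intro l2_inner_cong_AE P_diff L2_measurable P_L2 L2_diff t0 gh f) auto
    then show "l2_inner M (P t f) (\<lambda>x. g x - h x) - l2_inner M f (P t (\<lambda>x. g x - h x))
        = l2_inner M (P t f) g - l2_inner M f (P t g) - (l2_inner M (P t f) h - l2_inner M f (P t h))"
      using gh f Pf P_L2[OF t0] by (simp add: l2_inner_diff_right)
  next
    fix g assume g: "g \<in> L2 M"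
    have "\<bar>l2_inner M (P t f) g\<bar> \<le> C * l2_norm M f * l2_norm M g"
      using l2_cauchy_schwarz[OF Pf g] mult_right_mono[OF C(2)[OF f] l2_norm_nonneg[of M g]] by linarith
    moreover have "\<bar>l2_inner M f (P t g)\<bar> \<le> l2_norm M f * (C * l2_norm M g)"
      using l2_cauchy_schwarz[OF f P_L2[OF t0 g]] mult_left_mono[OF C(2)[OF g] l2_norm_nonneg[of M f]] by linarith
    ultimately show "\<bar>l2_inner M (P t f) g - l2_inner M f (P t g)\<bar> \<le> 2 * C * l2_norm M f * l2_norm M g"
      by (simp add: mult_ac)
  next
    fix J and c :: "nat \<Rightarrow> real" assume J: "finite J" "J \<subseteq> I"
    then have JI: "\<And>k. k \<in> J \<Longrightarrow> k \<in> I" by auto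
    have "l2_inner M f (P t (\<lambda>x. \<Sum>k\<in>J. c k * \<phi> k x)) = l2_inner M f (\<lambda>x. \<Sum>k\<in>J. c k * P t (\<phi> k) x)"
      by (intro l2_inner_cong_AE L2_measurable P_L2 L2_sum L2_scale phi_L2 JI t0 f P_sum J) auto
    also have "\<dots> = l2_inner M (P t f) (\<lambda>x. \<Sum>k\<in>J. c k * \<phi> k x)"
      using JI f Pf t0 inner_P_phi[OF t f]
      by (simp add: l2_inner_sum_right L2_scale P_L2 phi_L2 l2_inner_scale_right)
    finally show "l2_inner M (P t f) (\<lambda>x. \<Sum>k\<in>J. c k * \<phi> k x)
        - l2_inner M f (P t (\<lambda>x. \<Sum>k\<in>J. c k * \<phi> k x)) = 0" by simp
  qed
  then show ?thesis by simp
qed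

end

section \<open>The carr\'e du champ\<close>

context sigma_finite_measure begin

text \<open>An \<open>L2\<close> function need not be integrable on a space of infinite measure,
  while its integrals over sets of finite measure are inner products with indicators. Continuity
  from below of the measure with density \<open>h\<close>, along an exhaustion by such sets, passes
  a uniform bound to the whole space.\<close>

lemma integrable_if_bounded_on_finite_sets:
  fixes h :: "'a \<Rightarrow> real"
  assumes h: "h \<in> borel_measurable M" "AE x in M. 0 \<le> h x" and c: "0 \<le> c"
    and int: "\<And>B. B \<in> sets M \<Longrightarrow> emeasure M B < \<infinity> \<Longrightarrow> integrable M (\<lambda>x. h x * indicator B x)"
    and le: "\<And>B. B \<in> sets M \<Longrightarrow> emeasure M B < \<infinity> \<Longrightarrow> (\<integral>x. h x * indicator B x \<partial>M) \<le> c"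
  shows "integrable M h" "(\<integral>x. h x \<partial>M) \<le> c"
proof -
  obtain A :: "nat \<Rightarrow> 'a set" where A: "range A \<subseteq> sets M" "(\<Union>i. A i) = space M"
    "\<And>i. emeasure M (A i) \<noteq> \<infinity>" "incseq A"
    using sigma_finite_incseq by blast
  let ?D = "density M (\<lambda>x. ennreal (h x))"
  have "emeasure ?D (A i) \<le> ennreal c" for i
  proof -
    have Ai: "A i \<in> sets M" "emeasure M (A i) < \<infinity>"
      using A by (auto simp: less_top)
    have "emeasure ?D (A i) = (\<integral>\<^sup>+x. ennreal (h x * indicator (A i) x) \<partial>M)"
      using h Ai by (subst emeasure_density) (auto intro!: nn_integral_cong simp: indicator_def)
    also have "\<dots> = ennreal (\<integral>x. h x * indicator (A i) x \<partial>M)"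
      using h(2) by (intro nn_integral_eq_integral int Ai) (auto elim!: eventually_mono)
    also have "\<dots> \<le> ennreal c"
      by (intro ennreal_leI le Ai)
    finally show ?thesis .
  qed
  then have "(SUP i. emeasure ?D (A i)) \<le> ennreal c"
    by (rule SUP_least)
  also have "(SUP i. emeasure ?D (A i)) = emeasure ?D (space M)"
    using A(2) by (subst SUP_emeasure_incseq) (use A in auto)
  also have "\<dots> = (\<integral>\<^sup>+x. ennreal (h x) \<partial>M)"
    using h by (subst emeasure_density) (auto intro!: nn_integral_cong)
  finally have *: "(\<integral>\<^sup>+x. ennreal (h x) \<partial>M) \<le> ennreal c" .
  then show "integrable M h"
    using h by (intro integrableI_nonneg) (auto simp: le_less_trans[OF _ ennreal_less_top])
  show "(\<integral>x. h x \<partial>M) \<le> c"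
    using h * c by (subst integral_eq_nn_integral) (auto intro: enn2real_leI)
qed

end

locale markov_core = markov_eigenbasis M D L P N \<phi> lam
  for M :: "'a measure" and D L P N \<phi> lam +
  fixes \<A> :: "('a \<Rightarrow> real) set"
  assumes core: "algebraic_core M D L \<A>"
    and phi_core: "\<forall>k\<in>eigen_indices N. \<phi> k \<in> \<A>"
begin

abbreviation \<Gamma> where "\<Gamma> \<equiv> carre_du_champ L"

lemma A_D: "f \<in> \<A> \<Longrightarrow> f \<in> D"
  using core by (auto simp: algebraic_core_def)

lemma A_L2: "f \<in> \<A> \<Longrightarrow> f \<in> L2 M"
  by (intro D_L2 A_D)

lemma LA_L2: "f \<in> \<A> \<Longrightarrow> L f \<in> L2 M"
  by (intro L_L2 A_D)

lemma A_mult: "f \<in> \<A> \<Longrightarrow> g \<in> \<A> \<Longrightarrow> (\<lambda>x. f x * g x) \<in> \<A>"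
  using core by (simp add: algebraic_core_def)

lemma A_add: "f \<in> \<A> \<Longrightarrow> g \<in> \<A> \<Longrightarrow> (\<lambda>x. f x + g x) \<in> \<A>"
  using core by (simp add: algebraic_core_def l2_subspace_def)

lemma A_scale: "f \<in> \<A> \<Longrightarrow> (\<lambda>x. c * f x) \<in> \<A>"
  using core by (simp add: algebraic_core_def l2_subspace_def)

lemma A_zero: "(\<lambda>x. 0) \<in> \<A>"
  using core by (simp add: algebraic_core_def l2_subspace_def)

lemma A_sum: "(\<And>i. i \<in> J \<Longrightarrow> f i \<in> \<A>) \<Longrightarrow> (\<lambda>x. \<Sum>i\<in>J. f i x) \<in> \<A>"
  by (induction J rule: infinite_finite_induct) (auto intro: A_zero A_add)

lemma phi_A: "k \<in> I \<Longrightarrow> \<phi> k \<in> \<A>"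
  using phi_core by simp

lemma A_bounded:
  assumes "f \<in> \<A>"
  obtains C where "0 \<le> C" "AE x in M. \<bar>f x\<bar> \<le> C"
proof -
  have "linf_norm M f < \<infinity>"
    using core assms by (simp add: algebraic_core_def)
  then have "AE x in M. \<bar>f x\<bar> \<le> enn2real (linf_norm M f)"
    using A_L2[OF assms] by (intro linf_norm_AE_le L2_measurable)
  then show ?thesis by (intro that) auto
qed

lemma A_mult_L2:
  assumes "f \<in> \<A>" "g \<in> L2 M"
  shows "(\<lambda>x. f x * g x) \<in> L2 M"
  using A_bounded[OF assms(1)] L2_bounded_mult[OF L2_measurable[OF A_L2[OF assms(1)]] _ assms(2)] by metis

section \<open>Order properties of the semigroup\<close>

lemma P_unit_interval:
  "0 \<le> t \<Longrightarrow> f \<in> L2 M \<Longrightarrow> AE x in M. 0 \<le> f x \<and> f x \<le> 1 \<Longrightarrow> AE x in M. 0 \<le> P t f x \<and> P t f x \<le> 1"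
  using sub_markovian_P by (simp add: sub_markovian_def)

text \<open>\<open>sub_markovian\<close> only speaks about values in the unit interval, so
  \<open>g\<close> is rescaled; taking the maximum with 1 keeps the divisor positive for any
  \<open>C\<close>.\<close>

lemma P_nonneg:
  assumes t: "0 \<le> t" and g: "g \<in> L2 M" "AE x in M. 0 \<le> g x" "AE x in M. g x \<le> C"
  shows "AE x in M. 0 \<le> P t g x"
proof -
  define c where "c = max C 1"
  have c: "0 < c" "C \<le> c" by (auto simp: c_def)
  have "AE x in M. 0 \<le> (1 / c) * g x \<and> (1 / c) * g x \<le> 1"
    using g(2,3) by eventually_elim (use c in \<open>auto simp: divide_le_eq\<close>)
  then have "AE x in M. 0 \<le> P t (\<lambda>x. (1 / c) * g x) x \<and> P t (\<lambda>x. (1 / c) * g x) x \<le> 1"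
    by (rule P_unit_interval[OF t L2_scale[OF g(1)]])
  with P_scale[OF t g(1), of "1 / c"] show ?thesis
    
  proof eventually_elim
    case (elim x)
    then have "0 \<le> (1 / c) * P t g x" by simp
    then show ?case using c by (simp add: zero_le_divide_iff)
  qed
qed

text \<open>Rescaling by \<open>c\<close> reduces to the unit interval, except for
  \<open>c = 0\<close>, where \<open>g\<close> vanishes almost everywhere and linearity gives the
  claim.\<close>

lemma P_le_scaled:
  assumes t: "0 \<le> t" and g: "g \<in> L2 M" "AE x in M. 0 \<le> g x" "AE x in M. g x \<le> c" and c: "0 \<le> c"
  shows "AE x in M. P t g x \<le> c"
proof (cases "c = 0")
  case True
  have "AE x in M. g x = 0 * g x" using g(2,3) by eventually_elim (simp add: True)
  from P_cong[OF t g(1) L2_scale[OF g(1)] this] P_scale[OF t g(1), of 0]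
  show ?thesis by eventually_elim (simp add: True)
next
  case False
  with c have c: "c > 0" by simp
  have "AE x in M. 0 \<le> (1 / c) * g x \<and> (1 / c) * g x \<le> 1"
    using g(2,3) by eventually_elim (use c in \<open>auto simp: divide_le_eq\<close>)
  then have "AE x in M. 0 \<le> P t (\<lambda>x. (1 / c) * g x) x \<and> P t (\<lambda>x. (1 / c) * g x) x \<le> 1"
    by (rule P_unit_interval[OF t L2_scale[OF g(1)]])
  with P_scale[OF t g(1), of "1 / c"] show ?thesis
  proof eventually_elim
    case (elim x)
    then have "(1 / c) * P t g x \<le> 1" by simp
    then show ?case using c by (simp add: divide_le_eq)
  qed
qed

text \<open>Signed \<open>g\<close> are compared with their positive part \<open>?p\<close>: the
  difference \<open>?p - g\<close> is nonnegative and bounded, so \<open>P t g\<close> stays below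
  \<open>P t ?p\<close>.\<close>

lemma P_le:
  assumes t: "0 \<le> t" and g: "g \<in> L2 M" "AE x in M. \<bar>g x\<bar> \<le> C" "AE x in M. g x \<le> c" and c: "0 \<le> c"
  shows "AE x in M. P t g x \<le> c"
proof -
  let ?p = "\<lambda>x. max (g x) 0"
  have p: "?p \<in> L2 M"
    using g(1) by (intro L2_mono[OF g(1)]) auto
  have "AE x in M. P t ?p x \<le> c"
    using g(3) c by (intro P_le_scaled t p) auto
  moreover have "AE x in M. 0 \<le> P t (\<lambda>x. ?p x - g x) x"
  proof (rule P_nonneg[OF t])
    show "AE x in M. ?p x - g x \<le> 2 * C" using g(2) by eventually_elim auto
  qed (use g p in \<open>auto intro: L2_diff\<close>)
  ultimately show ?thesis
    using P_diff[OF t p g(1)] by eventually_elim simp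
qed

text \<open>Jensen's inequality without constants: \<open>2 * q * u - u * u\<close> lies in
  \<open>L2 M\<close> and is bounded above by the number \<open>q\<^sup>2\<close>, a bound that
  \<open>P t\<close> preserves. Optimising over rational \<open>q\<close> at almost every point
  gives the square.\<close>

lemma P_square_le:
  assumes t: "0 \<le> t" and u: "u \<in> \<A>"
  shows "AE x in M. (P t u x)\<^sup>2 \<le> P t (\<lambda>x. u x * u x) x"
proof -
  note uL = A_L2[OF u] note uu = A_L2[OF A_mult[OF u u]]
  obtain C where C: "0 \<le> C" "AE x in M. \<bar>u x\<bar> \<le> C" using A_bounded[OF u] .
  have "AE x in M. 2 * q * P t u x - P t (\<lambda>x. u x * u x) x \<le> q\<^sup>2" for q
  proof -
    let ?g = "\<lambda>x. 2 * q * u x - u x * u x"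
    have "AE x in M. P t ?g x \<le> q\<^sup>2"
    proof (rule P_le[OF t])
      show "?g \<in> L2 M" using uL uu by (intro L2_diff L2_scale)
      show "AE x in M. \<bar>?g x\<bar> \<le> 2 * \<bar>q\<bar> * C + C * C"
        using C(2)
      proof eventually_elim
        case (elim x)
        have "\<bar>?g x\<bar> \<le> 2 * \<bar>q\<bar> * \<bar>u x\<bar> + \<bar>u x\<bar> * \<bar>u x\<bar>"
          by (rule order_trans[OF abs_triangle_ineq4]) (simp add: abs_mult)
        also have "\<dots> \<le> 2 * \<bar>q\<bar> * C + C * C"
          using elim C(1) by (intro add_mono mult_mono) auto
        finally show ?case .
      qed
      have "2 * q * a - a * a \<le> q\<^sup>2" for a :: real
        using zero_le_power2[of "q - a"] by (simp add: power2_eq_square algebra_simps)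
      then show "AE x in M. ?g x \<le> q\<^sup>2" by simp
    qed simp
    with P_diff[OF t L2_scale[OF uL, of "2 * q"] uu] P_scale[OF t uL, of "2 * q"]
    show ?thesis by eventually_elim simp
  qed
  then have "AE x in M. \<forall>q\<in>\<rat>. 2 * q * P t u x - P t (\<lambda>x. u x * u x) x \<le> q\<^sup>2"
    by (subst AE_ball_countable) (auto simp: countable_rat)
  then show ?thesis
  proof eventually_elim
    case (elim x)
    have "(- P t u x)\<^sup>2 \<le> P t (\<lambda>x. u x * u x) x * 1"
    proof (rule quadratic_discriminant_rat)
      fix q :: real assume "q \<in> \<rat>"
      then have "2 * q * P t u x - P t (\<lambda>x. u x * u x) x \<le> q\<^sup>2" using elim by blast
      then show "0 \<le> P t (\<lambda>x. u x * u x) x + 2 * q * - P t u x + q\<^sup>2 * 1" by simp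
    qed simp
    then show ?case by simp
  qed
qed

section \<open>Approximation of the carre du champ by the semigroup\<close>

lemma Gamma_L2:
  assumes "f \<in> \<A>" "g \<in> \<A>"
  shows "\<Gamma> f g \<in> L2 M"
  unfolding carre_du_champ_def
  by (intro L2_intros A_mult_L2 assms LA_L2 A_mult)

text \<open>This is the carre du champ of the bounded operator (1 - P t) / t, which tends to
  \<open>L\<close> on \<open>D\<close> as t decreases to 0.\<close>

definition Gamma_approx :: "('a \<Rightarrow> real) \<Rightarrow> real \<Rightarrow> 'a \<Rightarrow> real" where
  "Gamma_approx u t = (\<lambda>x. (P t (\<lambda>y. u y * u y) x - 2 * (u x * P t u x) + u x * u x) / (2 * t))"

lemma Gamma_approx_L2:
  assumes "u \<in> \<A>" "0 \<le> t"
  shows "Gamma_approx u t \<in> L2 M"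
  unfolding Gamma_approx_def
  by (intro L2_intros A_mult_L2 P_L2 A_L2 A_mult assms)

lemma Gamma_approx_nonneg:
  assumes "u \<in> \<A>" "0 < t"
  shows "AE x in M. 0 \<le> Gamma_approx u t x"
  using P_square_le[OF less_imp_le[OF assms(2)] assms(1)]
proof eventually_elim
  case (elim x)
  have "0 \<le> (P t u x - u x)\<^sup>2" by simp
  also have "\<dots> = (P t u x)\<^sup>2 - 2 * (u x * P t u x) + u x * u x"
    by (simp add: power2_eq_square algebra_simps)
  also have "\<dots> \<le> P t (\<lambda>y. u y * u y) x - 2 * (u x * P t u x) + u x * u x"
    using elim by simp
  finally show ?case using assms(2) by (simp add: Gamma_approx_def)
qed

text \<open>The difference is half the generator error at the square of \<open>u\<close> minus
  \<open>u\<close> times the generator error at \<open>u\<close>. Both squares and bounds are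
  available because \<open>u\<close> lies in the core: its square is in \<open>D\<close>, and
  multiplication by \<open>u\<close> is bounded on \<open>L2 M\<close>.\<close>

lemma Gamma_approx_tendsto:
  assumes u: "u \<in> \<A>"
  shows "((\<lambda>t. l2_norm M (\<lambda>x. Gamma_approx u t x - \<Gamma> u u x)) \<longlongrightarrow> 0) (at_right 0)"
proof -
  note uu = A_mult[OF u u]
  obtain C where C: "0 \<le> C" "AE x in M. \<bar>u x\<bar> \<le> C" using A_bounded[OF u] .
  let ?a = "\<lambda>t x. (P t (\<lambda>y. u y * u y) x - u x * u x) / t + L (\<lambda>y. u y * u y) x"
  let ?b = "\<lambda>t x. (P t u x - u x) / t + L u x"
  have "((\<lambda>t. 1 / 2 * l2_norm M (?a t) + C * l2_norm M (?b t)) \<longlongrightarrow> 1 / 2 * 0 + C * 0) (at_right 0)"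
    by (intro tendsto_intros generator_tendsto[OF A_D[OF uu]] generator_tendsto[OF A_D[OF u]])
  then have lim: "((\<lambda>t. 1 / 2 * l2_norm M (?a t) + C * l2_norm M (?b t)) \<longlongrightarrow> 0) (at_right 0)" by simp
  have "\<forall>\<^sub>F t in at_right 0. norm (l2_norm M (\<lambda>x. Gamma_approx u t x - \<Gamma> u u x))
      \<le> 1 / 2 * l2_norm M (?a t) + C * l2_norm M (?b t)"
    using eventually_at_right_less[of 0]
  proof eventually_elim
    case (elim t)
    have a: "?a t \<in> L2 M" and b: "?b t \<in> L2 M"
      using elim by (intro L2_intros P_L2 A_L2 LA_L2 u uu; simp)+
    have "(\<lambda>x. Gamma_approx u t x - \<Gamma> u u x) = (\<lambda>x. 1 / 2 * ?a t x - u x * ?b t x)"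
      using elim by (auto simp: Gamma_approx_def carre_du_champ_def field_simps)
    then have "l2_norm M (\<lambda>x. Gamma_approx u t x - \<Gamma> u u x)
        \<le> l2_norm M (\<lambda>x. 1 / 2 * ?a t x) + l2_norm M (\<lambda>x. - (u x * ?b t x))"
      using l2_norm_triangle[OF L2_scale[OF a, of "1 / 2"] L2_minus[OF A_mult_L2[OF u b]]] by simp
    also have "\<dots> \<le> 1 / 2 * l2_norm M (?a t) + C * l2_norm M (?b t)"
      unfolding l2_norm_minus l2_norm_scale
      using l2_norm_bounded_mult[OF L2_measurable[OF A_L2[OF u]] C(2,1) b] by simp
    finally show ?case by (simp add: l2_norm_nonneg)
  qed
  then show ?thesis by (rule Lim_null_comparison) (rule lim)
qed

lemma eventually_Gamma_approx_L2:
  assumes "u \<in> \<A>"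
  shows "\<forall>\<^sub>F t in at_right 0. Gamma_approx u t \<in> L2 M"
  using eventually_at_right_less[of 0] by eventually_elim (simp add: Gamma_approx_L2 assms)

lemma Gamma_nonneg:
  assumes u: "u \<in> \<A>"
  shows "AE x in M. 0 \<le> \<Gamma> u u x"
proof (rule l2_limit_nonneg[OF eventually_Gamma_approx_L2[OF u] Gamma_L2[OF u u] Gamma_approx_tendsto[OF u]])
  show "\<forall>\<^sub>F t in at_right 0. AE x in M. 0 \<le> Gamma_approx u t x"
    using eventually_at_right_less[of 0] by eventually_elim (rule Gamma_approx_nonneg[OF u])
qed simp

text \<open>Formally the integral of \<open>P t h\<close> is that of \<open>h * P t 1\<close>. Since
  1 need not be in \<open>L2 M\<close>, symmetry is used against the indicator of each set of finite
  measure, whose image is at most 1, and the bound is then extended to the whole space.\<close>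

lemma P_integral_le:
  assumes t: "0 < t" and h: "h \<in> L2 M" "integrable M h" "AE x in M. 0 \<le> h x" "AE x in M. h x \<le> C"
  shows "integrable M (P t h)" "(\<integral>x. P t h x \<partial>M) \<le> (\<integral>x. h x \<partial>M)"
proof -
  have t0: "0 \<le> t" using t by simp
  have le: "(\<integral>x. P t h x * indicator B x \<partial>M) \<le> (\<integral>x. h x \<partial>M)"
    if B: "B \<in> sets M" "emeasure M B < \<infinity>" for B
  proof -
    have ind: "(indicator B :: 'a \<Rightarrow> real) \<in> L2 M" by (rule L2_indicator[OF B])
    have "(\<integral>x. P t h x * indicator B x \<partial>M) = (\<integral>x. h x * P t (indicator B) x \<partial>M)"
      using P_symmetric[OF t h(1) ind] by (simp add: l2_inner_def)
    also have "\<dots> \<le> (\<integral>x. h x \<partial>M)"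
    proof (rule integral_mono_AE)
      have "AE x in M. P t (indicator B) x \<le> 1"
        by (rule P_le_scaled[OF t0 ind]) (auto simp: indicator_def)
      then show "AE x in M. h x * P t (indicator B) x \<le> h x"
        using h(3) by eventually_elim (rule mult_left_le)
    qed (use h ind t0 in \<open>auto intro: L2_integrable_mult P_L2\<close>)
    finally show ?thesis .
  qed
  have "0 \<le> (\<integral>x. h x \<partial>M)" using h(3) by (rule integral_nonneg_AE)
  moreover have "integrable M (\<lambda>x. P t h x * indicator B x)"
    if "B \<in> sets M" "emeasure M B < \<infinity>" for B
    by (intro L2_integrable_mult P_L2 t0 h L2_indicator that)
  ultimately show "integrable M (P t h)" "(\<integral>x. P t h x \<partial>M) \<le> (\<integral>x. h x \<partial>M)"
    using integrable_if_bounded_on_finite_sets[of "P t h" "\<integral>x. h x \<partial>M"]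
      P_nonneg[OF t0 h(1,3,4)] le L2_measurable[OF P_L2[OF t0 h(1)]] by blast+
qed

text \<open>Contraction of integrals replaces \<open>P t\<close> of the square of \<open>u\<close>
  by the square itself; what remains is the difference quotient of \<open>P t u\<close> paired with
  \<open>u\<close>.\<close>

lemma Gamma_approx_integral_le:
  assumes t: "0 < t" and u: "u \<in> \<A>"
  shows "integrable M (Gamma_approx u t)"
    "(\<integral>x. Gamma_approx u t x \<partial>M) \<le> - l2_inner M (\<lambda>x. (P t u x - u x) / t) u"
proof -
  note uL = A_L2[OF u] note uu = A_L2[OF A_mult[OF u u]]
  have Pu: "P t u \<in> L2 M" using t by (intro P_L2 uL) simp
  have iuu: "integrable M (\<lambda>x. u x * u x)" by (rule L2_integrable_mult[OF uL uL])
  have iuP: "integrable M (\<lambda>x. u x * P t u x)" by (rule L2_integrable_mult[OF uL Pu])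
  obtain C where C: "0 \<le> C" "AE x in M. \<bar>u x\<bar> \<le> C" using A_bounded[OF u] .
  have "AE x in M. u x * u x \<le> C * C"
    using C(2)
  proof eventually_elim
    case (elim x)
    have "u x * u x = \<bar>u x\<bar> * \<bar>u x\<bar>" by simp
    also have "\<dots> \<le> C * C" using elim C(1) by (intro mult_mono) auto
    finally show ?case .
  qed
  then have P2: "integrable M (P t (\<lambda>x. u x * u x))"
    "(\<integral>x. P t (\<lambda>x. u x * u x) x \<partial>M) \<le> (\<integral>x. u x * u x \<partial>M)"
    by (intro P_integral_le[OF t uu iuu]; simp)+
  show "integrable M (Gamma_approx u t)"
    unfolding Gamma_approx_def using P2(1) iuu iuP by auto
  have "(\<integral>x. Gamma_approx u t x \<partial>M)
      = ((\<integral>x. P t (\<lambda>x. u x * u x) x \<partial>M) - 2 * (\<integral>x. u x * P t u x \<partial>M) + (\<integral>x. u x * u x \<partial>M)) / (2 * t)"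
    unfolding Gamma_approx_def using P2(1) iuu iuP by simp
  also have "\<dots> \<le> (2 * (\<integral>x. u x * u x \<partial>M) - 2 * (\<integral>x. u x * P t u x \<partial>M)) / (2 * t)"
    using P2(2) t by (intro divide_right_mono) auto
  also have "\<dots> = - (((\<integral>x. u x * P t u x \<partial>M) - (\<integral>x. u x * u x \<partial>M)) / t)"
    using t by (simp add: field_simps)
  also have "(\<integral>x. u x * P t u x \<partial>M) - (\<integral>x. u x * u x \<partial>M) = (\<integral>x. (P t u x - u x) * u x \<partial>M)"
    using iuP iuu by (subst Bochner_Integration.integral_diff[symmetric]) (auto simp: algebra_simps)
  also have "\<dots> / t = l2_inner M (\<lambda>x. (P t u x - u x) / t) u"
    by (simp add: l2_inner_def)
  finally show "(\<integral>x. Gamma_approx u t x \<partial>M) \<le> - l2_inner M (\<lambda>x. (P t u x - u x) / t) u" .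
qed

text \<open>Convergence of \<open>Gamma_approx\<close> in \<open>L2\<close> does not control
  integrals over a space of infinite measure. The limit is therefore taken on sets of finite
  measure, with a bound independent of the set, before exhausting the space.\<close>

lemma Gamma_integral_le:
  assumes u: "u \<in> \<A>"
  shows "integrable M (\<Gamma> u u)" "(\<integral>x. \<Gamma> u u x \<partial>M) \<le> l2_inner M u (L u)"
proof -
  note uL = A_L2[OF u] note Lu = LA_L2[OF u]
  have "((\<lambda>t. l2_inner M (\<lambda>x. (P t u x - u x) / t) u) \<longlongrightarrow> l2_inner M (\<lambda>x. - L u x) u) (at_right 0)"
  proof (rule l2_inner_tendsto)
    show "\<forall>\<^sub>F t in at_right 0. (\<lambda>x. (P t u x - u x) / t) \<in> L2 M"
      using eventually_at_right_less[of 0]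
      by eventually_elim (auto intro!: L2_intros P_L2 uL)
    show "((\<lambda>t. l2_norm M (\<lambda>x. (P t u x - u x) / t - - L u x)) \<longlongrightarrow> 0) (at_right 0)"
      using generator_tendsto[OF A_D[OF u]] by simp
  qed (auto intro: L2_minus Lu uL)
  from tendsto_minus[OF this]
  have lim: "((\<lambda>t. - l2_inner M (\<lambda>x. (P t u x - u x) / t) u) \<longlongrightarrow> l2_inner M u (L u)) (at_right 0)"
    by (simp add: l2_inner_def mult.commute)
  have le: "(\<integral>x. \<Gamma> u u x * indicator B x \<partial>M) \<le> l2_inner M u (L u)"
    if B: "B \<in> sets M" "emeasure M B < \<infinity>" for B
  proof (rule tendsto_le[OF _ lim])
    have ind: "(indicator B :: 'a \<Rightarrow> real) \<in> L2 M" by (rule L2_indicator[OF B])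
    show "((\<lambda>t. \<integral>x. Gamma_approx u t x * indicator B x \<partial>M) \<longlongrightarrow> (\<integral>x. \<Gamma> u u x * indicator B x \<partial>M)) (at_right 0)"
      using l2_inner_tendsto[OF eventually_Gamma_approx_L2[OF u] Gamma_L2[OF u u] ind Gamma_approx_tendsto[OF u]]
      by (simp add: l2_inner_def)
    show "\<forall>\<^sub>F t in at_right 0. (\<integral>x. Gamma_approx u t x * indicator B x \<partial>M)
        \<le> - l2_inner M (\<lambda>x. (P t u x - u x) / t) u"
      using eventually_at_right_less[of 0]
    proof eventually_elim
      case (elim t)
      have "(\<integral>x. Gamma_approx u t x * indicator B x \<partial>M) \<le> (\<integral>x. Gamma_approx u t x \<partial>M)"
      proof (rule integral_mono_AE)
        show "AE x in M. Gamma_approx u t x * indicator B x \<le> Gamma_approx u t x"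
          using Gamma_approx_nonneg[OF u elim] by eventually_elim (auto simp: indicator_def)
      qed (use elim u ind in \<open>auto intro: L2_integrable_mult Gamma_approx_L2 less_imp_le Gamma_approx_integral_le\<close>)
      with Gamma_approx_integral_le(2)[OF elim u] show ?case by simp
    qed
  qed simp
  have "0 \<le> l2_inner M u (L u)"
    using nonneg_self_adjoint_L A_D[OF u] by (simp add: nonneg_self_adjoint_def)
  moreover have "integrable M (\<lambda>x. \<Gamma> u u x * indicator B x)"
    if "B \<in> sets M" "emeasure M B < \<infinity>" for B
    by (intro L2_integrable_mult Gamma_L2 u L2_indicator that)
  ultimately show "integrable M (\<Gamma> u u)" "(\<integral>x. \<Gamma> u u x \<partial>M) \<le> l2_inner M u (L u)"
    using integrable_if_bounded_on_finite_sets[of "\<Gamma> u u" "l2_inner M u (L u)"]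
      Gamma_nonneg[OF u] le L2_measurable[OF Gamma_L2[OF u u]] by blast+
qed

section \<open>Cauchy-Schwarz for \<Gamma> and the commutator estimate\<close>

lemma Gamma_add_scaled:
  assumes f: "f \<in> \<A>" and v: "v \<in> \<A>"
  shows "AE x in M. \<Gamma> (\<lambda>y. f y + q * v y) (\<lambda>y. f y + q * v y) x
    = \<Gamma> f f x + 2 * q * \<Gamma> f v x + q\<^sup>2 * \<Gamma> v v x"
proof -
  note ff = A_mult[OF f f] note fv = A_mult[OF f v] note vv = A_mult[OF v v]
  have sq: "(\<lambda>y. (f y + q * v y) * (f y + q * v y))
      = (\<lambda>y. f y * f y + (2 * q * (f y * v y) + q\<^sup>2 * (v y * v y)))"
    by (auto simp: power2_eq_square algebra_simps)
  have "AE x in M. L (\<lambda>y. f y * f y + (2 * q * (f y * v y) + q\<^sup>2 * (v y * v y))) x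
      = L (\<lambda>y. f y * f y) x + L (\<lambda>y. 2 * q * (f y * v y) + q\<^sup>2 * (v y * v y)) x"
    by (intro L_add A_D A_add A_scale ff fv vv)
  moreover have "AE x in M. L (\<lambda>y. 2 * q * (f y * v y) + q\<^sup>2 * (v y * v y)) x
      = L (\<lambda>y. 2 * q * (f y * v y)) x + L (\<lambda>y. q\<^sup>2 * (v y * v y)) x"
    by (intro L_add A_D A_scale fv vv)
  moreover have "AE x in M. L (\<lambda>y. 2 * q * (f y * v y)) x = 2 * q * L (\<lambda>y. f y * v y) x"
    by (intro L_scale A_D fv)
  moreover have "AE x in M. L (\<lambda>y. q\<^sup>2 * (v y * v y)) x = q\<^sup>2 * L (\<lambda>y. v y * v y) x"
    by (intro L_scale A_D vv)
  moreover have "AE x in M. L (\<lambda>y. f y + q * v y) x = L f x + L (\<lambda>y. q * v y) x"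
    by (intro L_add A_D A_scale f v)
  moreover have "AE x in M. L (\<lambda>y. q * v y) x = q * L v x"
    by (intro L_scale A_D v)
  ultimately show ?thesis
    unfolding carre_du_champ_def sq
  proof eventually_elim
    case (elim x)
    then show ?case by (simp only: elim) (simp add: power2_eq_square algebra_simps)
  qed
qed

lemma Gamma_cauchy_schwarz:
  assumes f: "f \<in> \<A>" and v: "v \<in> \<A>"
  shows "AE x in M. (\<Gamma> f v x)\<^sup>2 \<le> \<Gamma> f f x * \<Gamma> v v x"
proof -
  have "AE x in M. 0 \<le> \<Gamma> f f x + 2 * q * \<Gamma> f v x + q\<^sup>2 * \<Gamma> v v x" for q
    using Gamma_add_scaled[OF f v, of q] Gamma_nonneg[OF A_add[OF f A_scale[OF v, of q]]]
    by eventually_elim simp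
  then have "AE x in M. \<forall>q\<in>\<rat>. 0 \<le> \<Gamma> f f x + 2 * q * \<Gamma> f v x + q\<^sup>2 * \<Gamma> v v x"
    by (subst AE_ball_countable) (auto simp: countable_rat)
  then show ?thesis
    using Gamma_nonneg[OF v]
    by eventually_elim (rule quadratic_discriminant_rat, auto)
qed

text \<open>The pointwise Cauchy-Schwarz inequality places \<open>\<Gamma> f f\<close> in sup norm
  and leaves \<open>\<Gamma> v v\<close> to be integrated, which the energy of \<open>v\<close>
  bounds.\<close>

lemma l2_norm_Gamma_le:
  assumes f: "f \<in> \<A>" "AE x in M. \<Gamma> f f x \<le> G" "0 \<le> G" and v: "v \<in> \<A>"
  shows "l2_norm M (\<Gamma> f v) \<le> sqrt G * sqrt (l2_inner M v (L v))"
proof -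
  have "l2_inner M (\<Gamma> f v) (\<Gamma> f v) \<le> (\<integral>x. G * \<Gamma> v v x \<partial>M)"
    unfolding l2_inner_def
  proof (rule integral_mono_AE)
    show "AE x in M. \<Gamma> f v x * \<Gamma> f v x \<le> G * \<Gamma> v v x"
      using Gamma_cauchy_schwarz[OF f(1) v] Gamma_nonneg[OF v] f(2)
    proof eventually_elim
      case (elim x)
      have "\<Gamma> f v x * \<Gamma> f v x \<le> \<Gamma> f f x * \<Gamma> v v x" using elim by (simp add: power2_eq_square)
      also have "\<dots> \<le> G * \<Gamma> v v x" using elim by (intro mult_right_mono)
      finally show ?case .
    qed
  qed (use f v in \<open>auto intro: L2_integrable_mult Gamma_L2 Gamma_integral_le\<close>)
  also have "\<dots> \<le> G * l2_inner M v (L v)"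
    using Gamma_integral_le[OF v] f(3) by (simp add: mult_left_mono)
  finally show ?thesis
    unfolding l2_norm_def real_sqrt_mult[symmetric] by (rule real_sqrt_le_mono)
qed

text \<open>In the antisymmetrised expression the terms \<open>u * v * L f\<close> cancel, and
  symmetry of \<open>L\<close> moves it from the products \<open>f * v\<close> and
  \<open>f * u\<close> onto the other factor.\<close>

lemma commutator_eq_Gamma:
  assumes f: "f \<in> \<A>" and u: "u \<in> \<A>" and v: "v \<in> \<A>"
  shows "l2_inner M (\<lambda>x. f x * u x) (L v) - l2_inner M (\<lambda>x. f x * v x) (L u)
    = l2_inner M u (\<Gamma> f v) - l2_inner M v (\<Gamma> f u)"
proof -
  have *: "2 * l2_inner M u (\<Gamma> f v)
      = (\<integral>x. u x * f x * L v x \<partial>M) + (\<integral>x. u x * v x * L f x \<partial>M) - l2_inner M (L u) (\<lambda>x. f x * v x)"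
    if u: "u \<in> \<A>" and v: "v \<in> \<A>" for u v
  proof -
    have "integrable M (\<lambda>x. u x * f x * L v x)" "integrable M (\<lambda>x. u x * v x * L f x)"
      "integrable M (\<lambda>x. u x * L (\<lambda>y. f y * v y) x)"
      by (intro L2_integrable_mult A_L2 A_mult LA_L2 u v f)+
    moreover have "2 * (u x * \<Gamma> f v x) = u x * f x * L v x + u x * v x * L f x - u x * L (\<lambda>y. f y * v y) x" for x
      by (simp add: carre_du_champ_def algebra_simps)
    ultimately have "2 * l2_inner M u (\<Gamma> f v)
      = (\<integral>x. u x * f x * L v x \<partial>M) + (\<integral>x. u x * v x * L f x \<partial>M) - l2_inner M u (L (\<lambda>x. f x * v x))"
      unfolding l2_inner_def by (subst integral_mult_right_zero[symmetric]) simp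
    then show ?thesis
      using L_symmetric[OF A_D[OF u] A_D[OF A_mult[OF f v]]] by simp
  qed
  show ?thesis
    using *[OF u v] *[OF v u] by (simp add: l2_inner_def mult_ac)
qed

lemma commutator_bound:
  assumes f: "f \<in> \<A>" "AE x in M. \<Gamma> f f x \<le> G" "0 \<le> G" and u: "u \<in> \<A>" and v: "v \<in> \<A>"
  shows "l2_inner M (\<lambda>x. f x * u x) (L v) - l2_inner M (\<lambda>x. f x * v x) (L u)
    \<le> sqrt G * (l2_norm M u * sqrt (l2_inner M v (L v)) + l2_norm M v * sqrt (l2_inner M u (L u)))"
proof -
  have *: "\<bar>l2_inner M u (\<Gamma> f v)\<bar> \<le> l2_norm M u * (sqrt G * sqrt (l2_inner M v (L v)))"
    if u: "u \<in> \<A>" and v: "v \<in> \<A>" for u v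
    using l2_cauchy_schwarz[OF A_L2[OF u] Gamma_L2[OF f(1) v]]
      mult_left_mono[OF l2_norm_Gamma_le[OF f v] l2_norm_nonneg[of M u]] by linarith
  show ?thesis
    using *[OF u v] *[OF v u] unfolding commutator_eq_Gamma[OF f(1) u v]
    by (simp add: algebra_simps abs_le_iff)
qed

end

section \<open>Off-diagonal decay of the multiplication operator\<close>

text \<open>The function x / (x - l)^2 decreases for x > l, as the factored difference shows. It
  bounds the weights \<open>lam j / (lam j - lam k)\<^sup>2\<close> in the energy of the test vector
  by their value at the threshold \<open>r\<close>.\<close>

lemma gap_weight_le:
  fixes r l x :: real
  assumes "0 \<le> l" "l < r" "r \<le> x"
  shows "x / (x - l)\<^sup>2 \<le> r / (r - l)\<^sup>2"
proof -
  have "r * (x - l)\<^sup>2 - x * (r - l)\<^sup>2 = (x - r) * (x * r - l * l)"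
    by (simp add: power2_eq_square algebra_simps)
  moreover have "l * l \<le> x * r" using assms by (intro mult_mono) auto
  ultimately have "x * (r - l)\<^sup>2 \<le> r * (x - l)\<^sup>2"
    using assms by (smt (verit) mult_nonneg_nonneg)
  moreover have "0 < (x - l)\<^sup>2" "0 < (r - l)\<^sup>2" using assms by auto
  ultimately show ?thesis by (simp add: divide_le_eq pos_le_divide_eq mult.commute)
qed

context markov_core begin

lemma off_diagonal_bound:
  assumes f: "f \<in> \<A>" "AE x in M. \<Gamma> f f x \<le> G" "0 \<le> G"
    and k: "k \<in> I" and J: "finite J" "J \<subseteq> I" and gap: "lam k < r" "\<And>j. j \<in> J \<Longrightarrow> r \<le> lam j"
  shows "(\<Sum>j\<in>J. (l2_inner M (\<lambda>x. f x * \<phi> k x) (\<phi> j))\<^sup>2) * (sqrt r - sqrt (lam k))\<^sup>2 \<le> G"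
proof -
  define a where "a j = l2_inner M (\<lambda>x. f x * \<phi> k x) (\<phi> j)" for j
  \<comment> \<open>Dividing by the eigenvalue gap makes \<open>v\<close> solve (L - lam k) v =
    projection of \<open>f * \<phi> k\<close> onto the span of the \<open>\<phi> j\<close> with
    \<open>j\<close> in \<open>J\<close>; the commutator is then exactly \<open>S\<close>.\<close>
  define b where "b j = a j / (lam j - lam k)" for j
  define S where "S = (\<Sum>j\<in>J. (a j)\<^sup>2)"
  define v where "v = (\<lambda>x. \<Sum>j\<in>J. b j * \<phi> j x)"
  have JI: "j \<in> I" if "j \<in> J" for j using J that by auto
  have l0: "0 \<le> lam k" by (rule lam_nonneg[OF k])
  have lj: "lam k < lam j" if "j \<in> J" for j using gap(1) gap(2)[OF that] by simp
  have r0: "0 < r" using l0 gap(1) by simp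
  have vA: "v \<in> \<A>" unfolding v_def by (intro A_sum A_scale phi_A JI)
  have fk: "(\<lambda>x. f x * \<phi> k x) \<in> L2 M" by (intro A_L2 A_mult f phi_A k)
  have S0: "0 \<le> S" unfolding S_def by (intro sum_nonneg) auto

  have Lv: "AE x in M. L v x = (\<Sum>j\<in>J. b j * lam j * \<phi> j x)"
    unfolding v_def using J(1) JI
  proof (induction J)
    case empty
    show ?case using L_scale[OF A_D[OF A_zero], of 0] by simp
  next
    case (insert j J)
    have "AE x in M. L (\<lambda>y. b j * \<phi> j y + (\<Sum>j\<in>J. b j * \<phi> j y)) x
        = L (\<lambda>y. b j * \<phi> j y) x + L (\<lambda>y. \<Sum>j\<in>J. b j * \<phi> j y) x"
      using insert by (intro L_add A_D A_scale A_sum phi_A) auto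
    moreover have "AE x in M. L (\<lambda>y. b j * \<phi> j y) x = b j * L (\<phi> j) x"
      using insert by (intro L_scale phi_D) auto
    moreover have "AE x in M. L (\<phi> j) x = lam j * \<phi> j x"
      using insert by (intro L_phi) auto
    moreover have "AE x in M. L (\<lambda>y. \<Sum>j\<in>J. b j * \<phi> j y) x = (\<Sum>j\<in>J. b j * lam j * \<phi> j x)"
      using insert by auto
    ultimately show ?case
      unfolding sum.insert[OF insert.hyps] by eventually_elim (simp add: mult_ac)
  qed
  have w: "(\<lambda>x. \<Sum>j\<in>J. b j * lam j * \<phi> j x) \<in> L2 M"
    by (intro L2_sum L2_scale phi_L2 JI)
  have inner_Lv: "l2_inner M g (L v) = (\<Sum>j\<in>J. b j * lam j * l2_inner M g (\<phi> j))" if "g \<in> L2 M" for g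
  proof -
    have "l2_inner M g (L v) = l2_inner M g (\<lambda>x. \<Sum>j\<in>J. b j * lam j * \<phi> j x)"
      using Lv w that vA by (intro l2_inner_cong_AE L2_measurable LA_L2) auto
    also have "\<dots> = (\<Sum>j\<in>J. b j * lam j * l2_inner M g (\<phi> j))"
      using that by (subst l2_inner_sum_right) (auto intro: L2_scale phi_L2 JI simp: l2_inner_scale_right)
    finally show ?thesis .
  qed
  have v_phi: "l2_inner M v (\<phi> j) = b j" if "j \<in> J" for j
  proof -
    have "l2_inner M v (\<phi> j) = (\<Sum>i\<in>J. b i * l2_inner M (\<phi> i) (\<phi> j))"
      unfolding v_def using that
      by (subst l2_inner_sum_left) (auto intro: L2_scale phi_L2 JI simp: l2_inner_scale_left)
    also have "\<dots> = (\<Sum>i\<in>J. if i = j then b i else 0)"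
      using that by (intro sum.cong) (auto simp: phi_inner JI)
    finally show ?thesis using that J(1) by simp
  qed
  have vLv: "l2_inner M v (L v) = (\<Sum>j\<in>J. (b j)\<^sup>2 * lam j)"
    unfolding inner_Lv[OF A_L2[OF vA]] using v_phi
    by (intro sum.cong) (auto simp: power2_eq_square)
  have vv: "(l2_norm M v)\<^sup>2 = (\<Sum>j\<in>J. (b j)\<^sup>2)"
  proof -
    have "l2_inner M v v = (\<Sum>j\<in>J. b j * l2_inner M v (\<phi> j))"
      by (subst (2) v_def, subst l2_inner_sum_right)
        (auto intro: L2_scale phi_L2 JI A_L2 vA simp: l2_inner_scale_right)
    then show ?thesis using v_phi by (simp only: l2_norm_power2) (simp add: power2_eq_square)
  qed
  have uLu: "l2_inner M (\<phi> k) (L (\<phi> k)) = lam k"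
  proof -
    have "l2_inner M (\<phi> k) (L (\<phi> k)) = l2_inner M (\<phi> k) (\<lambda>x. lam k * \<phi> k x)"
      using L_phi[OF k] by (intro l2_inner_cong_AE L2_measurable phi_L2 k L2_scale L_L2 phi_D) auto
    then show ?thesis by (simp add: l2_inner_scale_right phi_inner k)
  qed
  have fvLu: "l2_inner M (\<lambda>x. f x * v x) (L (\<phi> k)) = (\<Sum>j\<in>J. b j * lam k * a j)"
  proof -
    have "l2_inner M (\<lambda>x. f x * v x) (L (\<phi> k)) = l2_inner M (\<lambda>x. f x * v x) (\<lambda>x. lam k * \<phi> k x)"
      using L_phi[OF k] by (intro l2_inner_cong_AE L2_measurable phi_L2 k L2_scale L_L2 phi_D A_L2 A_mult f vA) auto
    also have "\<dots> = lam k * l2_inner M (\<lambda>x. f x * \<phi> k x) v"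
      unfolding l2_inner_scale_right by (simp add: l2_inner_def mult_ac)
    also have "l2_inner M (\<lambda>x. f x * \<phi> k x) v = (\<Sum>j\<in>J. b j * a j)"
      unfolding v_def a_def
      by (subst l2_inner_sum_right) (auto intro: L2_scale phi_L2 JI fk simp: l2_inner_scale_right)
    finally show ?thesis by (simp add: sum_distrib_left mult_ac)
  qed

  have "S = (\<Sum>j\<in>J. b j * lam j * a j) - (\<Sum>j\<in>J. b j * lam k * a j)"
    unfolding sum_subtractf[symmetric] S_def
  proof (rule sum.cong)
    fix j assume "j \<in> J"
    then have "lam j - lam k \<noteq> 0" using lj[of j] by simp
    then have "b j * (lam j - lam k) = a j" by (simp add: b_def)
    then show "(a j)\<^sup>2 = b j * lam j * a j - b j * lam k * a j"
      by (simp add: power2_eq_square algebra_simps)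
  qed simp
  also have "\<dots> = l2_inner M (\<lambda>x. f x * \<phi> k x) (L v) - l2_inner M (\<lambda>x. f x * v x) (L (\<phi> k))"
    unfolding fvLu inner_Lv[OF fk] a_def ..
  also have "\<dots> \<le> sqrt G * (l2_norm M (\<phi> k) * sqrt (l2_inner M v (L v))
      + l2_norm M v * sqrt (l2_inner M (\<phi> k) (L (\<phi> k))))"
    by (rule commutator_bound[OF f phi_A[OF k] vA])
  finally have S_le: "S \<le> sqrt G * (sqrt (l2_inner M v (L v)) + l2_norm M v * sqrt (lam k))"
    by (simp add: l2_norm_phi[OF k] uLu)

  \<comment> \<open>Both the energy and the norm of \<open>v\<close> are now bounded by
    \<open>S\<close>, using that the gaps over \<open>J\<close> are at least
    \<open>?d\<close>.\<close>
  let ?d = "r - lam k"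
  have d0: "0 < ?d" using gap by simp
  have "l2_inner M v (L v) \<le> (\<Sum>j\<in>J. (a j)\<^sup>2 * (r / ?d\<^sup>2))"
    unfolding vLv
  proof (rule sum_mono)
    fix j assume j: "j \<in> J"
    have "(b j)\<^sup>2 * lam j = (a j)\<^sup>2 * (lam j / (lam j - lam k)\<^sup>2)"
      by (simp add: b_def power_divide)
    also have "\<dots> \<le> (a j)\<^sup>2 * (r / ?d\<^sup>2)"
      by (intro mult_left_mono gap_weight_le l0 gap j) auto
    finally show "(b j)\<^sup>2 * lam j \<le> (a j)\<^sup>2 * (r / ?d\<^sup>2)" .
  qed
  then have "l2_inner M v (L v) \<le> S * (r / ?d\<^sup>2)"
    by (simp only: S_def sum_distrib_right)
  then have "sqrt (l2_inner M v (L v)) \<le> sqrt (S * (r / ?d\<^sup>2))" by (rule real_sqrt_le_mono)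
  also have "\<dots> = sqrt S * sqrt r / ?d"
    using d0 by (simp add: real_sqrt_mult real_sqrt_divide)
  finally have b1: "sqrt (l2_inner M v (L v)) \<le> sqrt S * sqrt r / ?d" .

  have "(l2_norm M v)\<^sup>2 \<le> (\<Sum>j\<in>J. (a j)\<^sup>2 * (1 / ?d\<^sup>2))"
    unfolding vv
  proof (rule sum_mono)
    fix j assume j: "j \<in> J"
    have "(b j)\<^sup>2 = (a j)\<^sup>2 * (1 / (lam j - lam k)\<^sup>2)"
      by (simp add: b_def power_divide)
    also have "\<dots> \<le> (a j)\<^sup>2 * (1 / ?d\<^sup>2)"
      using d0 gap(2)[OF j] by (intro mult_left_mono divide_left_mono power_mono) auto
    finally show "(b j)\<^sup>2 \<le> (a j)\<^sup>2 * (1 / ?d\<^sup>2)" .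
  qed
  then have "(l2_norm M v)\<^sup>2 \<le> S * (1 / ?d\<^sup>2)"
    by (simp only: S_def sum_distrib_right)
  then have "sqrt ((l2_norm M v)\<^sup>2) \<le> sqrt (S * (1 / ?d\<^sup>2))" by (rule real_sqrt_le_mono)
  also have "\<dots> = sqrt S / ?d"
    using d0 by (simp add: real_sqrt_mult real_sqrt_divide)
  finally have b2: "l2_norm M v \<le> sqrt S / ?d" using l2_norm_nonneg[of M v] by simp

  \<comment> \<open>Factoring \<open>?d\<close> as a difference of squares cancels the sum of roots
    produced by the two terms of the bound.\<close>
  define e where "e = sqrt r - sqrt (lam k)"
  have e0: "0 < e" using gap(1) l0 by (simp add: e_def)
  have de: "?d = e * (sqrt r + sqrt (lam k))"
    using r0 l0 by (simp add: e_def algebra_simps)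
  have srk: "0 < sqrt r + sqrt (lam k)" using r0 l0 by (simp add: add_pos_nonneg)
  have "sqrt (l2_inner M v (L v)) + l2_norm M v * sqrt (lam k)
      \<le> sqrt S * sqrt r / ?d + sqrt S / ?d * sqrt (lam k)"
    using b1 b2 l0 by (intro add_mono mult_right_mono) auto
  also have "\<dots> = sqrt S * (sqrt r + sqrt (lam k)) / ?d"
    by (simp add: add_divide_distrib distrib_left)
  also have "\<dots> = sqrt S / e"
    unfolding de using srk by simp
  finally have "S \<le> sqrt G * (sqrt S / e)"
    using S_le f(3) by (meson mult_left_mono order_trans real_sqrt_ge_zero)
  then have "S * e \<le> sqrt G * sqrt S" using e0 by (simp add: pos_le_divide_eq)
  then have "(S * e)\<^sup>2 \<le> (sqrt G * sqrt S)\<^sup>2" using S0 e0 by (intro power_mono) auto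
  then have *: "S * (S * e\<^sup>2) \<le> S * G"
    using S0 f(3) by (simp add: power_mult_distrib power2_eq_square mult_ac)
  \<comment> \<open>The estimate has \<open>S\<close> on both sides, with its square root on the
    right; squaring and cancelling one factor \<open>S\<close> needs \<open>S = 0\<close> treated
    apart.\<close>
  have "S * e\<^sup>2 \<le> G"
  proof (cases "S = 0")
    case True
    then show ?thesis using f(3) by simp
  next
    case False
    then show ?thesis using * S0 by simp
  qed
  then show ?thesis by (simp add: S_def a_def e_def)
qed

text \<open>The remainder is the coefficient mass beyond \<open>n\<close>. Each finite part of it
  obeys \<open>off_diagonal_bound\<close> with threshold \<open>lam n\<close>, uniformly in the
  part, and the mass left outside is arbitrarily small.\<close>

lemma bessel_remainder_bound:
  assumes f: "f \<in> \<A>" "AE x in M. \<Gamma> f f x \<le> G" "0 \<le> G"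
    and n: "n \<in> I" and k: "k \<in> {1..n}" and gap: "lam k < lam n"
  shows "((l2_norm M (\<lambda>x. f x * \<phi> k x))\<^sup>2 - (\<Sum>l=1..n. (l2_inner M (\<lambda>x. f x * \<phi> k x) (\<phi> l))\<^sup>2))
      * (sqrt (lam n) - sqrt (lam k))\<^sup>2 \<le> G"
proof -
  define g where "g = (\<lambda>x. f x * \<phi> k x)"
  define d where "d = (sqrt (lam n) - sqrt (lam k))\<^sup>2"
  have sub: "{1..n} \<subseteq> I"
  proof
    fix j assume "j \<in> {1..n}"
    then have "1 \<le> j" "enat j \<le> enat n" by auto
    moreover from this n have "enat j \<le> N" unfolding eigen_indices_def by (blast intro: order_trans)
    ultimately show "j \<in> I" unfolding eigen_indices_def by simp
  qed
  have kI: "k \<in> I" using sub k by auto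
  have gL: "g \<in> L2 M" unfolding g_def by (intro A_L2 A_mult f phi_A kI)
  have d0: "0 < d" using gap lam_nonneg[OF kI] by (simp add: d_def)
  let ?R = "(l2_norm M g)\<^sup>2 - (\<Sum>l=1..n. (l2_inner M g (\<phi> l))\<^sup>2)"
  have "?R * d \<le> G + e" if e: "0 < e" for e
  proof -
    \<comment> \<open>The tolerance is \<open>e / d\<close> because the remainder is multiplied by
      \<open>d\<close> afterwards.\<close>
    have "0 < e / d" using e d0 by simp
    then obtain K where K: "finite K" "{1..n} \<subseteq> K" "K \<subseteq> I"
      "(l2_norm M g)\<^sup>2 - (\<Sum>l\<in>K. (l2_inner M g (\<phi> l))\<^sup>2) < e / d"
      using bessel_remainder_arbitrarily_small[OF orthonormal_phi gL _ _ sub] by blast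
    let ?J = "K - {1..n}"
    have "(\<Sum>j\<in>?J. (l2_inner M g (\<phi> j))\<^sup>2) * d \<le> G"
      unfolding g_def d_def
    proof (rule off_diagonal_bound[OF f kI])
      fix j assume j: "j \<in> ?J"
      \<comment> \<open>Being outside \<open>{1..n}\<close> would still allow index 0; membership in
        \<open>I\<close> excludes it.\<close>
      then have "1 \<le> j" using K(3) by (auto simp: eigen_indices_def)
      with j have "n \<le> j" by auto
      then show "lam n \<le> lam j" using j K(3) n by (intro lam_mono) auto
    qed (use K gap in auto)
    moreover have "(\<Sum>l\<in>K. (l2_inner M g (\<phi> l))\<^sup>2)
        = (\<Sum>j\<in>?J. (l2_inner M g (\<phi> j))\<^sup>2) + (\<Sum>l=1..n. (l2_inner M g (\<phi> l))\<^sup>2)"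
      using K by (intro sum.subset_diff) auto
    ultimately have "?R < e / d + (\<Sum>j\<in>?J. (l2_inner M g (\<phi> j))\<^sup>2)"
      using K(4) by simp
    then have "?R * d \<le> (e / d + (\<Sum>j\<in>?J. (l2_inner M g (\<phi> j))\<^sup>2)) * d"
      using d0 by (intro mult_right_mono) auto
    also have "\<dots> = e + (\<Sum>j\<in>?J. (l2_inner M g (\<phi> j))\<^sup>2) * d"
      using d0 by (simp add: distrib_right)
    also have "\<dots> \<le> G + e"
      using \<open>(\<Sum>j\<in>?J. (l2_inner M g (\<phi> j))\<^sup>2) * d \<le> G\<close> by simp
    finally show ?thesis .
  qed
  then have "?R * d \<le> G" by (rule field_le_epsilon)
  then show ?thesis by (simp add: g_def d_def)
qed

end

section \<open>The variance of a linear statistic\<close>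

lemma det_mat_1: "Determinant.det (mat 1 1 F) = (F (0, 0) :: real)"
  by (subst det_single) auto

lemma det_mat_2:
  "Determinant.det (mat 2 2 F) = (F (0, 0) * F (1, 1) - F (0, 1) * F (1, 0) :: real)"
proof -
  let ?A = "mat 2 2 F"
  have "Determinant.det ?A = (\<Sum>i<2. ?A $$ (i, 0) * cofactor ?A i 0)"
    by (rule laplace_expansion_column[of _ 2]) auto
  also have "\<dots> = ?A $$ (0, 0) * cofactor ?A 0 0 + ?A $$ (1, 0) * cofactor ?A 1 0"
    by (simp add: numeral_2_eq_2)
  also have "cofactor ?A 0 0 = F (1, 1)"
    unfolding cofactor_def by (subst det_single) (auto simp: mat_delete_def)
  also have "cofactor ?A 1 0 = - F (0, 1)"
    unfolding cofactor_def by (subst det_single) (auto simp: mat_delete_def)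
  finally show ?thesis by simp
qed

lemma sum_distinct_tuples_1:
  "(\<Sum>x\<in>distinct_tuples 1 s. h (x 0)) = (\<Sum>y\<in>s. h y)"
  by (rule sum.reindex_bij_witness[where j = "\<lambda>x. x 0" and i = "\<lambda>y. \<lambda>i\<in>{..<1}. y"])
    (auto simp: distinct_tuples_def PiE_iff extensional_def restrict_def fun_eq_iff inj_on_def)

lemma sum_distinct_tuples_2:
  fixes h :: "'a \<Rightarrow> real"
  assumes "finite s"
  shows "(\<Sum>x\<in>distinct_tuples 2 s. h (x 0) * h (x 1)) = (\<Sum>y\<in>s. h y)\<^sup>2 - (\<Sum>y\<in>s. (h y)\<^sup>2)"
proof -
  have two: "{..<2::nat} = {0, 1}" by auto
  have "(\<Sum>x\<in>distinct_tuples 2 s. h (x 0) * h (x 1))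
      = (\<Sum>(y, z)\<in>(SIGMA y:s. s - {y}). h y * h z)"
    by (rule sum.reindex_bij_witness[where j = "\<lambda>x. (x 0, x 1)"
          and i = "\<lambda>(y, z). \<lambda>i\<in>{..<2}. if i = 0 then y else z"])
      (auto simp: two distinct_tuples_def PiE_iff extensional_def restrict_def fun_eq_iff inj_on_def)
  also have "\<dots> = (\<Sum>y\<in>s. \<Sum>z\<in>s - {y}. h y * h z)"
    using assms by (intro sum.Sigma[symmetric]) auto
  also have "\<dots> = (\<Sum>y\<in>s. (\<Sum>z\<in>s. h y * h z) - h y * h y)"
    using assms by (intro sum.cong refl) (simp add: sum_diff1)
  also have "\<dots> = (\<Sum>y\<in>s. h y)\<^sup>2 - (\<Sum>y\<in>s. (h y)\<^sup>2)"
    by (simp add: sum_subtractf power2_eq_square sum_product)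
  finally show ?thesis .
qed

lemma spectral_dpp_has_bochner_integral:
  assumes "spectral_dpp \<Omega> M \<phi> n X" "F \<in> borel_measurable (\<Pi>\<^sub>M i\<in>{..<j}. M)"
    "\<And>x. x \<in> space (\<Pi>\<^sub>M i\<in>{..<j}. M) \<Longrightarrow> \<bar>F x\<bar> \<le> C"
  shows "has_bochner_integral \<Omega> (\<lambda>\<omega>. \<Sum>x\<in>distinct_tuples j (X \<omega>). F x)
    (\<integral>x. F x * Determinant.det (mat j j (\<lambda>(a, b). spectral_kernel \<phi> n (x a) (x b)))
      \<partial>(\<Pi>\<^sub>M i\<in>{..<j}. M))"
  using assms unfolding spectral_dpp_def by blast

context sigma_finite_measure begin

interpretation PM: product_sigma_finite "\<lambda>i::nat. M" by unfold_locales

lemma integrable_bounded_mult_phi: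
  assumes "h \<in> borel_measurable M" "\<And>x. \<bar>h x\<bar> \<le> C" "u \<in> L2 M" "v \<in> L2 M"
  shows "integrable M (\<lambda>x. h x * u x * v x)"
  using assms by (intro L2_integrable_mult[OF L2_bounded_mult[of h M C u]]) auto

text \<open>For one point the determinant is the diagonal of the kernel. The bound on
  \<open>h\<close> holds at every point, not just almost everywhere, since the defining formula of
  the process asks for that.\<close>

lemma spectral_dpp_first_moment:
  assumes dpp: "spectral_dpp \<Omega> M \<phi> n X" and phi: "\<And>k. k \<in> {1..n} \<Longrightarrow> \<phi> k \<in> L2 M"
    and h: "h \<in> borel_measurable M" "\<And>x. \<bar>h x\<bar> \<le> C"
  shows "has_bochner_integral \<Omega> (\<lambda>\<omega>. \<Sum>x\<in>X \<omega>. h x) (\<Sum>k=1..n. \<integral>x. h x * \<phi> k x * \<phi> k x \<partial>M)"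
proof -
  let ?P = "\<Pi>\<^sub>M i\<in>{..<1::nat}. M"
  let ?g = "\<lambda>k x. h x * \<phi> k x * \<phi> k x"
  have gi: "integrable M (?g k)" if "k \<in> {1..n}" for k
    by (rule integrable_bounded_mult_phi[OF h]) (intro phi that)+
  have "has_bochner_integral \<Omega> (\<lambda>\<omega>. \<Sum>x\<in>distinct_tuples 1 (X \<omega>). h (x 0))
      (\<integral>x. h (x 0) * Determinant.det (mat 1 1 (\<lambda>(a, b). spectral_kernel \<phi> n (x a) (x b))) \<partial>?P)"
    using h by (intro spectral_dpp_has_bochner_integral[OF dpp]) auto
  moreover have "(\<integral>x. h (x 0) * Determinant.det (mat 1 1 (\<lambda>(a, b). spectral_kernel \<phi> n (x a) (x b))) \<partial>?P)
      = (\<integral>x. (\<Sum>k=1..n. \<Prod>i\<in>{..<1}. ?g k (x i)) \<partial>?P)"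
    unfolding det_mat_1 by (simp add: spectral_kernel_def sum_distrib_left mult_ac)
  moreover have "\<dots> = (\<Sum>k=1..n. \<integral>x. (\<Prod>i\<in>{..<1}. ?g k (x i)) \<partial>?P)"
    using gi by (intro Bochner_Integration.integral_sum PM.product_integrable_prod) auto
  moreover have "\<dots> = (\<Sum>k=1..n. \<Prod>i\<in>{..<1::nat}. \<integral>x. ?g k x \<partial>M)"
    using gi by (intro sum.cong PM.product_integral_prod) auto
  moreover have "\<dots> = (\<Sum>k=1..n. \<integral>x. ?g k x \<partial>M)" by simp
  ultimately show ?thesis by (simp only: sum_distinct_tuples_1)
qed

lemma spectral_dpp_second_moment:
  assumes dpp: "spectral_dpp \<Omega> M \<phi> n X" and phi: "\<And>k. k \<in> {1..n} \<Longrightarrow> \<phi> k \<in> L2 M"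
    and h: "h \<in> borel_measurable M" "\<And>x. \<bar>h x\<bar> \<le> C"
  shows "has_bochner_integral \<Omega> (\<lambda>\<omega>. \<Sum>x\<in>distinct_tuples 2 (X \<omega>). h (x 0) * h (x 1))
    ((\<Sum>k=1..n. \<integral>x. h x * \<phi> k x * \<phi> k x \<partial>M)\<^sup>2
      - (\<Sum>k=1..n. \<Sum>l=1..n. (\<integral>x. h x * \<phi> k x * \<phi> l x \<partial>M)\<^sup>2))"
proof -
  let ?P = "\<Pi>\<^sub>M i\<in>{..<2::nat}. M"
  let ?g = "\<lambda>k l x. h x * \<phi> k x * \<phi> l x"
  let ?c = "\<lambda>k l. \<integral>x. ?g k l x \<partial>M"
  let ?K = "\<lambda>x a b. spectral_kernel \<phi> n (x a) (x b)"
  have gi: "integrable M (?g k l)" if "k \<in> {1..n}" "l \<in> {1..n}" for k l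
    by (rule integrable_bounded_mult_phi[OF h]) (intro phi that)+
  have two: "{..<2::nat} = {0, 1}" by auto
  \<comment> \<open>Expanding the kernel turns the determinant into a double sum in which each pair
    (k, l) contributes the diagonal product \<open>A\<close> minus the off-diagonal product
    \<open>B\<close>. Both are products over the coordinates, so their integrals factorise.\<close>
  define A where "A k l i = (if i = (0::nat) then ?g k k else ?g l l)" for k l i
  define B where "B k l i = ?g k l" for k l and i :: nat
  have Ai: "integrable M (A k l i)" and Bi: "integrable M (B k l i)"
    if "k \<in> {1..n}" "l \<in> {1..n}" for k l i
    using gi that unfolding A_def B_def by auto
  \<comment> \<open>Since \<open>h\<close> is bounded at every point, any point at all shows that
    \<open>C\<close> is nonnegative.\<close>
  have C0: "0 \<le> C" using h(2)[of undefined] by simp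
  have "has_bochner_integral \<Omega> (\<lambda>\<omega>. \<Sum>x\<in>distinct_tuples 2 (X \<omega>). h (x 0) * h (x 1))
      (\<integral>x. h (x 0) * h (x 1) * Determinant.det (mat 2 2 (\<lambda>(a, b). ?K x a b)) \<partial>?P)"
  proof (rule spectral_dpp_has_bochner_integral[OF dpp])
    show "(\<lambda>x. h (x 0) * h (x 1)) \<in> borel_measurable ?P"
      using h(1) by measurable
    show "\<bar>h (x 0) * h (x 1)\<bar> \<le> C * C" for x :: "nat \<Rightarrow> 'a"
      unfolding abs_mult using h(2) C0 by (intro mult_mono) auto
  qed
  moreover have "h (x 0) * h (x 1) * Determinant.det (mat 2 2 (\<lambda>(a, b). ?K x a b))
      = (\<Sum>k=1..n. \<Sum>l=1..n. (\<Prod>i\<in>{..<2}. A k l i (x i)) - (\<Prod>i\<in>{..<2}. B k l i (x i)))" for x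
  proof -
    have "?K x 0 0 * ?K x 1 1 - ?K x 0 1 * ?K x 1 0
        = (\<Sum>k=1..n. \<Sum>l=1..n. \<phi> k (x 0) * \<phi> k (x 0) * (\<phi> l (x 1) * \<phi> l (x 1))
            - \<phi> k (x 0) * \<phi> k (x 1) * (\<phi> l (x 1) * \<phi> l (x 0)))"
      unfolding spectral_kernel_def sum_product sum_subtractf ..
    then show ?thesis
      unfolding det_mat_2
      by (simp add: two A_def B_def sum_distrib_left right_diff_distrib mult_ac)
  qed
  moreover have "(\<integral>x. (\<Sum>k=1..n. \<Sum>l=1..n. (\<Prod>i\<in>{..<2}. A k l i (x i)) - (\<Prod>i\<in>{..<2}. B k l i (x i))) \<partial>?P)
      = (\<Sum>k=1..n. \<Sum>l=1..n. (\<Prod>i\<in>{..<2::nat}. \<integral>x. A k l i x \<partial>M) - (\<Prod>i\<in>{..<2::nat}. \<integral>x. B k l i x \<partial>M))"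
  proof -
    have *: "integrable ?P (\<lambda>x. \<Prod>i\<in>{..<2}. A k l i (x i))" "integrable ?P (\<lambda>x. \<Prod>i\<in>{..<2}. B k l i (x i))"
      "(\<integral>x. (\<Prod>i\<in>{..<2}. A k l i (x i)) \<partial>?P) = (\<Prod>i\<in>{..<2::nat}. \<integral>x. A k l i x \<partial>M)"
      "(\<integral>x. (\<Prod>i\<in>{..<2}. B k l i (x i)) \<partial>?P) = (\<Prod>i\<in>{..<2::nat}. \<integral>x. B k l i x \<partial>M)"
      if "k \<in> {1..n}" "l \<in> {1..n}" for k l
      using Ai[OF that] Bi[OF that]
      by (intro PM.product_integrable_prod PM.product_integral_prod; simp)+
    have "(\<integral>x. (\<Sum>k=1..n. \<Sum>l=1..n. (\<Prod>i\<in>{..<2}. A k l i (x i)) - (\<Prod>i\<in>{..<2}. B k l i (x i))) \<partial>?P)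
      = (\<Sum>k=1..n. \<integral>x. (\<Sum>l=1..n. (\<Prod>i\<in>{..<2}. A k l i (x i)) - (\<Prod>i\<in>{..<2}. B k l i (x i))) \<partial>?P)"
      by (rule Bochner_Integration.integral_sum)
        (intro Bochner_Integration.integrable_sum Bochner_Integration.integrable_diff *; assumption)
    also have "\<dots> = (\<Sum>k=1..n. \<Sum>l=1..n. \<integral>x. (\<Prod>i\<in>{..<2}. A k l i (x i)) - (\<Prod>i\<in>{..<2}. B k l i (x i)) \<partial>?P)"
      by (intro sum.cong refl Bochner_Integration.integral_sum)
        (intro Bochner_Integration.integrable_diff *; assumption)
    also have "\<dots> = (\<Sum>k=1..n. \<Sum>l=1..n. (\<Prod>i\<in>{..<2::nat}. \<integral>x. A k l i x \<partial>M) - (\<Prod>i\<in>{..<2::nat}. \<integral>x. B k l i x \<partial>M))"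
      by (intro sum.cong refl, subst Bochner_Integration.integral_diff) (simp_all only: *)
    finally show ?thesis .
  qed
  moreover have "\<dots> = (\<Sum>k=1..n. \<Sum>l=1..n. ?c k k * ?c l l - (?c k l)\<^sup>2)"
    by (simp add: two A_def B_def power2_eq_square)
  moreover have "\<dots> = (\<Sum>k=1..n. ?c k k)\<^sup>2 - (\<Sum>k=1..n. \<Sum>l=1..n. (?c k l)\<^sup>2)"
    by (simp only: sum_subtractf sum_product power2_eq_square)
  ultimately show ?thesis by simp
qed

text \<open>The expected number of points in \<open>B\<close> is the integral of the kernel diagonal
  over \<open>B\<close>, which is 0. This allows \<open>f\<close> to be changed on a null set
  without affecting its linear statistic almost surely.\<close>

lemma spectral_dpp_avoids_null_set:
  assumes dpp: "spectral_dpp \<Omega> M \<phi> n X" and phi: "\<And>k. k \<in> {1..n} \<Longrightarrow> \<phi> k \<in> L2 M"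
    and B: "B \<in> null_sets M"
  shows "AE \<omega> in \<Omega>. X \<omega> \<inter> B = {}"
proof -
  let ?h = "indicator B :: 'a \<Rightarrow> real"
  have fin: "finite (X \<omega>)" if "\<omega> \<in> space \<Omega>" for \<omega>
    using dpp that by (simp add: spectral_dpp_def finite_point_process_def)
  have h: "?h \<in> borel_measurable M" "\<bar>?h x\<bar> \<le> 1" for x using B by (auto simp: indicator_def)
  have "AE x in M. ?h x = 0" using AE_not_in[OF B] by eventually_elim simp
  then have "(\<integral>x. ?h x * \<phi> k x * \<phi> k x \<partial>M) = 0" for k
    by (intro integral_eq_zero_AE) (auto elim!: eventually_mono)
  then have int: "has_bochner_integral \<Omega> (\<lambda>\<omega>. \<Sum>x\<in>X \<omega>. ?h x) 0"
    using spectral_dpp_first_moment[OF dpp _ h] phi by simp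
  then have "AE \<omega> in \<Omega>. (\<Sum>x\<in>X \<omega>. ?h x) = 0"
    using integral_nonneg_eq_0_iff_AE[of \<Omega> "\<lambda>\<omega>. \<Sum>x\<in>X \<omega>. ?h x"]
    by (auto simp: has_bochner_integral_iff intro!: sum_nonneg)
  then show ?thesis
  proof (rule AE_mp, intro AE_I2 impI)
    fix \<omega> assume "\<omega> \<in> space \<Omega>" "(\<Sum>x\<in>X \<omega>. ?h x) = 0"
    then have "\<forall>x\<in>X \<omega>. ?h x = 0"
      using fin by (subst (asm) sum_nonneg_eq_0_iff) auto
    then show "X \<omega> \<inter> B = {}" by (auto simp: indicator_def split: if_splits)
  qed
qed

text \<open>The first moment formula includes measurability, but only for bounded functions;
  truncations of \<open>f\<close> converge to it at every point, hence so do the sums.\<close>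

lemma linear_statistic_measurable:
  assumes dpp: "spectral_dpp \<Omega> M \<phi> n X" and phi: "\<And>k. k \<in> {1..n} \<Longrightarrow> \<phi> k \<in> L2 M"
    and f: "f \<in> borel_measurable M"
  shows "linear_statistic X f \<in> borel_measurable \<Omega>"
proof (rule borel_measurable_LIMSEQ_real)
  let ?t = "\<lambda>m x. if \<bar>f x\<bar> \<le> real m then f x else 0"
  fix m
  show "(\<lambda>\<omega>. \<Sum>x\<in>X \<omega>. ?t m x) \<in> borel_measurable \<Omega>"
    by (rule borel_measurable_has_bochner_integral,
        rule spectral_dpp_first_moment[OF dpp, where C = "real m"]) (use f phi in auto)
next
  let ?t = "\<lambda>m x. if \<bar>f x\<bar> \<le> real m then f x else 0"
  fix \<omega> assume "\<omega> \<in> space \<Omega>"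
  have "(\<lambda>m. \<Sum>x\<in>X \<omega>. ?t m x) \<longlonglongrightarrow> (\<Sum>x\<in>X \<omega>. f x)"
  proof (intro tendsto_sum)
    fix x
    obtain m0 :: nat where m0: "\<bar>f x\<bar> \<le> real m0" using real_arch_simple by blast
    have "\<forall>\<^sub>F m in sequentially. ?t m x = f x"
      using eventually_ge_at_top[of m0] by eventually_elim (use m0 in auto)
    then show "(\<lambda>m. ?t m x) \<longlonglongrightarrow> f x" by (rule tendsto_eventually)
  qed
  then show "(\<lambda>m. \<Sum>x\<in>X \<omega>. ?t m x) \<longlonglongrightarrow> linear_statistic X f \<omega>"
    by (simp add: linear_statistic_def)
qed

lemma spectral_dpp_variance:
  assumes "prob_space \<Omega>" and dpp: "spectral_dpp \<Omega> M \<phi> n X"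
    and phi: "\<And>k. k \<in> {1..n} \<Longrightarrow> \<phi> k \<in> L2 M"
    and f: "f \<in> borel_measurable M" "AE x in M. \<bar>f x\<bar> \<le> C" "0 \<le> C"
  shows "prob_space.variance \<Omega> (linear_statistic X f)
    = (\<Sum>k=1..n. (l2_norm M (\<lambda>x. f x * \<phi> k x))\<^sup>2
        - (\<Sum>l=1..n. (l2_inner M (\<lambda>x. f x * \<phi> k x) (\<phi> l))\<^sup>2))"
proof -
  interpret O: prob_space \<Omega> by fact
  \<comment> \<open>A version of \<open>f\<close> bounded at every point, as the moment formulas
    require.\<close>
  define h where "h x = (if \<bar>f x\<bar> \<le> C then f x else 0)" for x
  have hm: "h \<in> borel_measurable M" using f(1) unfolding h_def by measurable
  have hC: "\<bar>h x\<bar> \<le> C" for x using f(3) by (auto simp: h_def)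
  have fh: "AE x in M. f x = h x" using f(2) by eventually_elim (simp add: h_def)
  let ?S = "\<lambda>\<omega>. \<Sum>x\<in>X \<omega>. h x"
  let ?c = "\<lambda>k l. \<integral>x. h x * \<phi> k x * \<phi> l x \<partial>M"
  have pp: "finite (X \<omega>)" "X \<omega> \<subseteq> space M" if "\<omega> \<in> space \<Omega>" for \<omega>
    using dpp that by (auto simp: spectral_dpp_def finite_point_process_def)

  have "{x \<in> space M. \<not> \<bar>f x\<bar> \<le> C} \<in> null_sets M"
    using f(1,2) by (subst (asm) AE_iff_null) auto
  then have "AE \<omega> in \<Omega>. X \<omega> \<inter> {x \<in> space M. \<not> \<bar>f x\<bar> \<le> C} = {}"
    by (intro spectral_dpp_avoids_null_set[OF dpp] phi)
  then have AE_eq: "AE \<omega> in \<Omega>. linear_statistic X f \<omega> = ?S \<omega>"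
  proof (rule AE_mp, intro AE_I2 impI)
    fix \<omega> assume "\<omega> \<in> space \<Omega>" "X \<omega> \<inter> {x \<in> space M. \<not> \<bar>f x\<bar> \<le> C} = {}"
    then have "\<forall>x\<in>X \<omega>. f x = h x" using pp by (fastforce simp: h_def)
    then show "linear_statistic X f \<omega> = ?S \<omega>" by (simp add: linear_statistic_def)
  qed
  have m1: "has_bochner_integral \<Omega> ?S (\<Sum>k=1..n. ?c k k)"
    by (rule spectral_dpp_first_moment[OF dpp _ hm hC]) (rule phi)
  have Sm: "linear_statistic X f \<in> borel_measurable \<Omega>" "?S \<in> borel_measurable \<Omega>"
    using m1 by (auto simp: has_bochner_integral_iff intro!: linear_statistic_measurable[OF dpp _ f(1)] phi)
  have "O.expectation (linear_statistic X f) = O.expectation ?S"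
    using AE_eq Sm by (intro integral_cong_AE) auto
  then have "O.variance (linear_statistic X f) = O.variance ?S"
    using AE_eq Sm by (intro integral_cong_AE) auto
  also have "\<dots> = (\<Sum>k=1..n. \<integral>x. (h x)\<^sup>2 * \<phi> k x * \<phi> k x \<partial>M) - (\<Sum>k=1..n. \<Sum>l=1..n. (?c k l)\<^sup>2)"
  proof -
    have "has_bochner_integral \<Omega> (\<lambda>\<omega>. (\<Sum>x\<in>X \<omega>. (h x)\<^sup>2)) (\<Sum>k=1..n. \<integral>x. (h x)\<^sup>2 * \<phi> k x * \<phi> k x \<partial>M)"
    proof (rule spectral_dpp_first_moment[OF dpp phi, where C = "C\<^sup>2"])
      show "\<bar>(h x)\<^sup>2\<bar> \<le> C\<^sup>2" for x
        using hC[of x] f(3) by (simp add: abs_le_square_iff[symmetric])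
    qed (use hm in auto)
    moreover have "has_bochner_integral \<Omega> (\<lambda>\<omega>. \<Sum>x\<in>distinct_tuples 2 (X \<omega>). h (x 0) * h (x 1))
      ((\<Sum>k=1..n. ?c k k)\<^sup>2 - (\<Sum>k=1..n. \<Sum>l=1..n. (?c k l)\<^sup>2))"
      by (rule spectral_dpp_second_moment[OF dpp _ hm hC]) (rule phi)
    ultimately have "has_bochner_integral \<Omega> (\<lambda>\<omega>. (\<Sum>x\<in>X \<omega>. (h x)\<^sup>2) + (\<Sum>x\<in>distinct_tuples 2 (X \<omega>). h (x 0) * h (x 1)))
      ((\<Sum>k=1..n. \<integral>x. (h x)\<^sup>2 * \<phi> k x * \<phi> k x \<partial>M)
        + ((\<Sum>k=1..n. ?c k k)\<^sup>2 - (\<Sum>k=1..n. \<Sum>l=1..n. (?c k l)\<^sup>2)))"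
      by (rule has_bochner_integral_add)
    moreover have "(\<Sum>x\<in>X \<omega>. (h x)\<^sup>2) + (\<Sum>x\<in>distinct_tuples 2 (X \<omega>). h (x 0) * h (x 1)) = (?S \<omega>)\<^sup>2"
      if "\<omega> \<in> space \<Omega>" for \<omega>
      using sum_distinct_tuples_2[OF pp(1)[OF that], of h] by simp
    ultimately have m2: "has_bochner_integral \<Omega> (\<lambda>\<omega>. (?S \<omega>)\<^sup>2)
      ((\<Sum>k=1..n. \<integral>x. (h x)\<^sup>2 * \<phi> k x * \<phi> k x \<partial>M)
        + ((\<Sum>k=1..n. ?c k k)\<^sup>2 - (\<Sum>k=1..n. \<Sum>l=1..n. (?c k l)\<^sup>2)))"
      using has_bochner_integral_cong[of \<Omega> \<Omega>] by (metis (no_types, lifting))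
    \<comment> \<open>The square of the first moment contained in \<open>m2\<close> cancels against
      the squared expectation.\<close>
    have "O.variance ?S = O.expectation (\<lambda>\<omega>. (?S \<omega>)\<^sup>2) - (O.expectation ?S)\<^sup>2"
      using m1 m2 by (intro O.variance_eq) (auto simp: has_bochner_integral_iff)
    then show ?thesis using m1 m2 by (simp add: has_bochner_integral_integral_eq)
  qed
  also have "\<dots> = (\<Sum>k=1..n. (l2_norm M (\<lambda>x. f x * \<phi> k x))\<^sup>2
        - (\<Sum>l=1..n. (l2_inner M (\<lambda>x. f x * \<phi> k x) (\<phi> l))\<^sup>2))"
    unfolding sum_subtractf[symmetric]
  proof (intro sum.cong refl arg_cong2[where f = "(-)"])
    fix k assume k: "k \<in> {1..n}"
    show "(\<integral>x. (h x)\<^sup>2 * \<phi> k x * \<phi> k x \<partial>M) = (l2_norm M (\<lambda>x. f x * \<phi> k x))\<^sup>2"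
      unfolding l2_norm_power2 l2_inner_def
    proof (rule integral_cong_AE)
      show "AE x in M. (h x)\<^sup>2 * \<phi> k x * \<phi> k x = f x * \<phi> k x * (f x * \<phi> k x)"
        using fh by eventually_elim (simp add: power2_eq_square mult_ac)
    qed (use hm f(1) L2_measurable[OF phi[OF k]] in auto)
    fix l assume l: "l \<in> {1..n}"
    show "(?c k l)\<^sup>2 = (l2_inner M (\<lambda>x. f x * \<phi> k x) (\<phi> l))\<^sup>2"
      unfolding l2_inner_def
    proof (rule arg_cong[where f = "\<lambda>a. a\<^sup>2"], rule integral_cong_AE)
      show "AE x in M. h x * \<phi> k x * \<phi> l x = f x * \<phi> k x * \<phi> l x"
        using fh by eventually_elim simp
    qed (use hm f(1) L2_measurable[OF phi[OF k]] L2_measurable[OF phi[OF l]] in auto)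
  qed
  finally show ?thesis .
qed

end

section \<open>Interpolation and summation\<close>

text \<open>After division by the sum, the two fractions lie in the unit interval, add up to 1, and
  do not decrease when raised to a power at most 1.\<close>

lemma powr_add_le_add_powr:
  fixes x y b :: real
  assumes "0 \<le> x" "0 \<le> y" "0 \<le> b" "b \<le> 1"
  shows "(x + y) powr b \<le> x powr b + y powr b"
proof (cases "x + y = 0")
  case True
  then show ?thesis by simp
next
  case False
  define s where "s = x + y"
  have s: "0 < s" using False assms by (simp add: s_def)
  have le: "z / s \<le> (z / s) powr b" if "0 \<le> z" "z \<le> s" for z
    using powr_mono'[of b 1 "z / s"] assms that s by simp
  have "1 = x / s + y / s"
    using s by (simp add: s_def add_divide_distrib[symmetric])
  also have "\<dots> \<le> (x / s) powr b + (y / s) powr b"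
    using assms by (intro add_mono le) (auto simp: s_def)
  also have "\<dots> = (x powr b + y powr b) / s powr b"
    by (simp add: powr_divide add_divide_distrib)
  finally have "s powr b \<le> x powr b + y powr b"
    using s by (simp add: pos_le_divide_eq)
  then show ?thesis by (simp add: s_def)
qed

text \<open>Written with square roots the exponent becomes 2\<alpha>, and \<alpha> \<le> 1/2 is what
  makes that power subadditive.\<close>

lemma powr_diff_le_sqrt_diff_powr:
  fixes r l \<alpha> :: real
  assumes "0 \<le> l" "l \<le> r" "0 \<le> \<alpha>" "\<alpha> \<le> 1 / 2"
  shows "r powr \<alpha> - l powr \<alpha> \<le> (sqrt r - sqrt l) powr (2 * \<alpha>)"
proof -
  have eq: "sqrt x powr (2 * \<alpha>) = x powr \<alpha>" if "0 \<le> x" for x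
    using that by (simp add: powr_half_sqrt[symmetric] powr_powr)
  have "(sqrt l + (sqrt r - sqrt l)) powr (2 * \<alpha>)
      \<le> sqrt l powr (2 * \<alpha>) + (sqrt r - sqrt l) powr (2 * \<alpha>)"
    using assms by (intro powr_add_le_add_powr) auto
  then show ?thesis using assms by (simp add: eq)
qed

text \<open>\<open>Gamma\<close> is log-convex and equals 1 at both 1 and 2, so its logarithm is
  nonpositive in between.\<close>

lemma Gamma_real_le_1:
  fixes t :: real
  assumes "0 \<le> t" "t \<le> 1"
  shows "Gamma (1 + t) \<le> 1"
proof -
  have "(ln \<circ> Gamma) ((1 - t) *\<^sub>R 1 + t *\<^sub>R 2)
      \<le> (1 - t) * (ln \<circ> Gamma) 1 + t * (ln \<circ> Gamma) (2 :: real)"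
    using assms by (intro convex_onD[OF log_convex_Gamma_real]) auto
  moreover have "(1 - t) *\<^sub>R 1 + t *\<^sub>R 2 = 1 + t" by simp
  moreover have "Gamma (2 :: real) = 1" using Gamma_fact[of 1, where 'a = real] by simp
  ultimately have "ln (Gamma (1 + t)) \<le> 0" by (simp add: add.commute)
  moreover have "0 < Gamma (1 + t)" using assms by (intro Gamma_real_pos) simp
  ultimately show ?thesis by simp
qed

text \<open>The functional equation gives \<open>(1 - \<alpha>) * Gamma (1 - \<alpha>) = Gamma (2 -
  \<alpha>) \<le> 1\<close>, and 1 - 2\<alpha> is smaller than 1 - \<alpha>.\<close>

lemma interpolation_constant_ge_1:
  fixes \<alpha> :: real
  assumes "0 < \<alpha>" "\<alpha> < 1 / 2"
  shows "1 \<le> 2 / ((1 - 2 * \<alpha>) * Gamma (1 - \<alpha>))"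
proof -
  have pos: "0 < Gamma (1 - \<alpha>)" using assms by (intro Gamma_real_pos) simp
  have "1 - \<alpha> \<notin> \<int>\<^sub>\<le>\<^sub>0" using assms by (auto elim!: nonpos_Ints_cases)
  then have "Gamma (1 + (1 - \<alpha>)) = (1 - \<alpha>) * Gamma (1 - \<alpha>)"
    using Gamma_plus1[of "1 - \<alpha>"] by (simp add: add.commute)
  then have "(1 - \<alpha>) * Gamma (1 - \<alpha>) \<le> 1" using Gamma_real_le_1[of "1 - \<alpha>"] assms by simp
  moreover have "(1 - 2 * \<alpha>) * Gamma (1 - \<alpha>) \<le> (1 - \<alpha>) * Gamma (1 - \<alpha>)"
    using assms pos by (intro mult_right_mono) auto
  ultimately have "(1 - 2 * \<alpha>) * Gamma (1 - \<alpha>) \<le> 2" by linarith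
  then show ?thesis using pos assms by (simp add: pos_le_divide_eq)
qed

text \<open>\<open>A\<close> is split as
  \<open>A powr (1 - 2 * \<alpha>) * A powr (2 * \<alpha>)\<close>, the first factor bounded through
  \<open>F\<close> and the second through \<open>G\<close>. This splitting needs positive
  \<open>A\<close>; otherwise the right-hand side, being nonnegative, suffices.\<close>

lemma interpolate_bounds:
  fixes A F G c r l \<alpha> :: real
  assumes F: "0 \<le> F" "A \<le> F\<^sup>2" and G: "0 \<le> G" "A * (sqrt r - sqrt l)\<^sup>2 \<le> G"
    and l: "0 \<le> l" "l < r" and \<alpha>: "0 < \<alpha>" "\<alpha> < 1 / 2" and c: "1 \<le> c"
  shows "A \<le> (c * G powr \<alpha> * F powr (1 - 2 * \<alpha>))\<^sup>2 / (r powr \<alpha> - l powr \<alpha>)\<^sup>2"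
proof (cases "0 < A")
  case False
  then have "A \<le> 0" by simp
  also have "0 \<le> (c * G powr \<alpha> * F powr (1 - 2 * \<alpha>))\<^sup>2 / (r powr \<alpha> - l powr \<alpha>)\<^sup>2" by simp
  finally show ?thesis .
next
  case True
  define e where "e = sqrt r - sqrt l"
  have e: "0 < e" using l by (simp add: e_def)
  have d: "0 < r powr \<alpha> - l powr \<alpha>" using powr_less_mono2[OF \<alpha>(1) l] by simp
  have de: "r powr \<alpha> - l powr \<alpha> \<le> e powr (2 * \<alpha>)"
    unfolding e_def using l \<alpha> by (intro powr_diff_le_sqrt_diff_powr) auto
  have sq: "(x\<^sup>2) powr b = (x powr b)\<^sup>2" for x b :: real
    by (simp add: power2_eq_square powr_mult)
  have "A = A powr (1 - 2 * \<alpha>) * A powr (2 * \<alpha>)"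
    using True by (simp add: powr_add[symmetric])
  also have "\<dots> \<le> (F\<^sup>2) powr (1 - 2 * \<alpha>) * (G / e\<^sup>2) powr (2 * \<alpha>)"
    using True F G e \<alpha> by (intro mult_mono powr_mono2) (auto simp: e_def pos_le_divide_eq)
  also have "\<dots> = (G powr \<alpha> * F powr (1 - 2 * \<alpha>))\<^sup>2 / (e powr (2 * \<alpha>))\<^sup>2"
  proof -
    have "G powr (2 * \<alpha>) = (G powr \<alpha>)\<^sup>2"
      by (simp add: power2_eq_square powr_add[symmetric])
    then show ?thesis by (simp add: powr_divide sq power_mult_distrib)
  qed
  also have "\<dots> \<le> (c * G powr \<alpha> * F powr (1 - 2 * \<alpha>))\<^sup>2 / (r powr \<alpha> - l powr \<alpha>)\<^sup>2"
  proof (intro frac_le power_mono)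
    have "1 * (G powr \<alpha> * F powr (1 - 2 * \<alpha>)) \<le> c * (G powr \<alpha> * F powr (1 - 2 * \<alpha>))"
      using c by (intro mult_right_mono) auto
    then show "G powr \<alpha> * F powr (1 - 2 * \<alpha>) \<le> c * G powr \<alpha> * F powr (1 - 2 * \<alpha>)"
      by (simp add: mult.assoc)
  qed (use d de in auto)
  finally show ?thesis .
qed

lemma sum_inverse_squares_le: "(\<Sum>p=1..m. 1 / (real p)\<^sup>2) \<le> pi\<^sup>2 / 6"
proof -
  have "(\<Sum>p=1..m. 1 / (real p)\<^sup>2) = (\<Sum>i<m. 1 / (real i + 1)\<^sup>2)"
    by (rule sum.reindex_bij_witness[where i = Suc and j = "\<lambda>p. p - 1"]) auto
  also have "\<dots> \<le> (\<Sum>i. 1 / (real i + 1)\<^sup>2)"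
    using inverse_squares_sums by (intro sum_le_suminf) (auto simp: sums_iff add.commute)
  also have "\<dots> = pi\<^sup>2 / 6"
    using inverse_squares_sums by (simp add: sums_iff add.commute)
  finally show ?thesis .
qed

section \<open>Counting eigenvalues in spectral shells\<close>

context markov_eigenbasis begin

lemma Iic_subset_I: "n \<in> I \<Longrightarrow> {1..n} \<subseteq> I"
  by (auto simp: eigen_indices_def intro: order_trans[of _ "enat n"])

lemma
  shows eigen_count_le_R_const: "real (eigen_count N lam 1) \<le> R_const N lam \<alpha> n"
    and eigen_count_diff_le_R_const: "int p \<le> \<lfloor>lam n powr \<alpha>\<rfloor> - 1 \<Longrightarrow>
      real (eigen_count N lam ((lam n powr \<alpha> - real p) powr (1 / \<alpha>)))
        - real (eigen_count N lam ((lam n powr \<alpha> - real p - 1) powr (1 / \<alpha>))) \<le> R_const N lam \<alpha> n"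
proof -
  let ?d = "\<lambda>p. real (eigen_count N lam ((lam n powr \<alpha> - real p) powr (1 / \<alpha>)))
        - real (eigen_count N lam ((lam n powr \<alpha> - real p - 1) powr (1 / \<alpha>)))"
  \<comment> \<open>\<open>Max\<close> is only meaningful on a finite set. When the floor is 0 no
    natural \<open>p\<close> qualifies, so only the inserted element remains, as the omitted inner
    maximum demands.\<close>
  have "{p :: nat. int p \<le> \<lfloor>lam n powr \<alpha>\<rfloor> - 1} \<subseteq> {..nat (\<lfloor>lam n powr \<alpha>\<rfloor> - 1)}" by auto
  then have "finite {p :: nat. int p \<le> \<lfloor>lam n powr \<alpha>\<rfloor> - 1}" by (rule finite_subset) simp
  then have fin: "finite (insert (real (eigen_count N lam 1)) {?d p | p. int p \<le> \<lfloor>lam n powr \<alpha>\<rfloor> - 1})"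
    by simp
  show "real (eigen_count N lam 1) \<le> R_const N lam \<alpha> n"
    unfolding R_const_def by (rule Max_ge[OF fin]) simp
  show "?d p \<le> R_const N lam \<alpha> n" if "int p \<le> \<lfloor>lam n powr \<alpha>\<rfloor> - 1"
    unfolding R_const_def using that by (intro Max_ge[OF fin]) blast
qed

text \<open>Shell \<open>p\<close> is the half-open interval in which
  \<open>lam k powr \<alpha>\<close> exceeds \<open>lam n powr \<alpha> - p - 1\<close> but not
  \<open>lam n powr \<alpha> - p\<close>, which matches a difference of counting functions. In the
  last shell the lower end would be negative; there \<open>lam k\<close> is at most 1 and the count
  at 1 takes over.\<close>

lemma card_spectral_shell_le_R_const:
  assumes n: "n \<in> I" and \<alpha>: "0 < \<alpha>" and p: "int p \<le> \<lfloor>lam n powr \<alpha>\<rfloor>"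
  shows "real (card {k \<in> {1..n}. \<lfloor>lam n powr \<alpha> - lam k powr \<alpha>\<rfloor> = int p}) \<le> R_const N lam \<alpha> n"
proof (cases "int p = \<lfloor>lam n powr \<alpha>\<rfloor>")
  case True
  let ?S = "{k \<in> {1..n}. \<lfloor>lam n powr \<alpha> - lam k powr \<alpha>\<rfloor> = int p}"
  have "?S \<subseteq> {k \<in> I. lam k \<le> 1}"
  proof clarify
    fix k assume k: "k \<in> {1..n}" and eq: "\<lfloor>lam n powr \<alpha> - lam k powr \<alpha>\<rfloor> = int p"
    have "lam k powr \<alpha> < 1" using eq True by linarith
    moreover have "1 \<le> lam k powr \<alpha>" if "1 < lam k" using that \<alpha> by (simp add: ge_one_powr_ge_zero)
    ultimately have "lam k \<le> 1" by force
    then show "k \<in> I \<and> lam k \<le> 1" using k Iic_subset_I[OF n] by auto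
  qed
  then have "card ?S \<le> eigen_count N lam 1"
    unfolding eigen_count_def by (intro card_mono finite_eigenvalues_le)
  then show ?thesis using eigen_count_le_R_const[of \<alpha> n] by linarith
next
  case False
  let ?S = "{k \<in> {1..n}. \<lfloor>lam n powr \<alpha> - lam k powr \<alpha>\<rfloor> = int p}"
  define a where "a = (lam n powr \<alpha> - real p) powr (1 / \<alpha>)"
  define b where "b = (lam n powr \<alpha> - real p - 1) powr (1 / \<alpha>)"
  from False p have p': "int p \<le> \<lfloor>lam n powr \<alpha>\<rfloor> - 1" by simp
  then have pos: "0 \<le> lam n powr \<alpha> - real p - 1" by linarith
  have inv: "(lam k powr \<alpha>) powr (1 / \<alpha>) = lam k" if "k \<in> I" for k
    using lam_nonneg[OF that] \<alpha> by (simp add: powr_powr)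
  have ba: "b \<le> a" unfolding a_def b_def using pos \<alpha> by (intro powr_mono2) auto
  have sub: "?S \<subseteq> {k \<in> I. lam k \<le> a} - {k \<in> I. lam k \<le> b}"
  proof
    fix k assume "k \<in> ?S"
    then have k: "k \<in> I" and eq: "\<lfloor>lam n powr \<alpha> - lam k powr \<alpha>\<rfloor> = int p"
      using Iic_subset_I[OF n] by auto
    have le: "lam k powr \<alpha> \<le> lam n powr \<alpha> - real p" "lam n powr \<alpha> - real p - 1 < lam k powr \<alpha>"
      using eq by linarith+
    have "(lam k powr \<alpha>) powr (1 / \<alpha>) \<le> a"
      unfolding a_def using le \<alpha> by (intro powr_mono2) auto
    moreover have "b < (lam k powr \<alpha>) powr (1 / \<alpha>)"
      unfolding b_def using le pos \<alpha> by (intro powr_less_mono2) auto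
    ultimately show "k \<in> {k \<in> I. lam k \<le> a} - {k \<in> I. lam k \<le> b}"
      using k inv[OF k] by simp
  qed
  have sub2: "{k \<in> I. lam k \<le> b} \<subseteq> {k \<in> I. lam k \<le> a}" using ba by auto
  have "card ?S \<le> card ({k \<in> I. lam k \<le> a} - {k \<in> I. lam k \<le> b})"
    using sub by (intro card_mono finite_Diff finite_eigenvalues_le)
  also have "\<dots> = eigen_count N lam a - eigen_count N lam b"
    unfolding eigen_count_def using sub2 by (intro card_Diff_subset finite_eigenvalues_le)
  finally have "real (card ?S) \<le> real (eigen_count N lam a - eigen_count N lam b)" by simp
  \<comment> \<open>The sets counted are nested, so the subtraction of naturals does not
    truncate.\<close>
  also have "\<dots> = real (eigen_count N lam a) - real (eigen_count N lam b)"
    unfolding eigen_count_def using sub2 by (intro of_nat_diff card_mono finite_eigenvalues_le)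
  also have "\<dots> \<le> R_const N lam \<alpha> n"
    unfolding a_def b_def by (rule eigen_count_diff_le_R_const[OF p'])
  finally show ?thesis .
qed

lemma sum_spectral_gaps_le:
  fixes F C \<alpha> :: real
  assumes n: "n \<in> I" and \<alpha>: "0 < \<alpha>"
  shows "(\<Sum>k=1..n. if lam k = lam n then F\<^sup>2
      else min (F\<^sup>2) (C\<^sup>2 / (lam n powr \<alpha> - lam k powr \<alpha>)\<^sup>2))
    \<le> (F\<^sup>2 + pi\<^sup>2 / 6 * C\<^sup>2) * R_const N lam \<alpha> n"
proof -
  let ?b = "\<lambda>k. if lam k = lam n then F\<^sup>2 else min (F\<^sup>2) (C\<^sup>2 / (lam n powr \<alpha> - lam k powr \<alpha>)\<^sup>2)"
  let ?R = "R_const N lam \<alpha> n"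
  define gap where "gap k = lam n powr \<alpha> - lam k powr \<alpha>" for k
  define p where "p k = nat \<lfloor>gap k\<rfloor>" for k
  define m where "m = nat \<lfloor>lam n powr \<alpha>\<rfloor>"
  \<comment> \<open>An index in shell \<open>q\<close> has gap at least \<open>q\<close> and costs
    at most \<open>w q\<close>. Shell 0, which contains all \<open>k\<close> with
    \<open>lam k = lam n\<close>, gets the trivial bound; the quotient would be 0 there by the
    convention for division by 0.\<close>
  define w where "w q = (if q = 0 then F\<^sup>2 else C\<^sup>2 / (real q)\<^sup>2)" for q :: nat
  have kI: "k \<in> I" if "k \<in> {1..n}" for k using Iic_subset_I[OF n] that by blast
  have gap0: "0 \<le> gap k" if "k \<in> {1..n}" for k
    using lam_mono[OF kI[OF that] n] lam_nonneg[OF kI[OF that]] that \<alpha>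
    by (simp add: gap_def powr_mono2)
  have pm: "p k \<le> m" if "k \<in> {1..n}" for k
    unfolding p_def m_def gap_def by (intro nat_mono floor_mono) simp
  have bw: "?b k \<le> w (p k)" if k: "k \<in> {1..n}" for k
  proof (cases "p k = 0")
    case True
    then show ?thesis by (simp add: w_def)
  next
    case False
    then have "real (p k) \<le> gap k" using gap0[OF k] by (simp add: p_def)
    then have "C\<^sup>2 / (gap k)\<^sup>2 \<le> C\<^sup>2 / (real (p k))\<^sup>2"
      using False by (intro divide_left_mono power_mono) auto
    moreover have "lam k \<noteq> lam n"
      using False by (auto simp: p_def gap_def)
    ultimately show ?thesis using False by (simp add: w_def gap_def min.coboundedI2)
  qed
  have card_le: "real (card {k \<in> {1..n}. p k = q}) \<le> ?R" if q: "q \<le> m" for q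
  proof -
    have "{k \<in> {1..n}. p k = q} = {k \<in> {1..n}. \<lfloor>lam n powr \<alpha> - lam k powr \<alpha>\<rfloor> = int q}"
      using gap0 by (force simp: p_def gap_def)
    moreover have "int q \<le> \<lfloor>lam n powr \<alpha>\<rfloor>" using q by (simp add: m_def le_nat_iff)
    ultimately show ?thesis using card_spectral_shell_le_R_const[OF n \<alpha>] by simp
  qed
  have R0: "0 \<le> ?R" using eigen_count_le_R_const[of \<alpha> n] by linarith
  have "(\<Sum>k=1..n. ?b k) \<le> (\<Sum>k=1..n. w (p k))" by (intro sum_mono bw)
  also have "\<dots> = (\<Sum>q\<le>m. \<Sum>k\<in>{k \<in> {1..n}. p k = q}. w (p k))"
    by (rule sum.group[symmetric]) (use pm in auto)
  also have "\<dots> = (\<Sum>q\<le>m. real (card {k \<in> {1..n}. p k = q}) * w q)"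
    by (intro sum.cong refl) simp
  also have "\<dots> \<le> (\<Sum>q\<le>m. ?R * w q)"
    using card_le by (intro sum_mono mult_right_mono) (auto simp: w_def)
  also have "\<dots> = ?R * (\<Sum>q\<le>m. w q)" by (simp add: sum_distrib_left)
  also have "(\<Sum>q\<le>m. w q) = F\<^sup>2 + C\<^sup>2 * (\<Sum>q=1..m. 1 / (real q)\<^sup>2)"
  proof -
    have "(\<Sum>q\<le>m. w q) = w 0 + (\<Sum>q=1..m. w q)"
      by (simp add: atMost_atLeast0 sum.atLeast_Suc_atMost)
    also have "(\<Sum>q=1..m. w q) = C\<^sup>2 * (\<Sum>q=1..m. 1 / (real q)\<^sup>2)"
      unfolding sum_distrib_left by (intro sum.cong) (auto simp: w_def)
    finally show ?thesis by (simp add: w_def)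
  qed
  also have "?R * (F\<^sup>2 + C\<^sup>2 * (\<Sum>q=1..m. 1 / (real q)\<^sup>2)) \<le> ?R * (F\<^sup>2 + C\<^sup>2 * (pi\<^sup>2 / 6))"
    by (intro mult_left_mono add_left_mono sum_inverse_squares_le R0) simp
  finally show ?thesis by (simp add: mult_ac)
qed

end

section \<open>Assembling the variance bounds\<close>

context markov_core begin

text \<open>Each summand of the variance is a Bessel remainder, to which both the sup norm bound
  and, below \<open>lam n\<close>, the interpolated bound apply. The case distinction stands for the
  infinite fraction at \<open>lam k = lam n\<close>, where division by 0 would make the minimum
  0.\<close>

lemma variance_linear_statistic_le:
  assumes n: "n \<in> I" and "prob_space \<Omega>" and dpp: "spectral_dpp \<Omega> M \<phi> n X"
    and f: "f \<in> \<A>" and finf: "linf_norm M f < \<infinity>" and Ginf: "linf_norm M (\<Gamma> f f) < \<infinity>"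
    and \<alpha>: "0 < \<alpha>" "\<alpha> < 1 / 2"
  shows "prob_space.variance \<Omega> (linear_statistic X f)
    \<le> (\<Sum>k=1..n. if lam k = lam n then (enn2real (linf_norm M f))\<^sup>2
        else min ((enn2real (linf_norm M f))\<^sup>2) ((C_const M L \<alpha> f)\<^sup>2 / (lam n powr \<alpha> - lam k powr \<alpha>)\<^sup>2))"
proof -
  let ?F = "enn2real (linf_norm M f)" and ?G = "enn2real (linf_norm M (\<Gamma> f f))"
  note fm = L2_measurable[OF A_L2[OF f]]
  have kI: "k \<in> I" if "k \<in> {1..n}" for k using Iic_subset_I[OF n] that by blast
  have fF: "AE x in M. \<bar>f x\<bar> \<le> ?F" by (rule linf_norm_AE_le[OF fm finf])
  have "AE x in M. \<bar>\<Gamma> f f x\<bar> \<le> ?G"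
    by (intro linf_norm_AE_le L2_measurable Gamma_L2 f Ginf)
  then have GG: "AE x in M. \<Gamma> f f x \<le> ?G" by eventually_elim simp
  let ?A = "\<lambda>k. (l2_norm M (\<lambda>x. f x * \<phi> k x))\<^sup>2 - (\<Sum>l=1..n. (l2_inner M (\<lambda>x. f x * \<phi> k x) (\<phi> l))\<^sup>2)"
  have "prob_space.variance \<Omega> (linear_statistic X f) = (\<Sum>k=1..n. ?A k)"
    by (rule spectral_dpp_variance[OF assms(2) dpp phi_L2[OF kI] fm fF]) auto
  also have "\<dots> \<le> (\<Sum>k=1..n. if lam k = lam n then ?F\<^sup>2
        else min (?F\<^sup>2) ((C_const M L \<alpha> f)\<^sup>2 / (lam n powr \<alpha> - lam k powr \<alpha>)\<^sup>2))"
  proof (rule sum_mono)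
    fix k assume k: "k \<in> {1..n}"
    have "l2_norm M (\<lambda>x. f x * \<phi> k x) \<le> ?F * l2_norm M (\<phi> k)"
      by (rule l2_norm_bounded_mult[OF fm fF _ phi_L2[OF kI[OF k]]]) simp
    then have "(l2_norm M (\<lambda>x. f x * \<phi> k x))\<^sup>2 \<le> ?F\<^sup>2"
      by (intro power_mono l2_norm_nonneg) (simp add: l2_norm_phi[OF kI[OF k]])
    moreover have "0 \<le> (\<Sum>l=1..n. (l2_inner M (\<lambda>x. f x * \<phi> k x) (\<phi> l))\<^sup>2)"
      by (intro sum_nonneg) simp
    ultimately have A_F: "?A k \<le> ?F\<^sup>2" by linarith
    have "?A k \<le> (C_const M L \<alpha> f)\<^sup>2 / (lam n powr \<alpha> - lam k powr \<alpha>)\<^sup>2" if ne: "lam k \<noteq> lam n"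
    proof -
      have lt: "lam k < lam n" using lam_mono[OF kI[OF k] n] k ne by simp
      show ?thesis
        unfolding C_const_def
      proof (rule interpolate_bounds)
        show "?A k * (sqrt (lam n) - sqrt (lam k))\<^sup>2 \<le> ?G"
          by (rule bessel_remainder_bound[OF f GG _ n k lt]) simp
      qed (use A_F lt \<alpha> lam_nonneg[OF kI[OF k]] interpolation_constant_ge_1[OF \<alpha>] in auto)
    qed
    then show "?A k \<le> (if lam k = lam n then ?F\<^sup>2
        else min (?F\<^sup>2) ((C_const M L \<alpha> f)\<^sup>2 / (lam n powr \<alpha> - lam k powr \<alpha>)\<^sup>2))"
      using A_F by simp
  qed
  finally show ?thesis .
qed

end

theorem theorem3p1:
  fixes M :: "'a::polish_space measure"
    and D DS \<A> :: "('a \<Rightarrow> real) set"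
    and L S :: "('a \<Rightarrow> real) \<Rightarrow> 'a \<Rightarrow> real"
    and P :: "real \<Rightarrow> ('a \<Rightarrow> real) \<Rightarrow> 'a \<Rightarrow> real"
    and N :: enat and \<phi> :: "nat \<Rightarrow> 'a \<Rightarrow> real" and lam :: "nat \<Rightarrow> real"
    and n :: nat
    and \<Omega> :: "'b measure" and X :: "'b \<Rightarrow> 'a set"
    and f :: "'a \<Rightarrow> real" and \<alpha> :: real
  assumes "sets M = sets borel" and "sigma_finite_measure M"
    and "nonneg_self_adjoint M D L"
    and "generated_semigroup M D L P" and "sub_markovian M P"
    and "operator_sqrt M D L DS S"
    and A1: "eigenbasis M D L N \<phi> lam"
    and A2: "algebraic_core M D L \<A>" "\<forall>k\<in>eigen_indices N. \<phi> k \<in> \<A>"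
    and A3: "\<forall>g\<in>\<A>. linf_norm M (carre_du_champ L g g) < \<infinity> \<longrightarrow>
      (\<forall>w\<in>\<A>. dirichlet_form M S (\<lambda>x. g x * w x) (\<lambda>x. g x * w x)
         \<le> 2 * (enn2real (linf_norm M g))\<^sup>2 * dirichlet_form M S w w
           + 2 * enn2real (linf_norm M (carre_du_champ L g g)) * (l2_norm M w)\<^sup>2)"
    and "1 \<le> n" and "enat n \<le> N"
    and "prob_space \<Omega>" and "spectral_dpp \<Omega> M \<phi> n X"
    and "f \<in> \<A>" and "linf_norm M f < \<infinity>" and "linf_norm M (carre_du_champ L f f) < \<infinity>"
    and "0 < \<alpha>" and "\<alpha> < 1 / 2"
  shows "prob_space.variance \<Omega> (linear_statistic X f)
           \<le> (\<Sum>k=1..n.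
                if lam k = lam n then (enn2real (linf_norm M f))\<^sup>2
                else min ((enn2real (linf_norm M f))\<^sup>2)
                       ((C_const M L \<alpha> f)\<^sup>2 / (lam n powr \<alpha> - lam k powr \<alpha>)\<^sup>2))
       \<and> prob_space.variance \<Omega> (linear_statistic X f)
           \<le> ((enn2real (linf_norm M f))\<^sup>2 + pi\<^sup>2 / 6 * (C_const M L \<alpha> f)\<^sup>2) * R_const N lam \<alpha> n"
proof -
  interpret markov_core M D L P N \<phi> lam \<A>
    using assms
    by (intro markov_core.intro markov_eigenbasis.intro markov_eigenbasis_axioms.intro
        markov_core_axioms.intro) auto
  have n: "n \<in> eigen_indices N" using assms(11,12) by (simp add: eigen_indices_def)
  note var_le = variance_linear_statistic_le[OF n assms(13-19)]
  show ?thesis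
    using var_le order_trans[OF var_le sum_spectral_gaps_le[OF n assms(18)]] by blast
qed

end
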